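(* Let $A$ be a noetherian local ring with maximal ideal $\mathfrak{m}$, let $\overline{A}$ be its normalization, let $\mathfrak{b}$ be the conductor of $A$ in $\overline{A}$, and let $\overline{\mathfrak{m}}:=\mathfrak{m}\overline{A}$. Let $\nu:\operatorname{G}(A)\to\operatorname{G}_{\overline{\mathfrak{m}}}(\overline{A})$ be the natural graded ring homomorphism, with degree $n$ components $\nu_n:\mathfrak{m}^n/\mathfrak{m}^{n+1}\to\overline{\mathfrak{m}}^n/\overline{\mathfrak{m}}^{n+1}$. If $\operatorname{Proj}(\operatorname{G}(A))$ is reduced and $\sqrt{\mathfrak{b}}=\mathfrak{m}$, then $\nu_n$ is an isomorphism for all sufficiently large $n$, and in turn this implies that $$\operatorname{Proj}(\operatorname{G}(A))\cong\operatorname{Proj}\left(\operatorname{G}_{\overline{\mathfrak{m}}}(\overline{A})\right).$$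
   Context: All rings are commutative with identity. The normalization $\overline{A}$ of $A$ is the integral closure of $A$ in its total ring of fractions. The conductor of $A$ in $\overline{A}$ is $\mathfrak{b}=\{a\in A : a\overline{A}\subseteq A\}$, which is an ideal of both $A$ and $\overline{A}$; the radical $\sqrt{\mathfrak{b}}$ is taken in $A$. For an ideal $\mathfrak{a}$ of a ring $R$, $\operatorname{G}_{\mathfrak{a}}(R)=\bigoplus_{n\ge 0}\mathfrak{a}^n/\mathfrak{a}^{n+1}$ is the associated graded ring of $R$ with respect to $\mathfrak{a}$ (with $\mathfrak{a}^0=R$), and $\operatorname{G}(A):=\operatorname{G}_{\mathfrak{m}}(A)$. The homomorphism $\nu$ is induced by the inclusion $A\subseteq\overline{A}$: since $\mathfrak{m}^n\subseteq\overline{\mathfrak{m}}^n$ for all $n$, $\nu_n$ sends the class of $f\in\mathfrak{m}^n$ modulo $\mathfrak{m}^{n+1}$ to the class of $f$ modulo $\overline{\mathfrak{m}}^{n+1}$. *)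

theory Defs
  imports "HOL-Analysis.Abstract_Topology" "HOL-Algebra.Algebra"
begin

definition local_ring :: "('a, 'c) ring_scheme \<Rightarrow> 'a set \<Rightarrow> bool" where
  "local_ring R m \<longleftrightarrow> cring R \<and> maximalideal m R \<and> (\<forall>m'. maximalideal m' R \<longrightarrow> m' = m)"

definition reduced_ring :: "('a, 'c) ring_scheme \<Rightarrow> bool" where
  "reduced_ring R \<longleftrightarrow>
     (\<forall>x \<in> carrier R. \<forall>n::nat. x [^]\<^bsub>R\<^esub> n = \<zero>\<^bsub>R\<^esub> \<longrightarrow> x = \<zero>\<^bsub>R\<^esub>)"

definition radical :: "('a, 'c) ring_scheme \<Rightarrow> 'a set \<Rightarrow> 'a set" where
  "radical R I = {x \<in> carrier R. \<exists>n::nat. x [^]\<^bsub>R\<^esub> n \<in> I}"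


section \<open>Localization, normalization, conductor\<close>

text \<open>The fraction \<open>a/s\<close> in \<open>T\<^sup>-\<^sup>1R\<close>, for a multiplicative set \<open>T\<close> which may contain zero divisors.\<close>

definition fraction :: "('a, 'c) ring_scheme \<Rightarrow> 'a set \<Rightarrow> 'a \<Rightarrow> 'a \<Rightarrow> ('a \<times> 'a) set" where
  "fraction R T a s = {(b, t). b \<in> carrier R \<and> t \<in> T \<and>
     (\<exists>u \<in> T. u \<otimes>\<^bsub>R\<^esub> ((a \<otimes>\<^bsub>R\<^esub> t) \<ominus>\<^bsub>R\<^esub> (b \<otimes>\<^bsub>R\<^esub> s)) = \<zero>\<^bsub>R\<^esub>)}"

text \<open>Field selectors are qualified where unrelated library constants share their names.
  As in \<^const>\<open>rcoset_mult\<close>, the operations are unions over all representatives; the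
  classes united are all equal.\<close>

definition localization :: "('a, 'c) ring_scheme \<Rightarrow> 'a set \<Rightarrow> ('a \<times> 'a) set ring" where
  "localization R T =
     \<lparr> carrier = {fraction R T a s | a s. a \<in> carrier R \<and> s \<in> T},
       monoid.mult = (\<lambda>P Q. \<Union>x \<in> P. \<Union>y \<in> Q.
                 fraction R T (fst x \<otimes>\<^bsub>R\<^esub> fst y) (snd x \<otimes>\<^bsub>R\<^esub> snd y)),
       one = fraction R T \<one>\<^bsub>R\<^esub> \<one>\<^bsub>R\<^esub>,
       ring.zero = fraction R T \<zero>\<^bsub>R\<^esub> \<one>\<^bsub>R\<^esub>,
       ring.add = (\<lambda>P Q. \<Union>x \<in> P. \<Union>y \<in> Q.
                fraction R T ((fst x \<otimes>\<^bsub>R\<^esub> snd y) \<oplus>\<^bsub>R\<^esub> (fst y \<otimes>\<^bsub>R\<^esub> snd x)) (snd x \<otimes>\<^bsub>R\<^esub> snd y)) \<rparr>"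

definition regular_elements :: "('a, 'c) ring_scheme \<Rightarrow> 'a set" where
  "regular_elements R =
     {s \<in> carrier R. \<forall>a \<in> carrier R. s \<otimes>\<^bsub>R\<^esub> a = \<zero>\<^bsub>R\<^esub> \<longrightarrow> a = \<zero>\<^bsub>R\<^esub>}"

definition total_fractions :: "('a, 'c) ring_scheme \<Rightarrow> ('a \<times> 'a) set ring" where
  "total_fractions R = localization R (regular_elements R)"

definition to_fractions :: "('a, 'c) ring_scheme \<Rightarrow> 'a \<Rightarrow> ('a \<times> 'a) set" where
  "to_fractions R a = fraction R (regular_elements R) a \<one>\<^bsub>R\<^esub>"

definition integral_over :: "('a, 'c) ring_scheme \<Rightarrow> 'a set \<Rightarrow> 'a \<Rightarrow> bool" where
  "integral_over Q K x \<longleftrightarrow>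
     (\<exists>p \<in> carrier (K[X]\<^bsub>Q\<^esub>). p \<noteq> [] \<and> lead_coeff p = \<one>\<^bsub>Q\<^esub> \<and> ring.eval Q p x = \<zero>\<^bsub>Q\<^esub>)"

definition normalization :: "('a, 'c) ring_scheme \<Rightarrow> ('a \<times> 'a) set ring" where
  "normalization R = (total_fractions R)\<lparr> carrier :=
     {x \<in> carrier (total_fractions R).
        integral_over (total_fractions R) (to_fractions R ` carrier R) x} \<rparr>"

definition conductor :: "('a, 'c) ring_scheme \<Rightarrow> 'a set" where
  "conductor R = {a \<in> carrier R. \<forall>x \<in> carrier (normalization R).
     to_fractions R a \<otimes>\<^bsub>normalization R\<^esub> x \<in> to_fractions R ` carrier R}"

definition extend_ideal :: "('a, 'c) ring_scheme \<Rightarrow> 'a set \<Rightarrow> ('a \<times> 'a) set set" where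
  "extend_ideal R I = genideal (normalization R) (to_fractions R ` I)"


section \<open>Associated graded ring\<close>

primrec ideal_power :: "('a, 'c) ring_scheme \<Rightarrow> 'a set \<Rightarrow> nat \<Rightarrow> 'a set" where
  "ideal_power R I 0 = carrier R"
| "ideal_power R I (Suc n) = ideal_prod R (ideal_power R I n) I"

text \<open>The group \<open>I\<^sup>n/I\<^sup>n\<^sup>+\<^sup>1\<close>. It is a quotient of an additive group, but HOL-Algebra writes every
  \<^type>\<open>monoid\<close> multiplicatively.\<close>

definition gr_comp :: "('a, 'c) ring_scheme \<Rightarrow> 'a set \<Rightarrow> nat \<Rightarrow> 'a set monoid" where
  "gr_comp R I n =
     \<lparr> carrier = ideal_power R I n, monoid.mult = ring.add R, one = \<zero>\<^bsub>R\<^esub> \<rparr> Mod ideal_power R I (Suc n)"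

text \<open>The product of the classes of \<open>x \<in> I\<^sup>i\<close> and \<open>y \<in> I\<^sup>j\<close> is the class of \<open>xy\<close> in
  \<open>I\<^sup>i\<^sup>+\<^sup>j/I\<^sup>i\<^sup>+\<^sup>j\<^sup>+\<^sup>1\<close>; the iterated product \<^const>\<open>finprod\<close> in \<^const>\<open>gr_comp\<close> is a sum of classes.\<close>

definition assoc_graded :: "('a, 'c) ring_scheme \<Rightarrow> 'a set \<Rightarrow> (nat \<Rightarrow> 'a set) ring" where
  "assoc_graded R I =
     \<lparr> carrier = carrier (sum_group UNIV (gr_comp R I)),
       monoid.mult = (\<lambda>f g n. finprod (gr_comp R I n)
                 (\<lambda>i. rcoset_mult R (ideal_power R I (Suc n)) (f i) (g (n - i))) {..n}),
       one = (\<lambda>n. if n = 0 then ideal_power R I 1 +>\<^bsub>R\<^esub> \<one>\<^bsub>R\<^esub> else \<one>\<^bsub>gr_comp R I n\<^esub>),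
       ring.zero = one (sum_group UNIV (gr_comp R I)),
       ring.add = monoid.mult (sum_group UNIV (gr_comp R I)) \<rparr>"

definition gr_degree :: "('a, 'c) ring_scheme \<Rightarrow> 'a set \<Rightarrow> nat \<Rightarrow> (nat \<Rightarrow> 'a set) set" where
  "gr_degree R I n =
     {f \<in> carrier (assoc_graded R I). \<forall>k. k \<noteq> n \<longrightarrow> f k = \<one>\<^bsub>gr_comp R I k\<^esub>}"

text \<open>The degree \<open>n\<close> component \<open>I\<^sup>n/I\<^sup>n\<^sup>+\<^sup>1 \<rightarrow> J\<^sup>n/J\<^sup>n\<^sup>+\<^sup>1\<close> of the graded homomorphism induced by a ring
  homomorphism \<open>h\<close> into \<open>S\<close> with \<open>h(I) \<subseteq> J\<close>: the class of \<open>x\<close> goes to the class of \<open>h x\<close>, which is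
  the same for all \<open>x\<close> in a coset.\<close>

definition gr_map :: "('b, 'd) ring_scheme \<Rightarrow> 'b set \<Rightarrow> ('a \<Rightarrow> 'b) \<Rightarrow> nat \<Rightarrow> 'a set \<Rightarrow> 'b set" where
  "gr_map S J h n C = (\<Union>x \<in> C. ideal_power S J (Suc n) +>\<^bsub>S\<^esub> h x)"

definition nu :: "('a, 'c) ring_scheme \<Rightarrow> 'a set \<Rightarrow> nat \<Rightarrow> 'a set \<Rightarrow> ('a \<times> 'a) set set" where
  "nu R m = gr_map (normalization R) (extend_ideal R m) (to_fractions R)"


section \<open>Ringed spaces\<close>

record ('p, 's) ringed_space =
  top_space :: "'p topology"
  sections :: "'p set \<Rightarrow> 's ring"
  restriction :: "'p set \<Rightarrow> 'p set \<Rightarrow> 's \<Rightarrow> 's"  \<comment> \<open>from the first open set to the second\<close>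

definition reduced_space :: "('p, 's) ringed_space \<Rightarrow> bool" where
  "reduced_space M \<longleftrightarrow> (\<forall>U. openin (top_space M) U \<longrightarrow> reduced_ring (sections M U))"

text \<open>An isomorphism of (locally) ringed spaces is a homeomorphism \<open>\<phi>\<close> together with an isomorphism
  \<open>\<theta>\<close> of sheaves of rings from the structure sheaf of \<open>N\<close> to the direct image under \<open>\<phi>\<close> of that of
  \<open>M\<close>. For such a pair the maps on stalks are isomorphisms, so they need not be required to be
  local.\<close>

definition ringed_space_iso ::
  "('p, 's) ringed_space \<Rightarrow> ('q, 't) ringed_space \<Rightarrow> ('p \<Rightarrow> 'q) \<Rightarrow> ('q set \<Rightarrow> 't \<Rightarrow> 's) \<Rightarrow> bool" where
  "ringed_space_iso M N \<phi> \<theta> \<longleftrightarrow>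
     (let preim = (\<lambda>V. {x \<in> topspace (top_space M). \<phi> x \<in> V}) in
      homeomorphic_map (top_space M) (top_space N) \<phi> \<and>
      (\<forall>V. openin (top_space N) V \<longrightarrow> \<theta> V \<in> ring_iso (sections N V) (sections M (preim V))) \<and>
      (\<forall>V W. openin (top_space N) V \<and> openin (top_space N) W \<and> W \<subseteq> V \<longrightarrow>
         (\<forall>s \<in> carrier (sections N V).
            \<theta> W (restriction N V W s) = restriction M (preim V) (preim W) (\<theta> V s))))"

definition isomorphic_spaces :: "('p, 's) ringed_space \<Rightarrow> ('q, 't) ringed_space \<Rightarrow> bool" where
  "isomorphic_spaces M N \<longleftrightarrow> (\<exists>\<phi> \<theta>. ringed_space_iso M N \<phi> \<theta>)"


section \<open>Proj\<close>

text \<open>Throughout, \<open>S\<close> is a graded ring and \<open>Sd n\<close> is the set of its elements of degree \<open>n\<close>.\<close>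

definition irrelevant_ideal :: "('a, 'c) ring_scheme \<Rightarrow> (nat \<Rightarrow> 'a set) \<Rightarrow> 'a set" where
  "irrelevant_ideal S Sd = genideal S (\<Union>n \<in> {1..}. Sd n)"

definition homogeneous_ideal :: "('a, 'c) ring_scheme \<Rightarrow> (nat \<Rightarrow> 'a set) \<Rightarrow> 'a set \<Rightarrow> bool" where
  "homogeneous_ideal S Sd I \<longleftrightarrow> ideal I S \<and> I = genideal S (I \<inter> (\<Union>n. Sd n))"

definition proj_points :: "('a, 'c) ring_scheme \<Rightarrow> (nat \<Rightarrow> 'a set) \<Rightarrow> 'a set set" where
  "proj_points S Sd =
     {p. primeideal p S \<and> homogeneous_ideal S Sd p \<and> \<not> irrelevant_ideal S Sd \<subseteq> p}"

definition proj_closed :: "('a, 'c) ring_scheme \<Rightarrow> (nat \<Rightarrow> 'a set) \<Rightarrow> 'a set \<Rightarrow> 'a set set" where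
  "proj_closed S Sd E = {p \<in> proj_points S Sd. E \<subseteq> p}"

text \<open>As the points are homogeneous ideals, arbitrary subsets \<open>E\<close> define the same closed sets as
  homogeneous ideals.\<close>

definition proj_topology :: "('a, 'c) ring_scheme \<Rightarrow> (nat \<Rightarrow> 'a set) \<Rightarrow> 'a set topology" where
  "proj_topology S Sd =
     topology (\<lambda>U. \<exists>E \<subseteq> carrier S. U = proj_points S Sd - proj_closed S Sd E)"

text \<open>The ring \<open>S\<^bsub>(p)\<^esub>\<close>: fractions of degree zero in the localization at the homogeneous elements
  outside \<open>p\<close>.\<close>

definition homog_compl :: "(nat \<Rightarrow> 'a set) \<Rightarrow> 'a set \<Rightarrow> 'a set" where
  "homog_compl Sd p = (\<Union>n. Sd n) - p"

definition homog_localization ::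
  "('a, 'c) ring_scheme \<Rightarrow> (nat \<Rightarrow> 'a set) \<Rightarrow> 'a set \<Rightarrow> ('a \<times> 'a) set ring" where
  "homog_localization S Sd p = (localization S (homog_compl Sd p))\<lparr> carrier :=
     {fraction S (homog_compl Sd p) a f | a f. \<exists>n. a \<in> Sd n \<and> f \<in> Sd n - p} \<rparr>"

definition proj_sections ::
  "('a, 'c) ring_scheme \<Rightarrow> (nat \<Rightarrow> 'a set) \<Rightarrow> 'a set set \<Rightarrow> ('a set \<Rightarrow> ('a \<times> 'a) set) ring" where
  "proj_sections S Sd U =
     \<lparr> carrier = {s \<in> (\<Pi>\<^sub>E p \<in> U. carrier (homog_localization S Sd p)).
         \<forall>p \<in> U. \<exists>V n. \<exists>a \<in> Sd n. \<exists>f \<in> Sd n.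
           openin (proj_topology S Sd) V \<and> p \<in> V \<and> V \<subseteq> U \<and>
           (\<forall>q \<in> V. f \<notin> q \<and> s q = fraction S (homog_compl Sd q) a f)},
       monoid.mult = (\<lambda>s t. \<lambda>p \<in> U. s p \<otimes>\<^bsub>homog_localization S Sd p\<^esub> t p),
       one = (\<lambda>p \<in> U. \<one>\<^bsub>homog_localization S Sd p\<^esub>),
       ring.zero = (\<lambda>p \<in> U. \<zero>\<^bsub>homog_localization S Sd p\<^esub>),
       ring.add = (\<lambda>s t. \<lambda>p \<in> U. s p \<oplus>\<^bsub>homog_localization S Sd p\<^esub> t p) \<rparr>"

definition Proj ::
  "('a, 'c) ring_scheme \<Rightarrow> (nat \<Rightarrow> 'a set) \<Rightarrow> ('a set, 'a set \<Rightarrow> ('a \<times> 'a) set) ringed_space" where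
  "Proj S Sd =
     \<lparr> top_space = proj_topology S Sd,
       sections = proj_sections S Sd,
       restriction = (\<lambda>U V s. restrict s V) \<rparr>"

lemma openin_proj_topology:
  "openin (proj_topology S Sd) U \<longleftrightarrow>
     (\<exists>E \<subseteq> carrier S. U = proj_points S Sd - proj_closed S Sd E)"
proof -
  let ?O = "\<lambda>U. \<exists>E \<subseteq> carrier S. U = proj_points S Sd - proj_closed S Sd E"
  have "?O (U \<inter> V)" if "?O U" "?O V" for U V
  proof -
    from that obtain E F where E: "E \<subseteq> carrier S" "U = proj_points S Sd - proj_closed S Sd E"
      and F: "F \<subseteq> carrier S" "V = proj_points S Sd - proj_closed S Sd F" by blast
    let ?G = "{e \<otimes>\<^bsub>S\<^esub> f | e f. e \<in> E \<and> f \<in> F}"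
    have *: "?G \<subseteq> p \<longleftrightarrow> E \<subseteq> p \<or> F \<subseteq> p" if "p \<in> proj_points S Sd" for p
    proof -
      interpret primeideal p S using that by (simp add: proj_points_def)
      show ?thesis
      proof
        assume G: "?G \<subseteq> p"
        have "f \<in> p" if "e \<in> E" "e \<notin> p" "f \<in> F" for e f
        proof -
          have "e \<otimes>\<^bsub>S\<^esub> f \<in> p" using G that by blast
          then show ?thesis using I_prime[of e f] that E(1) F(1) by blast
        qed
        then show "E \<subseteq> p \<or> F \<subseteq> p" by blast
      next
        assume "E \<subseteq> p \<or> F \<subseteq> p"
        then show "?G \<subseteq> p" using E(1) F(1) I_l_closed I_r_closed by blast
      qed
    qed
    have "?G \<subseteq> carrier S \<or> proj_points S Sd = {}"
    proof (cases "proj_points S Sd = {}")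
      case False
      then obtain p where "primeideal p S" by (auto simp: proj_points_def)
      then interpret primeideal p S .
      show ?thesis using E(1) F(1) by blast
    qed simp
    moreover have "U \<inter> V = proj_points S Sd - proj_closed S Sd ?G"
      unfolding E(2) F(2) proj_closed_def using * by blast
    ultimately show ?thesis by auto
  qed
  moreover have "?O (\<Union>\<K>)" if "\<forall>K \<in> \<K>. ?O K" for \<K>
  proof -
    from that obtain E where E: "\<And>K. K \<in> \<K> \<Longrightarrow> E K \<subseteq> carrier S"
      "\<And>K. K \<in> \<K> \<Longrightarrow> K = proj_points S Sd - proj_closed S Sd (E K)" by metis
    have "x \<in> \<Union>\<K> \<longleftrightarrow> x \<in> proj_points S Sd - proj_closed S Sd (\<Union>(E ` \<K>))" for x
    proof -
      have "x \<in> \<Union>\<K> \<longleftrightarrow> (\<exists>K \<in> \<K>. x \<in> proj_points S Sd - proj_closed S Sd (E K))"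
        using E(2) by blast
      then show ?thesis unfolding proj_closed_def by blast
    qed
    then have "\<Union>\<K> = proj_points S Sd - proj_closed S Sd (\<Union>(E ` \<K>))" by blast
    moreover have "\<Union>(E ` \<K>) \<subseteq> carrier S" using E(1) by blast
    ultimately show ?thesis by blast
  qed
  ultimately have "istopology ?O" unfolding istopology_def by blast
  then show ?thesis by (simp add: proj_topology_def)
qed

end

theory Submission
  imports Defs "HOL-Library.Multiset_Order"
begin

text \<open>Let \<open>B\<close> be the normalization, a ring because \<open>A\<close> is noetherian. Since \<open>m\<close> is finitely generated,
  \<open>m\<^sup>k \<subseteq> b\<close> for some \<open>k\<close>, hence \<open>m\<^sup>nB \<subseteq> m\<^sup>n\<^sup>-\<^sup>k\<close> for \<open>n \<ge> k\<close>. If \<open>f \<in> m\<^sup>n \<inter> m\<^sup>n\<^sup>+\<^sup>1B\<close>, then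
  \<open>f\<^sup>k\<^sup>+\<^sup>1\<close> lies one power deeper than it has to, so the class of \<open>f\<close> in \<open>G(A)\<close> is nilpotent. As
  \<open>Proj (G(A))\<close> is reduced, this class is killed by a power of \<open>G(A)\<^sub>+\<close>, and such classes exist in
  finitely many degrees only: compare leading monomials and apply Dickson's lemma. So
  \<open>m\<^sup>n \<inter> m\<^sup>n\<^sup>+\<^sup>1B = m\<^sup>n\<^sup>+\<^sup>1\<close> for \<open>n \<ge> n\<^sub>0\<close>; applied \<open>k\<close> times to \<open>m\<^sup>nB \<subseteq> m\<^sup>n\<^sup>-\<^sup>k\<close> this gives
  \<open>m\<^sup>nB = m\<^sup>n\<close> for \<open>n \<ge> n\<^sub>0 + k\<close>, and \<open>\<nu>\<^sub>n\<close> is even an identity. For the second claim, a graded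
  homomorphism that is bijective in high degrees induces isomorphisms of all the rings of
  homogeneous fractions of degree 0, because numerator and denominator can be multiplied by a
  form of high degree.\<close>

section \<open>Localization\<close>

text \<open>Reducedness of Proj does not make G(A) reduced: a nilpotent class is only forced to
  vanish after multiplication by forms of high degree. The obstacle is therefore to bound the
  degrees in which such classes live. They form an ideal of G(A); in a noetherian graded ring it
  would be finitely generated, each generator being killed by a power of the irrelevant ideal. Here
  the same bound is obtained inside A, from leading monomials in generators of \<open>m\<close>, so
  that no basis theorem for G(A) is involved. The comparison of powers is carried out for an
  arbitrary injective homomorphism h from R to S such that h(I^k) S lies in h(R). The normalization
  enters through its conductor and through being a ring, which is what integrality is used for. For
  Proj, sections are functions into the stalks. It is therefore enough to match points and stalks in
  such a way that a local fraction on one side becomes a local fraction on the other.\<close>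

locale mult_set = cring R for R :: "('a, 'c) ring_scheme" (structure) +
  fixes T :: "'a set"
  assumes T_carrier: "T \<subseteq> carrier R"
    and T_one: "\<one> \<in> T"
    and T_mult: "s \<in> T \<Longrightarrow> t \<in> T \<Longrightarrow> s \<otimes> t \<in> T"
begin

lemma T_closed [simp]: "s \<in> T \<Longrightarrow> s \<in> carrier R"
  using T_carrier by blast

lemma mem_fraction:
  assumes "a \<in> carrier R" "s \<in> T"
  shows "(b, t) \<in> fraction R T a s \<longleftrightarrow>
    b \<in> carrier R \<and> t \<in> T \<and> (\<exists>u \<in> T. u \<otimes> (a \<otimes> t) = u \<otimes> (b \<otimes> s))"
proof -
  have "u \<otimes> (a \<otimes> t \<ominus> b \<otimes> s) = \<zero> \<longleftrightarrow> u \<otimes> (a \<otimes> t) = u \<otimes> (b \<otimes> s)"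
    if "u \<in> T" "b \<in> carrier R" "t \<in> T" for u
  proof -
    have "u \<otimes> (a \<otimes> t \<ominus> b \<otimes> s) = u \<otimes> (a \<otimes> t) \<ominus> u \<otimes> (b \<otimes> s)"
      using assms that by (simp add: minus_eq r_distr r_minus)
    then show ?thesis using assms that by (simp add: r_right_minus_eq)
  qed
  then show ?thesis by (auto simp: fraction_def)
qed

lemma fraction_self: "a \<in> carrier R \<Longrightarrow> s \<in> T \<Longrightarrow> (a, s) \<in> fraction R T a s"
  using mem_fraction T_one by blast

lemma fraction_trans:
  assumes "a \<in> carrier R" "s \<in> T" "(b, t) \<in> fraction R T a s" "(c, v) \<in> fraction R T b t"
  shows "(c, v) \<in> fraction R T a s"
proof -
  obtain u where b: "b \<in> carrier R" "t \<in> T" and u: "u \<in> T" "u \<otimes> (a \<otimes> t) = u \<otimes> (b \<otimes> s)"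
    using mem_fraction assms by blast
  obtain w where c: "c \<in> carrier R" "v \<in> T" and w: "w \<in> T" "w \<otimes> (b \<otimes> v) = w \<otimes> (c \<otimes> t)"
    using mem_fraction assms b by blast
  \<comment> \<open>The middle denominator \<open>t\<close> has to be part of the witness:
    eliminating \<open>b\<close> leaves it as a factor on both sides, and it cannot be cancelled
    when \<open>T\<close> has zero divisors.\<close>
  have "(u \<otimes> w \<otimes> t) \<otimes> (a \<otimes> v) = (w \<otimes> v) \<otimes> (u \<otimes> (a \<otimes> t))"
    using assms(1,2) b u(1) c w(1) by (simp add: m_ac)
  also have "\<dots> = (u \<otimes> s) \<otimes> (w \<otimes> (b \<otimes> v))"
    using assms(1,2) b c u(1) w(1) by (simp add: u(2) m_ac)
  also have "\<dots> = (u \<otimes> w \<otimes> t) \<otimes> (c \<otimes> s)"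
    using assms(1,2) b c u(1) w(1) by (simp add: w(2) m_ac)
  finally have "(u \<otimes> w \<otimes> t) \<otimes> (a \<otimes> v) = (u \<otimes> w \<otimes> t) \<otimes> (c \<otimes> s)" .
  moreover have "u \<otimes> w \<otimes> t \<in> T" using u w b T_mult by blast
  ultimately show ?thesis using mem_fraction assms c by blast
qed

lemma fraction_sym:
  assumes "a \<in> carrier R" "s \<in> T" "(b, t) \<in> fraction R T a s"
  shows "(a, s) \<in> fraction R T b t"
  using assms mem_fraction[OF assms(1,2), of b t] mem_fraction[of b t a s] by metis

lemma fraction_eqI:
  assumes "a \<in> carrier R" "s \<in> T" "(b, t) \<in> fraction R T a s"
  shows "fraction R T b t = fraction R T a s"
proof -
  have bt: "b \<in> carrier R" "t \<in> T" using assms mem_fraction by blast+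
  have "(c, v) \<in> fraction R T b t \<longleftrightarrow> (c, v) \<in> fraction R T a s" for c v
    using fraction_trans[OF assms] fraction_trans[OF bt fraction_sym[OF assms]] by blast
  then show ?thesis by auto
qed

lemma fraction_eq_iff:
  assumes "a \<in> carrier R" "s \<in> T" "b \<in> carrier R" "t \<in> T"
  shows "fraction R T a s = fraction R T b t \<longleftrightarrow> (\<exists>u \<in> T. u \<otimes> (a \<otimes> t) = u \<otimes> (b \<otimes> s))"
proof -
  have "fraction R T a s = fraction R T b t \<longleftrightarrow> (b, t) \<in> fraction R T a s"
    using fraction_eqI[of a s b t] fraction_self[of b t] assms by auto
  then show ?thesis using mem_fraction[of a s b t] assms by simp
qed

lemma fraction_eq:
  assumes "a \<in> carrier R" "s \<in> T" "b \<in> carrier R" "t \<in> T" "a \<otimes> t = b \<otimes> s"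
  shows "fraction R T a s = fraction R T b t"
  using fraction_eq_iff assms T_one by force

lemma fraction_cancel:
  assumes "a \<in> carrier R" "s \<in> T" "h \<in> T"
  shows "fraction R T (h \<otimes> a) (h \<otimes> s) = fraction R T a s"
  using assms T_mult by (intro fraction_eq) (auto simp: m_ac)

lemma fraction_eq_zero_iff:
  assumes "a \<in> carrier R" "s \<in> T"
  shows "fraction R T a s = fraction R T \<zero> \<one> \<longleftrightarrow> (\<exists>u \<in> T. u \<otimes> a = \<zero>)"
  using assms by (subst fraction_eq_iff) (auto simp: T_one)

text \<open>The ring operations are unions over all representatives. If the united classes agree,
  the union collapses to one of them, the index sets being nonempty by \<open>fraction_self\<close>;
  each operation then only needs its independence of representatives.\<close>

lemma fraction_op:
  assumes "a \<in> carrier R" "s \<in> T" "b \<in> carrier R" "t \<in> T"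
    and "\<And>a' s' b' t'. (a', s') \<in> fraction R T a s \<Longrightarrow> (b', t') \<in> fraction R T b t \<Longrightarrow>
      F a' s' b' t' = F a s b t"
  shows "(\<Union>x \<in> fraction R T a s. \<Union>y \<in> fraction R T b t. F (fst x) (snd x) (fst y) (snd y))
    = F a s b t"
proof -
  have "F (fst x) (snd x) (fst y) (snd y) = F a s b t"
    if "x \<in> fraction R T a s" "y \<in> fraction R T b t" for x y
    using assms(5) that by (metis prod.collapse)
  then show ?thesis using fraction_self assms by blast
qed

abbreviation L :: "('a \<times> 'a) set ring" where "L \<equiv> localization R T"

lemma fraction_mult:
  assumes "a \<in> carrier R" "s \<in> T" "b \<in> carrier R" "t \<in> T"
  shows "fraction R T a s \<otimes>\<^bsub>L\<^esub> fraction R T b t = fraction R T (a \<otimes> b) (s \<otimes> t)"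
proof -
  have "fraction R T (a' \<otimes> b') (s' \<otimes> t') = fraction R T (a \<otimes> b) (s \<otimes> t)"
    if x: "(a', s') \<in> fraction R T a s" "(b', t') \<in> fraction R T b t" for a' s' b' t'
  proof -
    obtain u where a': "a' \<in> carrier R" "s' \<in> T"
      and u: "u \<in> T" "u \<otimes> (a \<otimes> s') = u \<otimes> (a' \<otimes> s)"
      using mem_fraction assms x by blast
    obtain w where b': "b' \<in> carrier R" "t' \<in> T"
      and w: "w \<in> T" "w \<otimes> (b \<otimes> t') = w \<otimes> (b' \<otimes> t)"
      using mem_fraction assms x by blast
    have "(u \<otimes> w) \<otimes> ((a \<otimes> b) \<otimes> (s' \<otimes> t')) = (u \<otimes> (a \<otimes> s')) \<otimes> (w \<otimes> (b \<otimes> t'))"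
      using assms a' b' u(1) w(1) by (simp add: m_ac)
    also have "\<dots> = (u \<otimes> w) \<otimes> ((a' \<otimes> b') \<otimes> (s \<otimes> t))"
      using assms a' b' u(1) w(1) by (simp add: u(2) w(2)) (simp add: m_ac)
    finally show ?thesis
      using fraction_eq_iff[of "a \<otimes> b" "s \<otimes> t" "a' \<otimes> b'" "s' \<otimes> t'"] assms a' b' u(1) w(1) T_mult
      by (metis m_closed)
  qed
  then show ?thesis
    using fraction_op[OF assms, where F="\<lambda>a s b t. fraction R T (a \<otimes> b) (s \<otimes> t)"]
    by (simp add: localization_def)
qed

lemma fraction_add:
  assumes "a \<in> carrier R" "s \<in> T" "b \<in> carrier R" "t \<in> T"
  shows "fraction R T a s \<oplus>\<^bsub>L\<^esub> fraction R T b t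
    = fraction R T (a \<otimes> t \<oplus> b \<otimes> s) (s \<otimes> t)"
proof -
  have "fraction R T (a' \<otimes> t' \<oplus> b' \<otimes> s') (s' \<otimes> t') = fraction R T (a \<otimes> t \<oplus> b \<otimes> s) (s \<otimes> t)"
    if x: "(a', s') \<in> fraction R T a s" "(b', t') \<in> fraction R T b t" for a' s' b' t'
  proof -
    obtain u where a': "a' \<in> carrier R" "s' \<in> T"
      and u: "u \<in> T" "u \<otimes> (a \<otimes> s') = u \<otimes> (a' \<otimes> s)"
      using mem_fraction assms x by blast
    obtain w where b': "b' \<in> carrier R" "t' \<in> T"
      and w: "w \<in> T" "w \<otimes> (b \<otimes> t') = w \<otimes> (b' \<otimes> t)"
      using mem_fraction assms x by blast
    have "(u \<otimes> w) \<otimes> ((a \<otimes> t \<oplus> b \<otimes> s) \<otimes> (s' \<otimes> t'))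
      = (u \<otimes> (a \<otimes> s')) \<otimes> (w \<otimes> t \<otimes> t') \<oplus> (w \<otimes> (b \<otimes> t')) \<otimes> (u \<otimes> s \<otimes> s')"
      using assms a' b' u(1) w(1) by (simp add: r_distr l_distr m_ac)
    also have "\<dots> = (u \<otimes> w) \<otimes> ((a' \<otimes> t' \<oplus> b' \<otimes> s') \<otimes> (s \<otimes> t))"
      unfolding u(2) w(2) using assms a' b' u(1) w(1) by (simp add: r_distr l_distr m_ac)
    finally show ?thesis
      using fraction_eq_iff[of "a \<otimes> t \<oplus> b \<otimes> s" "s \<otimes> t" "a' \<otimes> t' \<oplus> b' \<otimes> s'" "s' \<otimes> t'"]
        assms a' b' u(1) w(1) T_mult by (metis m_closed a_closed T_closed)
  qed
  then show ?thesis
    using fraction_op[OF assms, where F="\<lambda>a s b t. fraction R T (a \<otimes> t \<oplus> b \<otimes> s) (s \<otimes> t)"]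
    by (simp add: localization_def)
qed

lemma localization_carrier:
  "carrier L = {fraction R T a s | a s. a \<in> carrier R \<and> s \<in> T}"
  and localization_one: "\<one>\<^bsub>L\<^esub> = fraction R T \<one> \<one>"
  and localization_zero: "\<zero>\<^bsub>L\<^esub> = fraction R T \<zero> \<one>"
  by (simp_all add: localization_def)

lemma localization_carrierE:
  assumes "x \<in> carrier L"
  obtains a s where "a \<in> carrier R" "s \<in> T" "x = fraction R T a s"
  using assms localization_carrier by blast

lemma fraction_closed [simp]:
  "a \<in> carrier R \<Longrightarrow> s \<in> T \<Longrightarrow> fraction R T a s \<in> carrier L"
  using localization_carrier by blast

lemma cring_localization: "cring L"
proof (rule cringI)
  note [simp] = T_one T_mult fraction_mult fraction_add localization_one localization_zero
  show "abelian_group L"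
  proof (rule abelian_groupI)
    fix x y z
    assume "x \<in> carrier L" "y \<in> carrier L"
    then obtain a s b t where x: "a \<in> carrier R" "s \<in> T" "x = fraction R T a s"
      and y: "b \<in> carrier R" "t \<in> T" "y = fraction R T b t" by (metis localization_carrierE)
    show "x \<oplus>\<^bsub>L\<^esub> y \<in> carrier L" using x y by simp
    show "x \<oplus>\<^bsub>L\<^esub> y = y \<oplus>\<^bsub>L\<^esub> x"
      using x y by (simp add: a_comm m_comm)
    assume "z \<in> carrier L"
    then obtain c v where z: "c \<in> carrier R" "v \<in> T" "z = fraction R T c v"
      by (metis localization_carrierE)
    show "x \<oplus>\<^bsub>L\<^esub> y \<oplus>\<^bsub>L\<^esub> z
      = x \<oplus>\<^bsub>L\<^esub> (y \<oplus>\<^bsub>L\<^esub> z)"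
      using x y z by (simp add: l_distr r_distr m_ac a_ac)
  next
    fix x assume "x \<in> carrier L"
    then obtain a s where x: "a \<in> carrier R" "s \<in> T" "x = fraction R T a s"
      by (metis localization_carrierE)
    show "\<zero>\<^bsub>L\<^esub> \<oplus>\<^bsub>L\<^esub> x = x" using x by simp
    have "fraction R T (\<ominus> a) s \<oplus>\<^bsub>L\<^esub> x = \<zero>\<^bsub>L\<^esub>"
      using x by (simp add: fraction_eq_zero_iff l_minus l_neg) (metis T_closed r_null)
    then show "\<exists>y\<in>carrier L. y \<oplus>\<^bsub>L\<^esub> x = \<zero>\<^bsub>L\<^esub>"
      using x by (metis a_inv_closed fraction_closed)
  qed simp
  show "comm_monoid L"
  proof (rule comm_monoidI)
    fix x y z
    assume "x \<in> carrier L" "y \<in> carrier L"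
    then obtain a s b t where x: "a \<in> carrier R" "s \<in> T" "x = fraction R T a s"
      and y: "b \<in> carrier R" "t \<in> T" "y = fraction R T b t" by (metis localization_carrierE)
    show "x \<otimes>\<^bsub>L\<^esub> y \<in> carrier L" using x y by simp
    show "x \<otimes>\<^bsub>L\<^esub> y = y \<otimes>\<^bsub>L\<^esub> x" using x y by (simp add: m_comm)
    assume "z \<in> carrier L"
    then obtain c v where z: "c \<in> carrier R" "v \<in> T" "z = fraction R T c v"
      by (metis localization_carrierE)
    show "x \<otimes>\<^bsub>L\<^esub> y \<otimes>\<^bsub>L\<^esub> z
      = x \<otimes>\<^bsub>L\<^esub> (y \<otimes>\<^bsub>L\<^esub> z)"
      using x y z by (simp add: m_assoc)
  next
    fix x assume "x \<in> carrier L"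
    then obtain a s where x: "a \<in> carrier R" "s \<in> T" "x = fraction R T a s"
      by (metis localization_carrierE)
    show "\<one>\<^bsub>L\<^esub> \<otimes>\<^bsub>L\<^esub> x = x" using x by simp
  qed simp
  fix x y z
  assume "x \<in> carrier L" "y \<in> carrier L"
    "z \<in> carrier L"
  then obtain a s b t c v where x: "a \<in> carrier R" "s \<in> T" "x = fraction R T a s"
    and y: "b \<in> carrier R" "t \<in> T" "y = fraction R T b t"
    and z: "c \<in> carrier R" "v \<in> T" "z = fraction R T c v" by (metis localization_carrierE)
  show "(x \<oplus>\<^bsub>L\<^esub> y) \<otimes>\<^bsub>L\<^esub> z
    = x \<otimes>\<^bsub>L\<^esub> z \<oplus>\<^bsub>L\<^esub> y \<otimes>\<^bsub>L\<^esub> z"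
  proof -
    have "x \<otimes>\<^bsub>L\<^esub> z \<oplus>\<^bsub>L\<^esub> y \<otimes>\<^bsub>L\<^esub> z
      = fraction R T (v \<otimes> ((a \<otimes> t \<oplus> b \<otimes> s) \<otimes> c)) (v \<otimes> (s \<otimes> t \<otimes> v))"
      using x y z by (simp add: l_distr r_distr m_ac)
    then show ?thesis using x y z by (simp add: fraction_cancel)
  qed
qed

end

section \<open>The total ring of fractions\<close>

lemma regular_elementsD:
  "s \<in> regular_elements R \<Longrightarrow> s \<in> carrier R"
  "s \<in> regular_elements R \<Longrightarrow> a \<in> carrier R \<Longrightarrow> s \<otimes>\<^bsub>R\<^esub> a = \<zero>\<^bsub>R\<^esub> \<Longrightarrow> a = \<zero>\<^bsub>R\<^esub>"
  unfolding regular_elements_def by blast+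

lemma (in cring) mult_set_regular_elements: "mult_set R (regular_elements R)"
proof
  show "regular_elements R \<subseteq> carrier R" by (auto dest: regular_elementsD(1))
  show "\<one> \<in> regular_elements R"
    unfolding regular_elements_def mem_Collect_eq by (metis l_one one_closed)
  fix s t assume st: "s \<in> regular_elements R" "t \<in> regular_elements R"
  note c = regular_elementsD(1)[OF st(1)] regular_elementsD(1)[OF st(2)]
  have "a = \<zero>" if "a \<in> carrier R" "s \<otimes> t \<otimes> a = \<zero>" for a
    using that c m_assoc[of s t a] regular_elementsD(2)[OF st(1), of "t \<otimes> a"]
      regular_elementsD(2)[OF st(2), of a] m_closed[of t a] by metis
  then show "s \<otimes> t \<in> regular_elements R"
    using c unfolding regular_elements_def by blast
qed

lemma (in cring) cring_total_fractions: "cring (total_fractions R)"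
  using mult_set.cring_localization[OF mult_set_regular_elements] by (simp add: total_fractions_def)

lemma (in cring) to_fractions_hom: "to_fractions R \<in> ring_hom R (total_fractions R)"
proof -
  interpret L: mult_set R "regular_elements R" by (rule mult_set_regular_elements)
  show ?thesis
    unfolding to_fractions_def total_fractions_def
  proof (rule ring_hom_memI)
    fix x y assume xy: "x \<in> carrier R" "y \<in> carrier R"
    show "fraction R (regular_elements R) x \<one> \<in> carrier (localization R (regular_elements R))"
      using xy L.T_one by simp
    show "fraction R (regular_elements R) (x \<otimes> y) \<one> =
      fraction R (regular_elements R) x \<one> \<otimes>\<^bsub>localization R (regular_elements R)\<^esub>
      fraction R (regular_elements R) y \<one>"
      using xy L.T_one by (subst L.fraction_mult) auto
    show "fraction R (regular_elements R) (x \<oplus> y) \<one> =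
      fraction R (regular_elements R) x \<one> \<oplus>\<^bsub>localization R (regular_elements R)\<^esub>
      fraction R (regular_elements R) y \<one>"
      using xy L.T_one by (subst L.fraction_add) auto
  qed (simp add: L.localization_one)
qed

text \<open>Equality of fractions holds only up to a factor \<open>u\<close> from the multiplicative
  set; here \<open>u\<close> is regular and can be cancelled.\<close>

lemma (in cring) to_fractions_inj: "inj_on (to_fractions R) (carrier R)"
proof (rule inj_onI)
  interpret L: mult_set R "regular_elements R" by (rule mult_set_regular_elements)
  fix x y assume xy: "x \<in> carrier R" "y \<in> carrier R" "to_fractions R x = to_fractions R y"
  then obtain u where u: "u \<in> regular_elements R" "u \<otimes> x = u \<otimes> y"
    using L.fraction_eq_iff[of x \<one> y \<one>] L.T_one by (auto simp: to_fractions_def)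
  then have "u \<otimes> (x \<ominus> y) = u \<otimes> x \<ominus> u \<otimes> y"
    using xy by (simp add: minus_eq r_distr r_minus)
  also have "\<dots> = \<zero>" using u xy by (simp add: r_right_minus_eq)
  finally have "x \<ominus> y = \<zero>" using xy regular_elementsD(2)[OF u(1)] by blast
  then show "x = y" using xy by (simp add: r_right_minus_eq)
qed

section \<open>Integral closure over a noetherian ring\<close>

lemma (in noetherian_ring) ideal_seq_stabilizes:
  assumes "\<And>i::nat. ideal (I i) R" "\<And>i. I i \<subseteq> I (Suc i)"
  shows "\<exists>n. \<forall>m\<ge>n. I m = I n"
proof -
  have mono: "I i \<subseteq> I j" if "i \<le> j" for i j
    using that lift_Suc_mono_le[of I] assms(2) by blast
  have "subset.chain {I. ideal I R} (range I)"
    unfolding pred_on.chain_def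
  proof (intro conjI ballI)
    show "range I \<subseteq> {I. ideal I R}" using assms(1) by blast
    fix J K assume "J \<in> range I" "K \<in> range I"
    then obtain i j where "J = I i" "K = I j" by blast
    then show "(\<subset>)\<^sup>=\<^sup>= J K \<or> (\<subset>)\<^sup>=\<^sup>= K J" using mono[of i j] mono[of j i] nat_le_linear[of i j] by blast
  qed
  then have "\<Union>(range I) \<in> range I" by (intro ideal_chain_is_trivial) auto
  then obtain n where "\<Union>(range I) = I n" by blast
  then show ?thesis using mono by blast
qed

text \<open>\<open>S\<close> is treated as an R-module along \<open>h\<close>, so submodules and
  spans take their scalars in the image of \<open>R\<close>, which is not a field in
  general.\<close>

locale noetherian_base = ring_hom_cring R S h
  for R :: "('a, 'c) ring_scheme" and S :: "('b, 'd) ring_scheme" (structure) and h +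
  assumes noetherian: "noetherian_ring R"
begin

definition submod :: "'b set \<Rightarrow> bool" where
  "submod N \<longleftrightarrow> N \<subseteq> carrier S \<and> \<zero> \<in> N \<and> (\<forall>x\<in>N. \<forall>y\<in>N. x \<oplus> y \<in> N) \<and>
     (\<forall>k\<in>carrier R. \<forall>x\<in>N. h k \<otimes> x \<in> N)"

abbreviation span :: "'b list \<Rightarrow> 'b set" where
  "span \<equiv> ring.Span S (h ` carrier R)"

lemma submod_carrier: "submod N \<Longrightarrow> x \<in> N \<Longrightarrow> x \<in> carrier S"
  and submod_zero: "submod N \<Longrightarrow> \<zero> \<in> N"
  and submod_add: "submod N \<Longrightarrow> x \<in> N \<Longrightarrow> y \<in> N \<Longrightarrow> x \<oplus> y \<in> N"
  and submod_smult: "submod N \<Longrightarrow> k \<in> carrier R \<Longrightarrow> x \<in> N \<Longrightarrow> h k \<otimes> x \<in> N"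
  unfolding submod_def by blast+

lemma submod_neg:
  assumes "submod N" "x \<in> N"
  shows "\<ominus> x \<in> N"
proof -
  have "h (\<ominus>\<^bsub>R\<^esub> \<one>\<^bsub>R\<^esub>) \<otimes> x \<in> N"
    by (rule submod_smult[OF assms(1) _ assms(2)]) simp
  then show ?thesis using submod_carrier[OF assms] by (simp add: S.l_minus)
qed

lemma submod_Int: "submod M \<Longrightarrow> submod N \<Longrightarrow> submod (M \<inter> N)"
  unfolding submod_def by auto

lemma submod_colon:
  assumes "submod N" "x \<in> carrier S"
  shows "submod {y \<in> carrier S. x \<otimes> y \<in> N}"
  unfolding submod_def
proof (intro conjI ballI)
  fix k y assume k: "k \<in> carrier R" and y: "y \<in> {y \<in> carrier S. x \<otimes> y \<in> N}"
  have "x \<otimes> (h k \<otimes> y) = h k \<otimes> (x \<otimes> y)"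
    using k y assms by (simp add: S.m_lcomm)
  then show "h k \<otimes> y \<in> {y \<in> carrier S. x \<otimes> y \<in> N}"
    using k y submod_smult[OF assms(1)] by simp
qed (use assms submod_zero submod_add in \<open>auto simp: S.r_distr\<close>)

lemma Span_Nil: "span [] = {\<zero>}"
  by simp

lemma Span_Cons:
  "u \<in> span (a # Us) \<longleftrightarrow> (\<exists>k\<in>carrier R. \<exists>v\<in>span Us. u = h k \<otimes> a \<oplus> v)"
  by (auto simp: S.line_extension_mem_iff)

lemma submod_Span: "set Us \<subseteq> carrier S \<Longrightarrow> submod (span Us)"
proof (induction Us)
  case Nil
  then show ?case by (simp add: submod_def)
next
  case (Cons a Us)
  then have IH: "submod (span Us)" and a: "a \<in> carrier S" by auto
  note c = submod_carrier[OF IH]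
  show ?case unfolding submod_def
  proof (intro conjI ballI subsetI)
    fix x assume "x \<in> span (a # Us)"
    then show "x \<in> carrier S" using a c unfolding Span_Cons by auto
  next
    show "\<zero> \<in> span (a # Us)" unfolding Span_Cons
      by (rule bexI[of _ "\<zero>\<^bsub>R\<^esub>"], rule bexI[OF _ submod_zero[OF IH]]) (use a in auto)
  next
    fix x y assume "x \<in> span (a # Us)" "y \<in> span (a # Us)"
    then obtain k v l w where kv: "k \<in> carrier R" "v \<in> span Us" "x = h k \<otimes> a \<oplus> v"
      and lw: "l \<in> carrier R" "w \<in> span Us" "y = h l \<otimes> a \<oplus> w"
      unfolding Span_Cons by blast
    have "x \<oplus> y = h (k \<oplus>\<^bsub>R\<^esub> l) \<otimes> a \<oplus> (v \<oplus> w)"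
      using a kv lw c by (simp add: S.l_distr S.a_ac)
    then show "x \<oplus> y \<in> span (a # Us)"
      unfolding Span_Cons using kv lw submod_add[OF IH] by blast
  next
    fix k x assume k: "k \<in> carrier R" and "x \<in> span (a # Us)"
    then obtain l v where lv: "l \<in> carrier R" "v \<in> span Us" "x = h l \<otimes> a \<oplus> v"
      unfolding Span_Cons by blast
    have "h k \<otimes> x = h (k \<otimes>\<^bsub>R\<^esub> l) \<otimes> a \<oplus> h k \<otimes> v"
      using a k lv c by (simp add: S.r_distr S.m_assoc)
    then show "h k \<otimes> x \<in> span (a # Us)"
      unfolding Span_Cons using k lv submod_smult[OF IH] by blast
  qed
qed

lemma Span_mono_Cons:
  assumes "set Us \<subseteq> carrier S" "a \<in> carrier S"
  shows "span Us \<subseteq> span (a # Us)"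
proof
  fix v assume v: "v \<in> span Us"
  then have "v = h \<zero>\<^bsub>R\<^esub> \<otimes> a \<oplus> v"
    using assms submod_carrier[OF submod_Span] by simp
  then show "v \<in> span (a # Us)" unfolding Span_Cons using v by blast
qed

lemma Span_base: "set Us \<subseteq> carrier S \<Longrightarrow> a \<in> set Us \<Longrightarrow> a \<in> span Us"
proof (induction Us)
  case (Cons b Us)
  show ?case
  proof (cases "a = b")
    case True
    then have "a = h \<one>\<^bsub>R\<^esub> \<otimes> b \<oplus> \<zero>" using Cons.prems by simp
    then show ?thesis unfolding Span_Cons
      using submod_zero[OF submod_Span[of Us]] Cons.prems R.one_closed
      by (metis set_subset_Cons subset_trans)
  next
    case False
    then show ?thesis using Cons Span_mono_Cons[of Us b] by auto
  qed
qed simp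

lemma Span_min: "submod N \<Longrightarrow> set Us \<subseteq> N \<Longrightarrow> span Us \<subseteq> N"
proof (induction Us)
  case Nil
  then show ?case by (simp add: submod_zero)
next
  case (Cons a Us)
  show ?case
  proof
    fix u assume "u \<in> span (a # Us)"
    then obtain k v where "k \<in> carrier R" "v \<in> span Us" "u = h k \<otimes> a \<oplus> v"
      unfolding Span_Cons by blast
    then show "u \<in> N" using Cons submod_add submod_smult by auto
  qed
qed

text \<open>Finitely generated modules over a noetherian ring are noetherian. In the induction on
  the generators, \<open>M i\<close> is controlled by two chains that are known to stop: its
  intersection with \<open>span Us\<close>, and the ideal \<open>I i\<close> of coefficients that
  \<open>a\<close> can have in elements of \<open>M i\<close>.\<close>

lemma submod_chain_stabilizes:
  assumes "set Us \<subseteq> carrier S" "\<And>i::nat. submod (M i)" "\<And>i. M i \<subseteq> M (Suc i)"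
    "\<And>i. M i \<subseteq> span Us"
  shows "\<exists>n. \<forall>m\<ge>n. M m = M n"
  using assms
proof (induction Us arbitrary: M)
  case Nil
  then have "M i = {\<zero>}" for i
    using submod_zero[OF Nil(2)] Nil(4)[of i] unfolding Span_Nil by blast
  then show ?case by simp
next
  case (Cons a Us)
  have a: "a \<in> carrier S" and Us: "set Us \<subseteq> carrier S" using Cons.prems by auto
  note sp = submod_Span[OF Us]
  note c = submod_carrier[OF sp]
  define I where "I i = {k \<in> carrier R. \<exists>v \<in> span Us. h k \<otimes> a \<oplus> v \<in> M i}" for i
  have "\<exists>n. \<forall>m\<ge>n. M m \<inter> span Us = M n \<inter> span Us"
    using Cons.prems(3)
    by (intro Cons.IH Us submod_Int[OF Cons.prems(2) sp]) auto
  then obtain n1 where n1: "\<And>m. m \<ge> n1 \<Longrightarrow> M m \<inter> span Us = M n1 \<inter> span Us" by blast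
  have "ideal (I i) R" for i
  proof (rule idealI)
    note N = Cons.prems(2)[of i]
    show "ring R" by (rule R.ring_axioms)
    have mult: "x \<otimes>\<^bsub>R\<^esub> k \<in> I i" if k: "k \<in> I i" "x \<in> carrier R" for k x
    proof -
      obtain v where v: "v \<in> span Us" "h k \<otimes> a \<oplus> v \<in> M i" and k': "k \<in> carrier R"
        using k unfolding I_def by blast
      have "h x \<otimes> (h k \<otimes> a \<oplus> v) = h (x \<otimes>\<^bsub>R\<^esub> k) \<otimes> a \<oplus> h x \<otimes> v"
        using k' that c v a by (simp add: S.r_distr S.m_assoc)
      then show ?thesis unfolding I_def
        using k' that v submod_smult[OF N] submod_smult[OF sp]
        by (metis (mono_tags, lifting) R.m_closed mem_Collect_eq)
    qed
    show "subgroup (I i) (add_monoid R)"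
    proof (rule R.add.subgroupI)
      show "I i \<subseteq> carrier R" unfolding I_def by blast
      have "h \<zero>\<^bsub>R\<^esub> \<otimes> a \<oplus> \<zero> \<in> M i" using a submod_zero[OF N] by simp
      then show "I i \<noteq> {}" unfolding I_def using submod_zero[OF sp] by blast
      fix k assume k: "k \<in> I i"
      have "\<ominus>\<^bsub>R\<^esub> k = (\<ominus>\<^bsub>R\<^esub> \<one>\<^bsub>R\<^esub>) \<otimes>\<^bsub>R\<^esub> k" using k by (simp add: I_def R.l_minus)
      then show "\<ominus>\<^bsub>R\<^esub> k \<in> I i" using mult[OF k] by simp
      fix l assume l: "l \<in> I i"
      obtain v w where k': "k \<in> carrier R" "v \<in> span Us" "h k \<otimes> a \<oplus> v \<in> M i"
        and l': "l \<in> carrier R" "w \<in> span Us" "h l \<otimes> a \<oplus> w \<in> M i"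
        using k l unfolding I_def by blast
      have "(h k \<otimes> a \<oplus> v) \<oplus> (h l \<otimes> a \<oplus> w)
          = h (k \<oplus>\<^bsub>R\<^esub> l) \<otimes> a \<oplus> (v \<oplus> w)"
        using k' l' a c by (simp add: S.l_distr S.a_ac)
      then show "k \<oplus>\<^bsub>R\<^esub> l \<in> I i" unfolding I_def
        using k' l' submod_add[OF N] submod_add[OF sp]
        by (metis (mono_tags, lifting) R.a_closed mem_Collect_eq)
    qed
    show "x \<otimes>\<^bsub>R\<^esub> k \<in> I i" "k \<otimes>\<^bsub>R\<^esub> x \<in> I i" if "k \<in> I i" "x \<in> carrier R" for k x
      using mult[OF that] that R.m_comm[of k x] unfolding I_def by auto
  qed
  moreover have "I i \<subseteq> I (Suc i)" for i
    using Cons.prems(3)[of i] unfolding I_def by blast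
  ultimately obtain n2 where n2: "\<And>m. m \<ge> n2 \<Longrightarrow> I m = I n2"
    using noetherian_ring.ideal_seq_stabilizes[OF noetherian, of I] by blast
  define n where "n = max n1 n2"
  have mono: "M i \<subseteq> M j" if "i \<le> j" for i j
    using that lift_Suc_mono_le[of M] Cons.prems(3) by blast
  have "M m \<subseteq> M n" if m: "m \<ge> n" for m
  proof
    fix x assume x: "x \<in> M m"
    then obtain k v where kv: "k \<in> carrier R" "v \<in> span Us" "x = h k \<otimes> a \<oplus> v"
      using Cons.prems(4)[of m] Span_Cons by blast
    then have "k \<in> I m" using x unfolding I_def by blast
    then have "k \<in> I n" using n2[of m] n2[of n] m unfolding n_def by simp
    then obtain w where w: "w \<in> span Us" "h k \<otimes> a \<oplus> w \<in> M n" unfolding I_def by blast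
    let ?y = "h k \<otimes> a \<oplus> w"
    \<comment> \<open>The two elements have the same coefficient at \<open>a\<close>, so their
      difference lies in \<open>span Us\<close>, where the first chain has already stopped.\<close>
    have eq: "x \<oplus> \<ominus> ?y = v \<oplus> \<ominus> w"
    proof -
      have cl: "h k \<otimes> a \<in> carrier S" "v \<in> carrier S" "w \<in> carrier S" using kv w c a by auto
      have "x \<oplus> \<ominus> ?y = (h k \<otimes> a \<oplus> \<ominus> (h k \<otimes> a)) \<oplus> (v \<oplus> \<ominus> w)"
        unfolding kv(3) S.minus_add[OF cl(1,3)] using cl by (simp add: S.a_ac)
      then show ?thesis using cl by (simp add: S.r_neg)
    qed
    have "?y \<in> M m" using w mono[OF m] by blast
    then have "x \<oplus> \<ominus> ?y \<in> M m \<inter> span Us"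
      using eq x kv w submod_add submod_neg sp Cons.prems(2) by (metis IntI)
    then have "x \<oplus> \<ominus> ?y \<in> M n" using n1[of m] n1[of n] m unfolding n_def by auto
    then have "(x \<oplus> \<ominus> ?y) \<oplus> ?y \<in> M n" using w submod_add Cons.prems(2) by blast
    then show "x \<in> M n"
      using submod_carrier[OF Cons.prems(2)] x w by (simp add: S.a_assoc S.l_neg)
  qed
  then show ?case using mono by (metis subset_antisym)
qed

section \<open>Integrality in terms of powers\<close>

definition pows :: "'b \<Rightarrow> nat \<Rightarrow> 'b list" where
  "pows x n = map (\<lambda>i. x [^] i) (rev [0..<n])"

lemma pows_0: "pows x 0 = []" and pows_Suc: "pows x (Suc n) = x [^] n # pows x n"
  by (simp_all add: pows_def)

lemma set_pows: "set (pows x n) = {x [^] i | i. i < n}"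
  by (auto simp: pows_def)

lemma pows_carrier: "x \<in> carrier S \<Longrightarrow> set (pows x n) \<subseteq> carrier S"
  by (auto simp: set_pows)

text \<open>The powers are listed from the highest down because \<open>eval\<close> reads a
  coefficient list from its leading end; both recursions then split off the same term.
  \<open>Ks\<close> may start with zeros, which is why its length can be exactly
  \<open>n\<close>.\<close>

lemma Span_pows_iff_eval:
  "y \<in> span (pows x n) \<longleftrightarrow>
    (\<exists>Ks. set Ks \<subseteq> h ` carrier R \<and> length Ks = n \<and> y = S.eval Ks x)"
proof (induction n arbitrary: y)
  case 0
  then show ?case by (simp add: pows_0)
next
  case (Suc n)
  show ?case
  proof
    assume "y \<in> span (pows x (Suc n))"
    then obtain k v where kv: "k \<in> carrier R" "v \<in> span (pows x n)"
      "y = h k \<otimes> x [^] n \<oplus> v" unfolding pows_Suc Span_Cons by blast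
    then obtain Ks where Ks: "set Ks \<subseteq> h ` carrier R" "length Ks = n" "v = S.eval Ks x"
      using Suc.IH by blast
    show "\<exists>Ks. set Ks \<subseteq> h ` carrier R \<and> length Ks = Suc n \<and> y = S.eval Ks x"
      by (rule exI[of _ "h k # Ks"]) (use kv Ks in auto)
  next
    assume "\<exists>Ks. set Ks \<subseteq> h ` carrier R \<and> length Ks = Suc n \<and> y = S.eval Ks x"
    then obtain k Ks where "k \<in> carrier R" "set Ks \<subseteq> h ` carrier R" "length Ks = n"
      "y = h k \<otimes> x [^] n \<oplus> S.eval Ks x" by (auto simp: length_Suc_conv)
    then show "y \<in> span (pows x (Suc n))" unfolding pows_Suc Span_Cons using Suc.IH by blast
  qed
qed

text \<open>A monic equation of degree \<open>n\<close> expresses the n-th power by the lower ones.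
  The condition \<open>\<one> \<noteq> \<zero>\<close> makes a list headed by \<open>\<one>\<close>
  a normalized polynomial.\<close>

lemma integral_over_iff_pow:
  assumes "x \<in> carrier S" "\<one> \<noteq> \<zero>"
  shows "integral_over S (h ` carrier R) x \<longleftrightarrow> (\<exists>n. x [^] n \<in> span (pows x n))"
proof
  assume "integral_over S (h ` carrier R) x"
  then obtain p where p: "polynomial (h ` carrier R) p" "p \<noteq> []" "lead_coeff p = \<one>"
    "S.eval p x = \<zero>" 
    unfolding integral_over_def univ_poly_def by auto
  then obtain Ks where Ks: "p = \<one> # Ks" by (metis list.collapse)
  let ?n = "length Ks"
  have ev: "S.eval Ks x \<in> span (pows x ?n)"
    using p(1) unfolding Span_pows_iff_eval Ks polynomial_def by auto
  note sp = submod_Span[OF pows_carrier[OF assms(1)]]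
  have "x [^] ?n \<oplus> S.eval Ks x = \<zero>" using p(4) assms(1) unfolding Ks by simp
  then have "x [^] ?n = \<ominus> S.eval Ks x"
    using S.minus_equality assms(1) submod_carrier[OF sp ev] by auto
  then show "\<exists>n. x [^] n \<in> span (pows x n)" using submod_neg[OF sp ev] by metis
next
  assume "\<exists>n. x [^] n \<in> span (pows x n)"
  then obtain n where n: "x [^] n \<in> span (pows x n)" by blast
  \<comment> \<open>The lower coefficients are read off from the negative of the power, since the
    resulting polynomial must vanish at \<open>x\<close>.\<close>
  have "\<ominus> (x [^] n) \<in> span (pows x n)"
    using submod_neg[OF submod_Span[OF pows_carrier[OF assms(1)]] n] .
  then obtain Ks where Ks: "set Ks \<subseteq> h ` carrier R" "length Ks = n"
    "\<ominus> (x [^] n) = S.eval Ks x"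
    unfolding Span_pows_iff_eval by blast
  let ?p = "\<one> # Ks"
  have "h \<one>\<^bsub>R\<^esub> \<in> h ` carrier R" by blast
  then have "polynomial (h ` carrier R) ?p" using Ks(1) assms(2) unfolding polynomial_def by simp
  moreover have "S.eval ?p x = \<zero>"
    using assms(1) by (simp add: Ks(2) Ks(3)[symmetric] S.r_neg)
  ultimately show "integral_over S (h ` carrier R) x"
    unfolding integral_over_def univ_poly_def by (intro bexI[of _ ?p]) auto
qed

text \<open>Noetherianness takes the place of the determinant trick: the spans of 1, ..., x^(i-1)
  ascend inside a finitely generated module, and where they stop, the next power is a combination of
  the lower ones.\<close>

lemma integral_if_pows_in_Span:
  assumes "x \<in> carrier S" "\<one> \<noteq> \<zero>" "set Us \<subseteq> carrier S" "\<And>i::nat. x [^] i \<in> span Us"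
  shows "integral_over S (h ` carrier R) x"
proof -
  have "\<exists>n. \<forall>m\<ge>n. span (pows x m) = span (pows x n)"
  proof (rule submod_chain_stabilizes[OF assms(3)])
    fix i
    show "submod (span (pows x i))" using submod_Span pows_carrier assms(1) by blast
    show "span (pows x i) \<subseteq> span (pows x (Suc i))"
      unfolding pows_Suc using Span_mono_Cons pows_carrier assms(1) by simp
    show "span (pows x i) \<subseteq> span Us"
      using assms(4) by (intro Span_min submod_Span assms(3)) (auto simp: set_pows)
  qed
  then obtain n where "span (pows x (Suc n)) = span (pows x n)" by (meson le_SucI order_refl)
  moreover have "x [^] n \<in> span (pows x (Suc n))"
    by (rule Span_base) (use assms(1) in \<open>auto simp: set_pows\<close>)
  ultimately show ?thesis using integral_over_iff_pow assms by blast
qed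

text \<open>Once it contains x^n, the span of the lower powers is stable under multiplication by
  \<open>x\<close> and hence contains all powers.\<close>

lemma integral_imp_pows_in_Span:
  assumes "x \<in> carrier S" "\<one> \<noteq> \<zero>" "integral_over S (h ` carrier R) x"
  obtains n where "\<And>i::nat. x [^] i \<in> span (pows x n)"
proof -
  obtain n where n: "x [^] n \<in> span (pows x n)"
    using integral_over_iff_pow assms by blast
  note sp = submod_Span[OF pows_carrier[OF assms(1), of n]]
  have le: "x [^] i \<in> span (pows x n)" if "i \<le> n" for i
  proof (cases "i = n")
    case False
    then have "x [^] i \<in> set (pows x n)" using that by (auto simp: set_pows)
    then show ?thesis using Span_base[OF pows_carrier[OF assms(1)]] by blast
  qed (use n in blast)
  have "span (pows x n) \<subseteq> {y \<in> carrier S. x \<otimes> y \<in> span (pows x n)}"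
  proof (rule Span_min[OF submod_colon[OF sp assms(1)]], rule subsetI)
    fix y assume "y \<in> set (pows x n)"
    then obtain i where i: "i < n" "y = x [^] i" by (auto simp: set_pows)
    then have "x \<otimes> y = x [^] Suc i" using assms(1) by (simp add: S.m_comm)
    then show "y \<in> {y \<in> carrier S. x \<otimes> y \<in> span (pows x n)}"
      using le[of "Suc i"] i assms(1) by (simp del: S.Span.simps)
  qed
  then have step: "x \<otimes> y \<in> span (pows x n)" if "y \<in> span (pows x n)" for y
    using that by blast
  have "x [^] i \<in> span (pows x n)" for i :: nat
  proof (induction i)
    case 0
    then show ?case using le[of 0] by simp
  next
    case (Suc i)
    then show ?case using step[OF Suc] assms(1) S.m_comm[of x "x [^] i"]
      by (simp del: S.Span.simps)
  qed
  then show ?thesis using that by blast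
qed

lemma
  assumes x: "x \<in> carrier S" "integral_over S (h ` carrier R) x"
    and y: "y \<in> carrier S" "integral_over S (h ` carrier R) y"
    and ne: "\<one> \<noteq> \<zero>"
  shows integral_mult: "integral_over S (h ` carrier R) (x \<otimes> y)"
    and integral_add: "integral_over S (h ` carrier R) (x \<oplus> y)"
proof -
  obtain n where n: "\<And>i::nat. x [^] i \<in> span (pows x n)"
    using integral_imp_pows_in_Span x ne by blast
  obtain m where m: "\<And>i::nat. y [^] i \<in> span (pows y m)"
    using integral_imp_pows_in_Span y ne by blast
  define Us where "Us = concat (map (\<lambda>a. map (\<lambda>b. a \<otimes> b) (pows y m)) (pows x n))"
  have set_Us: "set Us = {a \<otimes> b | a b. a \<in> set (pows x n) \<and> b \<in> set (pows y m)}"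
    unfolding Us_def by auto
  have px: "set (pows x n) \<subseteq> carrier S" and py: "set (pows y m) \<subseteq> carrier S"
    using pows_carrier x y by blast+
  then have Us: "set Us \<subseteq> carrier S" unfolding set_Us by auto
  note sp = submod_Span[OF Us]
  \<comment> \<open>Products of generators belong to \<open>Us\<close>. The colon submodule extends
    this to the spans one factor at a time: here in the second factor, then in the first.\<close>
  have 1: "a \<otimes> b \<in> span Us" if a: "a \<in> set (pows x n)" and b: "b \<in> span (pows y m)" for a b
  proof -
    have "span (pows y m) \<subseteq> {b \<in> carrier S. a \<otimes> b \<in> span Us}"
    proof (rule Span_min[OF submod_colon[OF sp]])
      show "set (pows y m) \<subseteq> {b \<in> carrier S. a \<otimes> b \<in> span Us}"
        using Span_base[OF Us] set_Us a py by blast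
    qed (use a px in blast)
    then show ?thesis using b by blast
  qed
  have 2: "a \<otimes> b \<in> span Us" if a: "a \<in> span (pows x n)" and b: "b \<in> span (pows y m)" for a b
  proof -
    have bc: "b \<in> carrier S" using submod_carrier[OF submod_Span[OF py] b] .
    have "span (pows x n) \<subseteq> {a \<in> carrier S. b \<otimes> a \<in> span Us}"
    proof (rule Span_min[OF submod_colon[OF sp bc]], rule subsetI)
      fix a assume a: "a \<in> set (pows x n)"
      then have "a \<in> carrier S" using px by blast
      then show "a \<in> {a \<in> carrier S. b \<otimes> a \<in> span Us}"
        using 1[OF a b] S.m_comm[OF bc] by simp
    qed
    then show ?thesis using a S.m_comm[OF bc] by (metis (mono_tags, lifting) mem_Collect_eq subsetD)
  qed
  have 3: "x [^] i \<otimes> y [^] j \<in> span Us" for i j :: nat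
    using 2 n m by blast
  show "integral_over S (h ` carrier R) (x \<otimes> y)"
    using x y 3 by (intro integral_if_pows_in_Span[OF _ ne Us])
      (auto simp: S.nat_pow_distrib simp del: S.Span.simps)
  \<comment> \<open>The prefactor makes the induction close without the binomial theorem: one factor
    x + y is absorbed into it and raises either \<open>i\<close> or \<open>j\<close>.\<close>
  have 4: "x [^] i \<otimes> y [^] j \<otimes> (x \<oplus> y) [^] l \<in> span Us" for i j l :: nat
  proof (induction l arbitrary: i j)
    case 0
    then show ?case using 3 x y by (simp del: S.Span.simps)
  next
    case (Suc l)
    have "x [^] i \<otimes> y [^] j \<otimes> (x \<oplus> y) [^] Suc l
      = x [^] Suc i \<otimes> y [^] j \<otimes> (x \<oplus> y) [^] l
      \<oplus> x [^] i \<otimes> y [^] Suc j \<otimes> (x \<oplus> y) [^] l"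
      using x y by (simp add: S.r_distr S.l_distr S.m_ac)
    then show ?case using submod_add[OF sp Suc.IH[of "Suc i" j] Suc.IH[of i "Suc j"]] by metis
  qed
  have "(x \<oplus> y) [^] l \<in> span Us" for l :: nat
    using 4[of 0 0 l] x y by (simp del: S.Span.simps)
  then show "integral_over S (h ` carrier R) (x \<oplus> y)"
    using x y by (intro integral_if_pows_in_Span[OF _ ne Us]) auto
qed

lemma integral_base:
  assumes "a \<in> carrier R" "\<one> \<noteq> \<zero>"
  shows "integral_over S (h ` carrier R) (h a)"
proof -
  have "h a [^] (1::nat) = h a \<otimes> h a [^] (0::nat) \<oplus> \<zero>" using assms by simp
  then have "h a [^] (1::nat) \<in> span (pows (h a) 1)"
    unfolding One_nat_def pows_Suc pows_0 Span_Cons Span_Nil using assms(1) by blast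
  then show ?thesis using integral_over_iff_pow assms by blast
qed

lemma subcring_integral_closure:
  assumes ne: "\<one> \<noteq> \<zero>"
  shows "subcring {x \<in> carrier S. integral_over S (h ` carrier R) x} S"
proof (rule S.subcringI', rule S.subringI)
  show "\<one> \<in> {x \<in> carrier S. integral_over S (h ` carrier R) x}"
    using integral_base[of "\<one>\<^bsub>R\<^esub>"] ne by simp
  fix x assume x: "x \<in> {x \<in> carrier S. integral_over S (h ` carrier R) x}"
  have "integral_over S (h ` carrier R) (h (\<ominus>\<^bsub>R\<^esub> \<one>\<^bsub>R\<^esub>) \<otimes> x)"
    using x ne by (intro integral_mult integral_base) auto
  then show "\<ominus> x \<in> {x \<in> carrier S. integral_over S (h ` carrier R) x}"
    using x by (simp add: S.l_minus)
qed (use integral_mult integral_add ne in auto)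

end

section \<open>The normalization of a noetherian ring\<close>

lemma
  assumes "noetherian_ring A" "cring A" "\<one>\<^bsub>A\<^esub> \<noteq> \<zero>\<^bsub>A\<^esub>"
  shows cring_normalization: "cring (normalization A)"
    and to_fractions_normalization_hom: "to_fractions A \<in> ring_hom A (normalization A)"
proof -
  interpret A: cring A by fact
  interpret Q: cring "total_fractions A" by (rule A.cring_total_fractions)
  interpret N: noetherian_base A "total_fractions A" "to_fractions A"
    by (intro noetherian_base.intro noetherian_base_axioms.intro ring_hom_cring.intro
        ring_hom_cring_axioms.intro A.to_fractions_hom assms(1) A.is_cring Q.is_cring)
  have ne: "\<one>\<^bsub>total_fractions A\<^esub> \<noteq> \<zero>\<^bsub>total_fractions A\<^esub>"
    using inj_onD[OF A.to_fractions_inj, of "\<one>\<^bsub>A\<^esub>" "\<zero>\<^bsub>A\<^esub>"] assms(3) by auto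
  show "cring (normalization A)"
    using N.subcring_integral_closure[OF ne] Q.subcring_iff
    unfolding normalization_def by (simp add: subset_eq)
  show "to_fractions A \<in> ring_hom A (normalization A)"
    using N.integral_base[OF _ ne] by (intro ring_hom_memI) (auto simp: normalization_def)
qed

section \<open>Powers of ideals and monomials\<close>

text \<open>Exponent vectors are encoded as multisets, so that the multiset order serves as the
  monomial order: it is total, well-founded and compatible with sums.\<close>

definition monoms :: "nat \<Rightarrow> nat \<Rightarrow> nat multiset set" where
  "monoms r n = {M. size M = n \<and> set_mset M \<subseteq> {..<r}}"

context cring begin

lemma ideal_ideal_power: "ideal I R \<Longrightarrow> ideal (ideal_power R I n) R"
  by (induction n) (auto intro: oneideal ideal_prod_is_ideal)

lemma ideal_power_carrier: "ideal I R \<Longrightarrow> x \<in> ideal_power R I n \<Longrightarrow> x \<in> carrier R"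
  using ideal_ideal_power ideal.Icarr by metis

lemma ideal_power_Suc_subset:
  assumes "ideal I R"
  shows "ideal_power R I (Suc n) \<subseteq> ideal_power R I n"
  using ideal_prod_inter[OF ideal_ideal_power[OF assms] assms] by simp

lemma ideal_power_antimono:
  assumes "ideal I R" "i \<le> j"
  shows "ideal_power R I j \<subseteq> ideal_power R I i"
  using assms(2) lift_Suc_antimono_le[of "ideal_power R I"] ideal_power_Suc_subset[OF assms(1)] by blast

lemma ideal_power_mult:
  assumes "ideal I R" "x \<in> ideal_power R I i" "y \<in> ideal_power R I j"
  shows "x \<otimes> y \<in> ideal_power R I (i + j)"
  using assms(3)
proof (induction j arbitrary: y)
  case 0
  then show ?case using ideal.I_r_closed[OF ideal_ideal_power[OF assms(1)] assms(2)] by simp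
next
  case (Suc j)
  have xc: "x \<in> carrier R" using ideal_power_carrier assms by blast
  from Suc.prems have "y \<in> ideal_prod R (ideal_power R I j) I" by simp
  then show ?case
  proof (induction y rule: ideal_prod.induct)
    case (prod u v)
    have "x \<otimes> u \<otimes> v \<in> ideal_power R I (Suc (i + j))"
      using ideal_prod.prod[of "x \<otimes> u" "ideal_power R I (i + j)" v I R] Suc.IH[OF prod(1)] prod(2)
      by simp
    then show ?case
      using xc ideal_power_carrier[OF assms(1) prod(1)] ideal.Icarr[OF assms(1) prod(2)]
      by (simp add: m_assoc)
  next
    case (sum u v)
    have "u \<in> carrier R" "v \<in> carrier R"
      using ideal_power_carrier[OF assms(1), of _ "Suc j"] sum.hyps by auto
    moreover have "x \<otimes> u \<oplus> x \<otimes> v \<in> ideal_power R I (i + Suc j)"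
      using additive_subgroup.a_closed[OF ideal.axioms(1)[OF ideal_ideal_power[OF assms(1)]]] sum.IH
      by blast
    ultimately show ?case using xc by (simp add: r_distr)
  qed
qed

lemma ideal_power_one: "ideal I R \<Longrightarrow> ideal_power R I 1 = I"
proof -
  assume I: "ideal I R"
  have "x \<in> ideal_prod R (carrier R) I" if "x \<in> I" for x
    using ideal_prod.prod[of \<one> "carrier R" x I R] that ideal.Icarr[OF I] by simp
  then show ?thesis using ideal_prod_inter[OF oneideal I] by auto
qed

lemma ideal_power_pow:
  assumes "ideal I R" "x \<in> ideal_power R I i"
  shows "x [^] (j::nat) \<in> ideal_power R I (i * j)"
proof (induction j)
  case (Suc j)
  then show ?case using ideal_power_mult[OF assms(1) Suc assms(2)] by (simp add: add.commute)
qed simp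

lemma ideal_colon:
  assumes "ideal J R" "v \<in> carrier R"
  shows "ideal {u \<in> carrier R. u \<otimes> v \<in> J} R"
proof -
  interpret J: ideal J R by fact
  show ?thesis
  proof (rule idealI[OF ring_axioms])
    show "subgroup {u \<in> carrier R. u \<otimes> v \<in> J} (add_monoid R)"
      by (rule add.subgroupI) (use assms(2) in \<open>auto simp: l_distr l_minus J.a_closed intro!: exI[of _ \<zero>]\<close>)
    fix u x assume u: "u \<in> {u \<in> carrier R. u \<otimes> v \<in> J}" and x: "x \<in> carrier R"
    have "x \<otimes> u \<otimes> v = x \<otimes> (u \<otimes> v)" using u x assms(2) by (simp add: m_assoc)
    then show 1: "x \<otimes> u \<in> {u \<in> carrier R. u \<otimes> v \<in> J}" using u x J.I_l_closed by simp
    then show "u \<otimes> x \<in> {u \<in> carrier R. u \<otimes> v \<in> J}" using u x m_comm[of u x] by simp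
  qed
qed

text \<open>Elements of a generated ideal need not be written as linear combinations: the
  \<open>u\<close> with u v \<in> J form the colon ideal, so generators suffice.
  \<open>Idl_mult\<close> applies this in both factors.\<close>

lemma Idl_mult_right:
  assumes "ideal J R" "G \<subseteq> carrier R" "v \<in> carrier R" "\<And>a. a \<in> G \<Longrightarrow> a \<otimes> v \<in> J" "u \<in> Idl G"
  shows "u \<otimes> v \<in> J"
proof -
  have "Idl G \<subseteq> {u \<in> carrier R. u \<otimes> v \<in> J}"
    by (rule genideal_minimal[OF ideal_colon[OF assms(1,3)]]) (use assms in auto)
  then show ?thesis using assms(5) by blast
qed

lemma Idl_mult:
  assumes "ideal J R" "G \<subseteq> carrier R" "H \<subseteq> carrier R"
    and "\<And>a b. a \<in> G \<Longrightarrow> b \<in> H \<Longrightarrow> a \<otimes> b \<in> J" and u: "u \<in> Idl G" and v: "v \<in> Idl H"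
  shows "u \<otimes> v \<in> J"
proof (rule Idl_mult_right[OF assms(1,2) _ _ u])
  show vc: "v \<in> carrier R" using v ideal.Icarr[OF genideal_ideal[OF assms(3)]] by blast
  fix a assume a: "a \<in> G"
  then have ac: "a \<in> carrier R" using assms(2) by blast
  have "v \<otimes> a \<in> J"
    by (rule Idl_mult_right[OF assms(1,3) ac _ v])
      (use a ac assms(3,4) m_comm in \<open>metis subsetD\<close>)
  then show "a \<otimes> v \<in> J" using m_comm[OF ac vc] by simp
qed

lemma Idl_insertE:
  assumes "G \<subseteq> carrier R" "a \<in> carrier R" "f \<in> Idl (insert a G)"
  obtains c v where "c \<in> carrier R" "v \<in> Idl G" "f = c \<otimes> a \<oplus> v"
proof -
  interpret J: ideal "Idl G" R by (rule genideal_ideal[OF assms(1)])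
  have "ideal (set_add R (PIdl a) (Idl G)) R"
    by (rule add_ideals[OF cgenideal_ideal[OF assms(2)] J.is_ideal])
  moreover have "insert a G \<subseteq> set_add R (PIdl a) (Idl G)"
  proof
    fix y assume y: "y \<in> insert a G"
    show "y \<in> set_add R (PIdl a) (Idl G)"
    proof (cases "y = a")
      case True
      then have "y = a \<oplus> \<zero>" using assms(2) by simp
      then show ?thesis
        unfolding set_add_def' using cgenideal_self[OF assms(2)] J.zero_closed by blast
    next
      case False
      then have "y \<in> Idl G" using y genideal_self[OF assms(1)] by blast
      moreover have "\<zero> \<in> PIdl a"
        using additive_subgroup.zero_closed ideal.axioms(1) cgenideal_ideal[OF assms(2)] by blast
      moreover have "y = \<zero> \<oplus> y" using J.Icarr[OF \<open>y \<in> Idl G\<close>] by simp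
      ultimately show ?thesis unfolding set_add_def' by blast
    qed
  qed
  ultimately have "f \<in> set_add R (PIdl a) (Idl G)" using genideal_minimal assms(3) by blast
  then show ?thesis unfolding set_add_def' cgenideal_def using that by blast
qed

definition mon :: "(nat \<Rightarrow> 'a) \<Rightarrow> nat \<Rightarrow> nat multiset \<Rightarrow> 'a" where
  "mon x r M = (\<Otimes>i\<in>{..<r}. x i [^] count M i)"

lemma mon_closed [simp]: "x \<in> {..<r} \<rightarrow> carrier R \<Longrightarrow> mon x r M \<in> carrier R"
  unfolding mon_def by (rule finprod_closed) auto

lemma mon_union: "x \<in> {..<r} \<rightarrow> carrier R \<Longrightarrow> mon x r (M + N) = mon x r M \<otimes> mon x r N"
proof -
  assume x: "x \<in> {..<r} \<rightarrow> carrier R"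
  have xc: "x i \<in> carrier R" if "i < r" for i using funcset_mem[OF x] that by simp
  have "mon x r (M + N) = (\<Otimes>i\<in>{..<r}. x i [^] count M i \<otimes> x i [^] count N i)"
    unfolding mon_def using xc by (intro finprod_cong') (auto simp: nat_pow_mult)
  then show ?thesis unfolding mon_def using x by (subst (asm) finprod_multf) auto
qed

lemma mon_empty [simp]: "mon x r {#} = \<one>"
  unfolding mon_def by (simp add: finprod_one_eqI)

lemma mon_replicate:
  assumes "x \<in> {..<r} \<rightarrow> carrier R" "i < r"
  shows "mon x r (replicate_mset e i) = x i [^] e"
proof -
  have "mon x r (replicate_mset e i) = (\<Otimes>j\<in>{..<r}. if i = j then x j [^] e else \<one>)"
    unfolding mon_def using funcset_mem[OF assms(1)] by (intro finprod_cong') auto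
  also have "\<dots> = x i [^] e"
    using finprod_singleton[of i "{..<r}" "\<lambda>j. x j [^] e"] assms funcset_mem[OF assms(1)]
    by (simp add: Pi_def)
  finally show ?thesis .
qed

lemma mon_add_mset:
  assumes "x \<in> {..<r} \<rightarrow> carrier R" "i < r"
  shows "mon x r (add_mset i M) = mon x r M \<otimes> x i"
  using mon_union[OF assms(1), of M "{#i#}"] mon_replicate[OF assms, of 1] assms
    funcset_mem[OF assms(1), of i] by simp

lemma finite_monoms: "finite (monoms r n)"
proof -
  have "monoms r n \<subseteq> mset ` {xs. set xs \<subseteq> {..<r} \<and> length xs = n}"
  proof
    fix M assume M: "M \<in> monoms r n"
    obtain xs where "mset xs = M" using ex_mset by blast
    then show "M \<in> mset ` {xs. set xs \<subseteq> {..<r} \<and> length xs = n}"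
      using M unfolding monoms_def by (auto intro!: image_eqI[of _ mset xs])
  qed
  then show ?thesis
    by (rule finite_subset) (intro finite_imageI finite_lists_length_eq finite_lessThan)
qed

context
  fixes x :: "nat \<Rightarrow> 'a" and r :: nat and I :: "'a set"
  assumes x: "x \<in> {..<r} \<rightarrow> carrier R" and I: "I = Idl (x ` {..<r})"
begin

lemma ideal_I: "ideal I R"
  unfolding I by (rule genideal_ideal) (use x in auto)

lemma mon_in_ideal_power: "M \<in> monoms r n \<Longrightarrow> mon x r M \<in> ideal_power R I n"
proof (induction M arbitrary: n)
  case empty
  then show ?case by (simp add: monoms_def)
next
  case (add i M)
  then have i: "i < r" and M: "M \<in> monoms r (size M)" and n: "n = Suc (size M)"
    by (auto simp: monoms_def)
  have "x i \<in> I" unfolding I using i x genideal_self[of "x ` {..<r}"] by auto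
  then show ?case
    using ideal_prod.prod[OF add.IH[OF M]] mon_add_mset[OF x i] n by simp
qed

lemma ideal_power_eq_Idl_mon: "ideal_power R I n = Idl (mon x r ` monoms r n)"
proof
  show "Idl (mon x r ` monoms r n) \<subseteq> ideal_power R I n"
    by (rule genideal_minimal[OF ideal_ideal_power[OF ideal_I]]) (auto intro: mon_in_ideal_power)
  have mc: "mon x r ` F \<subseteq> carrier R" for F using mon_closed[OF x] by blast
  show "ideal_power R I n \<subseteq> Idl (mon x r ` monoms r n)"
  proof (induction n)
    case 0
    have "{#} \<in> monoms r 0" by (simp add: monoms_def)
    then have "\<one> \<in> Idl (mon x r ` monoms r 0)"
      using genideal_self[OF mc, of "monoms r 0"] mon_empty[of x r] by (metis image_eqI subsetD)
    then show ?case using ideal.one_imp_carrier[OF genideal_ideal[OF mc]] by auto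
  next
    case (Suc n)
    interpret J: ideal "Idl (mon x r ` monoms r (Suc n))" R by (rule genideal_ideal[OF mc])
    have "u \<otimes> v \<in> Idl (mon x r ` monoms r (Suc n))"
      if "u \<in> ideal_power R I n" "v \<in> I" for u v
    proof (rule Idl_mult[OF J.is_ideal mc[of "monoms r n"], of "x ` {..<r}"])
      show "x ` {..<r} \<subseteq> carrier R" using x by auto
      show "u \<in> Idl (mon x r ` monoms r n)" using that Suc by blast
      show "v \<in> Idl (x ` {..<r})" using that I by simp
      fix a b assume "a \<in> mon x r ` monoms r n" "b \<in> x ` {..<r}"
      then obtain M i where M: "M \<in> monoms r n" "a = mon x r M" and i: "i < r" "b = x i" by auto
      have "add_mset i M \<in> monoms r (Suc n)" using M i by (simp add: monoms_def)
      moreover have "a \<otimes> b = mon x r (add_mset i M)" using M i mon_add_mset[OF x] by simp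
      ultimately show "a \<otimes> b \<in> Idl (mon x r ` monoms r (Suc n))"
        using genideal_self[OF mc, of "monoms r (Suc n)"] by blast
    qed
    note uv = this
    have "z \<in> Idl (mon x r ` monoms r (Suc n))" if "z \<in> ideal_prod R (ideal_power R I n) I" for z
      using that by (induction z rule: ideal_prod.induct) (auto intro: uv J.a_closed)
    then show ?case by auto
  qed
qed

text \<open>If all exponents stayed below their \<open>e i\<close>, the degree could not exceed the
  sum of the \<open>e i\<close>. The bound is used twice: to find a power of \<open>m\<close> in the
  conductor, and to pass from powers of single generators that kill a class to a power of the ideal
  that kills it.\<close>

lemma mon_pigeonhole:
  assumes M: "M \<in> monoms r n" and n: "(\<Sum>i<r. e i) < n"
  obtains i M' where "i < r" "M' \<in> monoms r (n - e i)" "e i \<le> n"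
    "mon x r M = mon x r M' \<otimes> x i [^] e i"
proof -
  have "\<exists>i<r. e i \<le> count M i"
  proof (rule ccontr)
    assume "\<not> ?thesis"
    then have "(\<Sum>i<r. count M i) \<le> (\<Sum>i<r. e i)" by (intro sum_mono) (auto simp: not_le less_imp_le)
    moreover have "size M = (\<Sum>i<r. count M i)"
      unfolding size_multiset_overloaded_eq
      by (rule sum.mono_neutral_left) (use M in \<open>auto simp: monoms_def not_in_iff\<close>)
    ultimately show False using M n by (simp add: monoms_def)
  qed
  then obtain i where i: "i < r" "e i \<le> count M i" by blast
  then have sub: "replicate_mset (e i) i \<subseteq># M" by (simp add: count_le_replicate_mset_subset_eq)
  let ?M' = "M - replicate_mset (e i) i"
  have eq: "M = ?M' + replicate_mset (e i) i" using sub by simp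
  have "size M = size ?M' + e i" by (subst eq) (simp only: size_union size_replicate_mset)
  then have "?M' \<in> monoms r (n - e i)" "e i \<le> n"
    using M by (auto simp: monoms_def dest: in_diffD)
  moreover have "mon x r M = mon x r ?M' \<otimes> x i [^] e i"
    by (subst eq) (simp only: mon_union[OF x] mon_replicate[OF x i(1)])
  ultimately show ?thesis using that i by blast
qed

end

end

section \<open>Dickson's lemma\<close>

lemma nat_incseq_subseq: "\<exists>g. strict_mono g \<and> incseq (\<lambda>k. (s::nat \<Rightarrow> nat) (g k))"
proof -
  obtain g where g: "strict_mono g" "monoseq (\<lambda>k. s (g k))" using seq_monosub by blast
  show ?thesis
  proof (cases "incseq (\<lambda>k. s (g k))")
    case False
    then have dec: "decseq (\<lambda>k. s (g k))" using g(2) by (simp add: monoseq_iff)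
    \<comment> \<open>A decreasing sequence of naturals is constant from the place where it attains
      its minimum, and a constant tail is weakly increasing.\<close>
    define v where "v = (LEAST v. v \<in> range (\<lambda>k. s (g k)))"
    have "v \<in> range (\<lambda>k. s (g k))" unfolding v_def by (rule LeastI) auto
    then obtain N where N: "v = s (g N)" by blast
    have "s (g (N + k)) = v" for k
      using decseqD[OF dec, of N "N + k"] N Least_le[of "\<lambda>v. v \<in> range (\<lambda>k. s (g k))" "s (g (N + k))"]
      unfolding v_def by (simp add: le_antisym)
    then show ?thesis
      using g(1) by (intro exI[of _ "\<lambda>k. g (N + k)"]) (simp add: strict_mono_def incseq_def)
  qed (use g in blast)
qed

text \<open>One comparable pair of exponent vectors would not be enough: later the second index must
  lie beyond a bound that depends on the first. A subsequence increasing in all coordinates provides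
  this.\<close>

lemma dickson:
  assumes "finite I"
  shows "\<exists>g. strict_mono g \<and> (\<forall>i\<in>I. incseq (\<lambda>k. (s::nat \<Rightarrow> 'i \<Rightarrow> nat) (g k) i))"
  using assms
proof (induction I)
  case empty
  show ?case using strict_mono_id by auto
next
  case (insert i I)
  then obtain g where g: "strict_mono g" "\<forall>i\<in>I. incseq (\<lambda>k. s (g k) i)" by blast
  obtain f where f: "strict_mono f" "incseq (\<lambda>k. s (g (f k)) i)"
    using nat_incseq_subseq[of "\<lambda>k. s (g k) i"] by blast
  have "incseq (\<lambda>k. s (g (f k)) j)" if "j \<in> I" for j
    using g(2) that monoD[OF strict_mono_mono[OF f(1)]] by (auto simp: incseq_def)
  then show ?case
    using strict_mono_o[OF g(1) f(1)] f(2) by (intro exI[of _ "g \<circ> f"]) (auto simp: o_def)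
qed

text \<open>Zorn's lemma, applied below with \<open>T = {\<one>}\<close> to obtain maximal ideals
  and with a multiplicative set to obtain primes.\<close>

lemma (in ring) exists_maximal_ideal_avoiding:
  assumes "ideal I R" "I \<inter> T = {}"
  obtains M where "ideal M R" "I \<subseteq> M" "M \<inter> T = {}"
    "\<forall>J. ideal J R \<longrightarrow> M \<subseteq> J \<longrightarrow> J \<inter> T = {} \<longrightarrow> J = M"
proof -
  let ?S = "{J. ideal J R \<and> I \<subseteq> J \<and> J \<inter> T = {}}"
  have "\<exists>M\<in>?S. \<forall>J\<in>?S. M \<subseteq> J \<longrightarrow> J = M"
  proof (rule subset_Zorn_nonempty)
    show "?S \<noteq> {}" using assms by blast
    fix C assume C: "C \<noteq> {}" "subset.chain ?S C"
    then have "subset.chain {J. ideal J R} C" unfolding pred_on.chain_def by blast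
    then have "ideal (\<Union>C) R" using chain_Union_is_ideal[of C] C(1) by simp
    then show "\<Union>C \<in> ?S" using C unfolding pred_on.chain_def by blast
  qed
  then obtain M where M: "M \<in> ?S" "\<forall>J\<in>?S. M \<subseteq> J \<longrightarrow> J = M" by (elim bexE)
  have "J = M" if "ideal J R" "M \<subseteq> J" "J \<inter> T = {}" for J
  proof -
    have "I \<subseteq> J" using M(1) that(2) by auto
    then show ?thesis using M(2) that by simp
  qed
  then show ?thesis using M(1) by (intro that[of M]) simp_all
qed

text \<open>A nonunit generates a proper ideal, which lies in some maximal ideal, and
  \<open>m\<close> is the only one.\<close>

lemma local_ring_unit:
  assumes "local_ring R m" "c \<in> carrier R" "c \<notin> m"
  shows "\<exists>d \<in> carrier R. d \<otimes>\<^bsub>R\<^esub> c = \<one>\<^bsub>R\<^esub>"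
proof (rule ccontr)
  assume no: "\<not> ?thesis"
  interpret cring R using assms(1) by (simp add: local_ring_def)
  have "PIdl\<^bsub>R\<^esub> c \<inter> {\<one>\<^bsub>R\<^esub>} = {}" using no by (auto simp: cgenideal_def)
  then obtain M where M: "ideal M R" "PIdl\<^bsub>R\<^esub> c \<subseteq> M" "M \<inter> {\<one>\<^bsub>R\<^esub>} = {}"
    and max: "\<forall>J. ideal J R \<longrightarrow> M \<subseteq> J \<longrightarrow> J \<inter> {\<one>\<^bsub>R\<^esub>} = {} \<longrightarrow> J = M"
    by (rule exists_maximal_ideal_avoiding[OF cgenideal_ideal[OF assms(2)]])
  have "maximalideal M R"
  proof (rule maximalidealI[OF M(1)])
    show "carrier R \<noteq> M" using M(3) by blast
    fix J assume "ideal J R" "M \<subseteq> J" "J \<subseteq> carrier R"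
    then show "J = M \<or> J = carrier R" using max ideal.one_imp_carrier[of J R] by blast
  qed
  then have "M = m" using assms(1) unfolding local_ring_def by blast
  then show False using M(2) assms(3) cgenideal_self[OF assms(2)] by blast
qed

lemma (in noetherian_ring) ideal_gensE:
  assumes "ideal I R"
  obtains x r where "x \<in> {..<r::nat} \<rightarrow> carrier R" "I = Idl (x ` {..<r})"
proof -
  obtain F where F: "F \<subseteq> carrier R" "finite F" "I = Idl F" using finetely_gen[OF assms] by blast
  then obtain r and x :: "nat \<Rightarrow> 'a" where "F = x ` {i. i < r}"
    using finite_imp_nat_seg_image_inj_on[OF F(2)] by blast
  then show ?thesis using F by (intro that[of x r]) (auto simp: lessThan_def)
qed

section \<open>Classes killed by high powers of the maximal ideal\<close>

context cring begin

text \<open>These are the degrees in which G(A) has torsion with respect to its irrelevant ideal.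
  Multiplying a torsion class with leading monomial \<alpha> by a monomial \<gamma> of high degree
  gives zero, which exhibits the monomial \<alpha> + \<gamma> as a combination of smaller ones
  modulo the next power of \<open>m\<close>. Leading monomials of nonzero classes are never such
  combinations. With infinitely many degrees, Dickson's lemma produces a leading monomial of the
  form \<alpha> + \<gamma>, a contradiction.\<close>

lemma finite_degrees_of_torsion:
  assumes noeth: "noetherian_ring R" and loc: "local_ring R m"
  shows "finite {n. \<exists>f \<in> ideal_power R m n - ideal_power R m (Suc n).
    \<exists>N. \<forall>N'\<ge>N. \<forall>a \<in> ideal_power R m N'. a \<otimes> f \<in> ideal_power R m (Suc (n + N'))}"
    (is "finite ?D")
proof (rule ccontr)
  let ?p = "ideal_power R m"
  assume "infinite ?D"
  have m: "ideal m R" using loc unfolding local_ring_def maximalideal_def by blast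
  then obtain x and r :: nat where x: "x \<in> {..<r} \<rightarrow> carrier R" and m_eq: "m = Idl (x ` {..<r})"
    by (rule noetherian_ring.ideal_gensE[OF noeth])
  have mc: "mon x r ` F \<subseteq> carrier R" for F using mon_closed[OF x] by blast
  \<comment> \<open>For monomials of degree \<open>n\<close>, this is the preimage in m^n of the
    span of their classes over the residue field. Inclusions of such ideals replace linear algebra
    in the quotient m^n/m^(n+1).\<close>
  define J where "J n F = Idl (?p (Suc n) \<union> mon x r ` F)" for n F
  have gens: "?p (Suc n) \<union> mon x r ` F \<subseteq> carrier R" for n F
    using mc ideal_power_carrier[OF m] by blast
  have J_ideal: "ideal (J n F) R" for n F
    unfolding J_def by (rule genideal_ideal[OF gens])
  have J_pow: "?p (Suc n) \<subseteq> J n F" and J_mon: "mon x r ` F \<subseteq> J n F" for n F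
    unfolding J_def using genideal_self[OF gens, of n F] by blast+
  \<comment> \<open>Here \<alpha> is the least bound for the monomials needed to write
    \<open>f\<close> modulo the next power. Its coefficient \<open>c\<close> is a unit, and by
    minimality the monomial \<alpha> itself does not depend on the smaller ones.\<close>
  have lead: "\<exists>\<alpha> \<in> monoms r n. mon x r \<alpha> \<notin> J n {\<beta> \<in> monoms r n. \<beta> < \<alpha>} \<and>
      (\<exists>c d v. c \<in> carrier R \<and> d \<in> carrier R \<and> d \<otimes> c = \<one> \<and>
        v \<in> J n {\<beta> \<in> monoms r n. \<beta> < \<alpha>} \<and> f = c \<otimes> mon x r \<alpha> \<oplus> v)"
    if f: "f \<in> ?p n" "f \<notin> ?p (Suc n)" for f n
  proof -
    let ?P = "\<lambda>\<alpha>. \<alpha> \<in> monoms r n \<and> f \<in> J n {\<beta> \<in> monoms r n. \<beta> \<le> \<alpha>}"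
    have J_empty: "J n {} = ?p (Suc n)"
      using J_pow genideal_minimal[OF ideal_ideal_power[OF m]] unfolding J_def
      by (metis Un_empty_right image_empty order_refl subset_antisym)
    have "f \<in> Idl (mon x r ` monoms r n)" using f(1) ideal_power_eq_Idl_mon[OF x m_eq] by simp
    moreover have "Idl (mon x r ` monoms r n) \<subseteq> J n (monoms r n)"
      by (rule genideal_minimal[OF J_ideal J_mon])
    ultimately have fJ: "f \<in> J n (monoms r n)" by blast
    then have "monoms r n \<noteq> {}" using J_empty f(2) by metis
    then have "Max (monoms r n) \<in> monoms r n" using finite_monoms by (intro Max_in)
    moreover have "{\<beta> \<in> monoms r n. \<beta> \<le> Max (monoms r n)} = monoms r n"
      using Max_ge[OF finite_monoms] by blast
    ultimately have "?P (Max (monoms r n))" using fJ by simp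
    then have "\<exists>\<alpha>. ?P \<alpha>" by (rule exI)
    define \<alpha> where "\<alpha> = (LEAST \<alpha>. ?P \<alpha>)"
    have \<alpha>: "?P \<alpha>" using LeastI_ex[OF \<open>\<exists>\<alpha>. ?P \<alpha>\<close>] unfolding \<alpha>_def .
    let ?L = "{\<beta> \<in> monoms r n. \<beta> < \<alpha>}"
    \<comment> \<open>Otherwise the largest monomial below \<alpha> would already be a bound. It
      exists because \<open>f\<close> lies outside m^(n+1), so that some smaller monomial is
      needed.\<close>
    have fL: "f \<notin> J n ?L"
    proof
      assume fL: "f \<in> J n ?L"
      then have "?L \<noteq> {}" using J_empty f(2) by metis
      moreover have "finite ?L" using finite_monoms by auto
      ultimately have M: "Max ?L \<in> ?L" by (intro Max_in)
      have "?L = {\<beta> \<in> monoms r n. \<beta> \<le> Max ?L}"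
        using M Max_ge[OF \<open>finite ?L\<close>] by auto
      then have "f \<in> J n {\<beta> \<in> monoms r n. \<beta> \<le> Max ?L}" using fL by simp
      then have "?P (Max ?L)" using M by simp
      then have "\<alpha> \<le> Max ?L" unfolding \<alpha>_def by (rule Least_le)
      then show False using M by auto
    qed
    have "{\<beta> \<in> monoms r n. \<beta> \<le> \<alpha>} = insert \<alpha> ?L" using \<alpha> by auto
    then have "f \<in> Idl (insert (mon x r \<alpha>) (?p (Suc n) \<union> mon x r ` ?L))"
      using \<alpha> unfolding J_def by (metis (no_types, lifting) Un_insert_right image_insert)
    then obtain c v where cv: "c \<in> carrier R" "v \<in> J n ?L" "f = c \<otimes> mon x r \<alpha> \<oplus> v"
      unfolding J_def by (rule Idl_insertE[OF gens mon_closed[OF x]])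
    interpret L: ideal "J n ?L" R by (rule J_ideal)
    have nin: "c \<otimes> mon x r \<alpha> \<notin> J n ?L" using fL cv L.a_closed by blast
    \<comment> \<open>A coefficient in \<open>m\<close> would push the leading term into m^(n+1),
      which is contained in the ideal of the lower terms.\<close>
    have "c \<notin> m"
    proof
      assume "c \<in> m"
      then have "c \<otimes> mon x r \<alpha> \<in> ?p (Suc n)"
        using ideal_power_mult[OF m, of c 1 "mon x r \<alpha>" n] mon_in_ideal_power[OF x m_eq] \<alpha>
          ideal_power_one[OF m] by simp
      then show False using nin J_pow by blast
    qed
    then obtain d where "d \<in> carrier R" "d \<otimes> c = \<one>" using local_ring_unit[OF loc] cv(1) by blast
    moreover have "mon x r \<alpha> \<notin> J n ?L" using nin cv(1) L.I_l_closed by blast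
    ultimately show ?thesis using \<alpha> cv by blast
  qed
  from infinite_enumerate[OF \<open>infinite ?D\<close>]
  obtain e :: "nat \<Rightarrow> nat" where e: "strict_mono e \<and> (\<forall>k. e k \<in> ?D)" ..
  have "\<exists>f N. f \<in> ?p (e k) \<and> f \<notin> ?p (Suc (e k)) \<and>
      (\<forall>N'\<ge>N. \<forall>a \<in> ?p N'. a \<otimes> f \<in> ?p (Suc (e k + N')))" for k
    using e by blast
  then obtain f N where f: "\<And>k. f k \<in> ?p (e k)" "\<And>k. f k \<notin> ?p (Suc (e k))"
    and N: "\<And>k N' a. N' \<ge> N k \<Longrightarrow> a \<in> ?p N' \<Longrightarrow>
      a \<otimes> f k \<in> ?p (Suc (e k + N'))" by metis
  define L where "L n f \<alpha> \<longleftrightarrow> \<alpha> \<in> monoms r n \<and> mon x r \<alpha> \<notin> J n {\<beta> \<in> monoms r n. \<beta> < \<alpha>} \<and>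
      (\<exists>c d v. c \<in> carrier R \<and> d \<in> carrier R \<and> d \<otimes> c = \<one> \<and>
        v \<in> J n {\<beta> \<in> monoms r n. \<beta> < \<alpha>} \<and> f = c \<otimes> mon x r \<alpha> \<oplus> v)" for n f \<alpha>
  have "\<exists>\<alpha>. L (e k) (f k) \<alpha>" for k using lead[OF f, of k] unfolding L_def by blast
  then obtain \<alpha> where L: "\<And>k. L (e k) (f k) (\<alpha> k)" by metis
  then have \<alpha>: "\<And>k. \<alpha> k \<in> monoms r (e k)"
    and nin: "\<And>k. mon x r (\<alpha> k) \<notin> J (e k) {\<beta> \<in> monoms r (e k). \<beta> < \<alpha> k}"
    and rep: "\<And>k. \<exists>c d v. c \<in> carrier R \<and> d \<in> carrier R \<and> d \<otimes> c = \<one> \<and>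
        v \<in> J (e k) {\<beta> \<in> monoms r (e k). \<beta> < \<alpha> k} \<and> f k = c \<otimes> mon x r (\<alpha> k) \<oplus> v"
    unfolding L_def by blast+
  obtain g where g: "strict_mono g" "\<forall>i\<in>{..<r}. incseq (\<lambda>k. count (\<alpha> (g k)) i)"
    using dickson[of "{..<r}" "\<lambda>k. count (\<alpha> k)"] by blast
  \<comment> \<open>As \<open>e \<circ> g\<close> is strictly increasing, e (g k) is at least k.
    This index therefore makes the degree gap at least N (g 0), from where on multiplication kills
    the class of f (g 0).\<close>
  define k where "k = e (g 0) + N (g 0)"
  let ?nz = "e (g 0)" and ?n = "e (g k)" and ?az = "\<alpha> (g 0)" and ?\<alpha> = "\<alpha> (g k)"
  have n: "?n \<ge> ?nz + N (g 0)"
  proof -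
    have "k \<le> e (g k)"
      using strict_mono_imp_increasing[OF strict_mono_o[OF conjunct1[OF e] g(1)], of k]
      by (simp only: o_def)
    then show ?thesis using k_def by linarith
  qed
  have sub: "?az \<subseteq># ?\<alpha>"
  proof (rule mset_subset_eqI)
    fix i show "count ?az i \<le> count ?\<alpha> i"
    proof (cases "i < r")
      case True
      then show ?thesis using g(2) by (auto simp: incseq_def)
    next
      case False
      then have "i \<notin># ?az" using \<alpha>[of "g 0"] by (auto simp: monoms_def)
      then show ?thesis by (simp add: not_in_iff)
    qed
  qed
  define \<gamma> where "\<gamma> = ?\<alpha> - ?az"
  have \<gamma>: "?\<alpha> = \<gamma> + ?az" unfolding \<gamma>_def using sub by simp
  have sz: "\<gamma> \<in> monoms r (?n - ?nz)"
    using \<alpha>[of "g k"] \<alpha>[of "g 0"] unfolding \<gamma> by (auto simp: monoms_def)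
  obtain c d v where c: "c \<in> carrier R" "d \<in> carrier R" "d \<otimes> c = \<one>"
    and v: "v \<in> J ?nz {\<beta> \<in> monoms r ?nz. \<beta> < ?az}" and fe: "f (g 0) = c \<otimes> mon x r ?az \<oplus> v"
    using rep[of "g 0"] by blast
  let ?J = "J ?n {\<beta> \<in> monoms r ?n. \<beta> < ?\<alpha>}"
  interpret L: ideal ?J R by (rule J_ideal)
  have m\<gamma>: "mon x r \<gamma> \<in> ?p (?n - ?nz)" by (rule mon_in_ideal_power[OF x m_eq sz])
  have vc: "v \<in> carrier R" using v ideal.Icarr[OF J_ideal] by blast
  \<comment> \<open>Adding \<gamma> preserves the multiset order, so the lower terms of f (g 0)
    become monomials below the leading one in the new degree, while terms in the next power of
    \<open>m\<close> stay in the next power.\<close>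
  have 1: "v \<otimes> mon x r \<gamma> \<in> ?J"
  proof (rule Idl_mult_right[OF J_ideal gens mon_closed[OF x] _ v[unfolded J_def]])
    fix a assume "a \<in> ?p (Suc ?nz) \<union> mon x r ` {\<beta> \<in> monoms r ?nz. \<beta> < ?az}"
    then show "a \<otimes> mon x r \<gamma> \<in> ?J"
    proof
      assume "a \<in> ?p (Suc ?nz)"
      then have "a \<otimes> mon x r \<gamma> \<in> ?p (Suc ?n)"
        using ideal_power_mult[OF m _ m\<gamma>] n by fastforce
      then show ?thesis using J_pow by blast
    next
      assume "a \<in> mon x r ` {\<beta> \<in> monoms r ?nz. \<beta> < ?az}"
      then obtain \<beta> where \<beta>: "\<beta> \<in> monoms r ?nz" "\<beta> < ?az" "a = mon x r \<beta>" by blast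
      have "\<gamma> + \<beta> \<in> {\<beta> \<in> monoms r ?n. \<beta> < ?\<alpha>}"
        using \<beta> sz n unfolding \<gamma> by (auto simp: monoms_def)
      moreover have "a \<otimes> mon x r \<gamma> = mon x r (\<gamma> + \<beta>)"
        using \<beta>(3) mon_union[OF x] by (simp add: add.commute)
      ultimately have "a \<otimes> mon x r \<gamma> \<in> mon x r ` {\<beta> \<in> monoms r ?n. \<beta> < ?\<alpha>}"
        by (intro image_eqI)
      then show ?thesis by (rule subsetD[OF J_mon])
    qed
  qed
  have "mon x r \<gamma> \<otimes> f (g 0) \<in> ?p (Suc ?n)"
    using N[of "g 0", OF _ m\<gamma>] n le_add_diff_inverse[of ?nz ?n] by (simp del: ideal_power.simps)
  then have 2: "mon x r \<gamma> \<otimes> f (g 0) \<in> ?J" using J_pow by blast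
  \<comment> \<open>The product with f (g 0) lies in the next power, so modulo that power the
    leading term is the negative of the lower ones. Dividing by the unit \<open>c\<close>
    contradicts the independence of the monomial.\<close>
  have "c \<otimes> mon x r ?\<alpha> = mon x r \<gamma> \<otimes> f (g 0) \<ominus> v \<otimes> mon x r \<gamma>"
    unfolding fe \<gamma> mon_union[OF x] using c(1) vc mon_closed[OF x] by algebra
  then have "c \<otimes> mon x r ?\<alpha> \<in> ?J"
    using L.a_closed[OF 2 L.a_inv_closed[OF 1]] by (simp only: minus_eq)
  then have "d \<otimes> (c \<otimes> mon x r ?\<alpha>) \<in> ?J" by (rule L.I_l_closed[OF _ c(2)])
  then have "mon x r ?\<alpha> \<in> ?J" using c mon_closed[OF x] by (simp add: m_assoc[symmetric])
  then show False using nin[of "g k"] by simp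
qed

end

section \<open>The associated graded ring\<close>

declare ideal_power.simps(2) [simp del]

locale cring_ideal = cring R for R :: "('a, 'c) ring_scheme" (structure) +
  fixes I :: "'a set"
  assumes ideal: "ideal I R"
begin

abbreviation pw :: "nat \<Rightarrow> 'a set" where "pw \<equiv> ideal_power R I"

text \<open>Formed for every ring element and not only for elements of \<open>pw n\<close>, so that
  sums of classes can be computed without membership conditions.\<close>

definition cls :: "nat \<Rightarrow> 'a \<Rightarrow> 'a set" where "cls n x = pw (Suc n) +> x"

lemma pw_ideal: "ideal (pw n) R"
  by (rule ideal_ideal_power[OF ideal])

lemma pw_carrier: "x \<in> pw n \<Longrightarrow> x \<in> carrier R"
  by (rule ideal_power_carrier[OF ideal])

lemma pw_Suc: "x \<in> pw (Suc n) \<Longrightarrow> x \<in> pw n"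
  using ideal_power_Suc_subset[OF ideal] by blast

lemma pw_zero [simp]: "\<zero> \<in> pw n"
  by (rule additive_subgroup.zero_closed[OF ideal.axioms(1)[OF pw_ideal]])

lemma pw_add: "x \<in> pw n \<Longrightarrow> y \<in> pw n \<Longrightarrow> x \<oplus> y \<in> pw n"
  by (rule additive_subgroup.a_closed[OF ideal.axioms(1)[OF pw_ideal]])

lemma pw_neg: "x \<in> pw n \<Longrightarrow> \<ominus> x \<in> pw n"
  by (rule additive_subgroup.a_inv_closed[OF ideal.axioms(1)[OF pw_ideal]])

lemma pw_mult: "x \<in> pw i \<Longrightarrow> y \<in> pw j \<Longrightarrow> x \<otimes> y \<in> pw (i + j)"
  by (rule ideal_power_mult[OF ideal])

lemma pw_finsum: "finite F \<Longrightarrow> (\<And>i. i \<in> F \<Longrightarrow> f i \<in> pw n) \<Longrightarrow> (\<Oplus>i\<in>F. f i) \<in> pw n"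
proof (induction F rule: finite_induct)
  case (insert i F)
  then have "f \<in> F \<rightarrow> carrier R" "f i \<in> carrier R" using pw_carrier by auto
  then have "(\<Oplus>i\<in>insert i F. f i) = f i \<oplus> (\<Oplus>i\<in>F. f i)" using insert by simp
  then show ?case using insert pw_add by simp
qed simp

lemma cls_eq_iff: "x \<in> carrier R \<Longrightarrow> y \<in> carrier R \<Longrightarrow> cls n x = cls n y \<longleftrightarrow> x \<ominus> y \<in> pw (Suc n)"
  unfolding cls_def using quotient_eq_iff_same_a_r_cos[OF pw_ideal] by blast

lemma cls_eq_zero_iff: "x \<in> carrier R \<Longrightarrow> cls n x = cls n \<zero> \<longleftrightarrow> x \<in> pw (Suc n)"
  by (simp add: cls_eq_iff minus_eq)

lemma cls_zero: "cls n \<zero> = pw (Suc n)"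
  unfolding cls_def by (rule a_rcos_zero[OF pw_ideal pw_zero])

lemma cls_self: "x \<in> carrier R \<Longrightarrow> x \<in> cls n x"
  unfolding cls_def
  by (rule abelian_subgroup.a_rcos_self[OF abelian_subgroupI3[OF ideal.axioms(1)[OF pw_ideal] is_abelian_group]])

lemma mem_cls: "x \<in> carrier R \<Longrightarrow> y \<in> cls n x \<Longrightarrow> y \<in> carrier R \<and> cls n y = cls n x"
proof -
  assume x: "x \<in> carrier R" and y: "y \<in> cls n x"
  then obtain z where z: "z \<in> pw (Suc n)" "y = z \<oplus> x"
    unfolding cls_def a_r_coset_def' by blast
  then have zc: "z \<in> carrier R" using pw_carrier by blast
  then have "y \<ominus> x = z" using x z(2) by (simp add: minus_eq a_assoc r_neg)
  then show ?thesis using cls_eq_iff[of y x n] x z zc by simp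
qed

lemma gr_carrier: "carrier (gr_comp R I n) = cls n ` pw n"
  unfolding gr_comp_def carrier_FactGroup cls_def a_r_coset_def r_coset_def by simp

lemma gr_one: "\<one>\<^bsub>gr_comp R I n\<^esub> = cls n \<zero>"
  unfolding gr_comp_def cls_zero by simp

lemma gr_mult:
  assumes "x \<in> carrier R" "y \<in> carrier R"
  shows "cls n x \<otimes>\<^bsub>gr_comp R I n\<^esub> cls n y = cls n (x \<oplus> y)"
proof -
  have "cls n x \<otimes>\<^bsub>gr_comp R I n\<^esub> cls n y = set_add R (cls n x) (cls n y)"
    unfolding gr_comp_def set_add_def by (simp add: set_mult_def)
  then show ?thesis unfolding cls_def using ideal.a_rcos_sum[OF pw_ideal assms] by simp
qed

lemma comm_group_gr: "comm_group (gr_comp R I n)"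
proof (rule comm_groupI)
  fix C D E assume "C \<in> carrier (gr_comp R I n)" "D \<in> carrier (gr_comp R I n)"
  then obtain x y where x: "x \<in> pw n" "C = cls n x" and y: "y \<in> pw n" "D = cls n y"
    unfolding gr_carrier by blast
  note c = pw_carrier[OF x(1)] pw_carrier[OF y(1)]
  show "C \<otimes>\<^bsub>gr_comp R I n\<^esub> D \<in> carrier (gr_comp R I n)"
    unfolding x(2) y(2) gr_mult[OF c] gr_carrier using pw_add x(1) y(1) by blast
  show "C \<otimes>\<^bsub>gr_comp R I n\<^esub> D = D \<otimes>\<^bsub>gr_comp R I n\<^esub> C"
    unfolding x(2) y(2) using c by (simp add: gr_mult a_comm)
  assume "E \<in> carrier (gr_comp R I n)"
  then obtain z where z: "z \<in> pw n" "E = cls n z" unfolding gr_carrier by blast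
  show "C \<otimes>\<^bsub>gr_comp R I n\<^esub> D \<otimes>\<^bsub>gr_comp R I n\<^esub> E = C \<otimes>\<^bsub>gr_comp R I n\<^esub> (D \<otimes>\<^bsub>gr_comp R I n\<^esub> E)"
    unfolding x(2) y(2) z(2) using c pw_carrier[OF z(1)] by (simp add: gr_mult a_assoc)
next
  show "\<one>\<^bsub>gr_comp R I n\<^esub> \<in> carrier (gr_comp R I n)"
    unfolding gr_one gr_carrier by (rule imageI) simp
  fix C assume "C \<in> carrier (gr_comp R I n)"
  then obtain x where x: "x \<in> pw n" "C = cls n x" unfolding gr_carrier by blast
  note c = pw_carrier[OF x(1)]
  show "\<one>\<^bsub>gr_comp R I n\<^esub> \<otimes>\<^bsub>gr_comp R I n\<^esub> C = C"
    unfolding gr_one x(2) using c by (simp add: gr_mult)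
  have "cls n (\<ominus> x) \<otimes>\<^bsub>gr_comp R I n\<^esub> C = \<one>\<^bsub>gr_comp R I n\<^esub>"
    unfolding gr_one x(2) using c by (simp add: gr_mult l_neg)
  then show "\<exists>D\<in>carrier (gr_comp R I n). D \<otimes>\<^bsub>gr_comp R I n\<^esub> C = \<one>\<^bsub>gr_comp R I n\<^esub>"
    unfolding gr_carrier using pw_neg[OF x(1)] by blast
qed

text \<open>The factors are cosets of different ideals and the product is a coset of a third one, so
  this is not multiplication in a single quotient ring. Changing the representatives by
  \<open>z\<close> and \<open>w\<close> alters the product by z w + z y + x w, and each summand lies
  in I^(i+j+1).\<close>

lemma rcoset_mult_cls:
  assumes "x \<in> pw i" "y \<in> pw j"
  shows "rcoset_mult R (pw (Suc (i + j))) (cls i x) (cls j y) = cls (i + j) (x \<otimes> y)"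
proof -
  have *: "cls (i + j) (a \<otimes> b) = cls (i + j) (x \<otimes> y)" if a: "a \<in> cls i x" and b: "b \<in> cls j y" for a b
  proof -
    obtain z where z: "z \<in> pw (Suc i)" "a = z \<oplus> x"
      using a unfolding cls_def a_r_coset_def' by blast
    obtain w where w: "w \<in> pw (Suc j)" "b = w \<oplus> y"
      using b unfolding cls_def a_r_coset_def' by blast
    note c = pw_carrier[OF assms(1)] pw_carrier[OF assms(2)] pw_carrier[OF z(1)] pw_carrier[OF w(1)]
    have "a \<otimes> b \<ominus> x \<otimes> y = z \<otimes> w \<oplus> z \<otimes> y \<oplus> x \<otimes> w"
      unfolding z(2) w(2) using c by algebra
    moreover have "z \<otimes> w \<in> pw (Suc (i + j))"
      using pw_mult[OF z(1) pw_Suc[OF w(1)]] by simp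
    moreover have "z \<otimes> y \<in> pw (Suc (i + j))" using pw_mult[OF z(1) assms(2)] by simp
    moreover have "x \<otimes> w \<in> pw (Suc (i + j))" using pw_mult[OF assms(1) w(1)] by simp
    ultimately have "a \<otimes> b \<ominus> x \<otimes> y \<in> pw (Suc (i + j))" using pw_add by simp
    then show ?thesis using c unfolding z(2) w(2) by (subst cls_eq_iff) auto
  qed
  have "rcoset_mult R (pw (Suc (i + j))) (cls i x) (cls j y)
    = (\<Union>a \<in> cls i x. \<Union>b \<in> cls j y. cls (i + j) (a \<otimes> b))"
    unfolding rcoset_mult_def cls_def ..
  also have "\<dots> = (\<Union>a \<in> cls i x. \<Union>b \<in> cls j y. cls (i + j) (x \<otimes> y))"
    by (intro SUP_cong refl) (rule *)
  also have "\<dots> = cls (i + j) (x \<otimes> y)"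
    using cls_self[OF pw_carrier[OF assms(1)]] cls_self[OF pw_carrier[OF assms(2)]] by blast
  finally show ?thesis .
qed

lemma finprod_cls:
  assumes "finite F" "\<And>i. i \<in> F \<Longrightarrow> z i \<in> pw n"
  shows "finprod (gr_comp R I n) (\<lambda>i. cls n (z i)) F = cls n (\<Oplus>i\<in>F. z i)"
  using assms
proof (induction F rule: finite_induct)
  case empty
  interpret C: comm_group "gr_comp R I n" by (rule comm_group_gr)
  show ?case by (simp add: gr_one)
next
  case (insert i F)
  interpret C: comm_group "gr_comp R I n" by (rule comm_group_gr)
  have zc: "z \<in> F \<rightarrow> carrier R" "z i \<in> carrier R" using insert pw_carrier by auto
  have "finprod (gr_comp R I n) (\<lambda>i. cls n (z i)) (insert i F)
      = cls n (z i) \<otimes>\<^bsub>gr_comp R I n\<^esub> finprod (gr_comp R I n) (\<lambda>i. cls n (z i)) F"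
    using insert by (intro C.finprod_insert) (auto simp: gr_carrier)
  also have "\<dots> = cls n (z i \<oplus> (\<Oplus>i\<in>F. z i))"
    using insert zc by (simp add: gr_mult)
  finally show ?case using insert(1,2) zc by simp
qed

text \<open>The graded ring is the image of the Rees algebra \<open>\<Oplus> I\<^sup>n t\<^sup>n\<close>, from which it inherits
  the ring axioms.\<close>

definition rees :: "(nat \<Rightarrow> 'a) set" where
  "rees = {p \<in> up R. \<forall>n. p n \<in> pw n}"

definition \<Gamma> :: "(nat \<Rightarrow> 'a) \<Rightarrow> nat \<Rightarrow> 'a set" where
  "\<Gamma> p = (\<lambda>n. cls n (p n))"

lemma rees_pw: "p \<in> rees \<Longrightarrow> p n \<in> pw n"
  and rees_carrier: "p \<in> rees \<Longrightarrow> p n \<in> carrier R"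
  and rees_up: "p \<in> rees \<Longrightarrow> p \<in> up R"
  unfolding rees_def by auto

lemma rees_conv:
  "p \<in> rees \<Longrightarrow> q \<in> rees \<Longrightarrow> (\<Oplus>i\<in>{..n}. p i \<otimes> q (n - i)) \<in> pw n"
proof (rule pw_finsum)
  fix i assume pq: "p \<in> rees" "q \<in> rees" and i: "i \<in> {..n}"
  then show "p i \<otimes> q (n - i) \<in> pw n"
    using pw_mult[OF rees_pw[OF pq(1), of i] rees_pw[OF pq(2), of "n - i"]] by simp
qed simp

lemma UP_simps:
  "carrier (UP R) = up R"
  "\<one>\<^bsub>UP R\<^esub> = (\<lambda>n. if n = 0 then \<one> else \<zero>)"
  "\<zero>\<^bsub>UP R\<^esub> = (\<lambda>n. \<zero>)"
  "p \<in> up R \<Longrightarrow> q \<in> up R \<Longrightarrow> p \<oplus>\<^bsub>UP R\<^esub> q = (\<lambda>n. p n \<oplus> q n)"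
  "p \<in> up R \<Longrightarrow> q \<in> up R \<Longrightarrow> p \<otimes>\<^bsub>UP R\<^esub> q = (\<lambda>n. \<Oplus>i\<in>{..n}. p i \<otimes> q (n - i))"
  by (simp_all add: UP_def)

lemma subring_rees: "subring rees (UP R)"
proof -
  interpret U: UP_cring R "UP R" by unfold_locales auto
  have rc: "rees \<subseteq> carrier (UP R)" by (auto simp: rees_def UP_simps(1))
  have neg: "(\<lambda>i. \<ominus> (p i)) \<in> up R" "\<ominus>\<^bsub>UP R\<^esub> p = (\<lambda>i. \<ominus> (p i))" if p: "p \<in> rees" for p
  proof -
    show n: "(\<lambda>i. \<ominus> (p i)) \<in> up R" by (rule up_a_inv_closed[OF rees_up[OF p]])
    show "\<ominus>\<^bsub>UP R\<^esub> p = (\<lambda>i. \<ominus> (p i))"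
    proof (rule U.P.minus_equality)
      show "(\<lambda>i. \<ominus> p i) \<oplus>\<^bsub>UP R\<^esub> p = \<zero>\<^bsub>UP R\<^esub>"
        unfolding UP_simps(4)[OF n rees_up[OF p]] UP_simps(3)
        by (rule ext, rule l_neg[OF rees_carrier[OF p]])
    qed (use rees_up[OF p] n in \<open>simp_all only: UP_simps(1)\<close>)
  qed
  show ?thesis
  proof (rule U.P.subringI[OF rc])
    show "\<one>\<^bsub>UP R\<^esub> \<in> rees"
      unfolding rees_def UP_simps(2) mem_Collect_eq using up_one_closed by simp
  next
    fix p assume p: "p \<in> rees"
    show "\<ominus>\<^bsub>UP R\<^esub> p \<in> rees"
      unfolding rees_def mem_Collect_eq neg(2)[OF p] using neg(1)[OF p] pw_neg[OF rees_pw[OF p]]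
      by simp
  next
    fix p q assume p: "p \<in> rees" and q: "q \<in> rees"
    note u = rees_up[OF p] rees_up[OF q]
    show "p \<oplus>\<^bsub>UP R\<^esub> q \<in> rees"
      unfolding rees_def mem_Collect_eq UP_simps(4)[OF u]
      using up_add_closed[OF u] pw_add[OF rees_pw[OF p] rees_pw[OF q]] by simp
    show "p \<otimes>\<^bsub>UP R\<^esub> q \<in> rees"
      unfolding rees_def mem_Collect_eq UP_simps(5)[OF u]
      using up_mult_closed[OF u] rees_conv[OF p q] by simp
  qed
qed

abbreviation G :: "(nat \<Rightarrow> 'a set) ring" where "G \<equiv> assoc_graded R I"

lemma G_carrier:
  "f \<in> carrier G \<longleftrightarrow> (\<forall>n. f n \<in> cls n ` pw n) \<and> finite {n. f n \<noteq> cls n \<zero>}"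
proof -
  have "carrier G = {x \<in> \<Pi>\<^sub>E i\<in>UNIV. carrier (gr_comp R I i). finite {i \<in> UNIV. x i \<noteq> \<one>\<^bsub>gr_comp R I i\<^esub>}}"
    unfolding assoc_graded_def using carrier_sum_group[of UNIV "gr_comp R I"] comm_group_gr
    by (simp add: comm_group_def)
  then show ?thesis by (simp add: PiE_UNIV_domain gr_carrier gr_one Pi_def)
qed

lemma G_zero: "\<zero>\<^bsub>G\<^esub> = (\<lambda>n. cls n \<zero>)"
  by (simp add: assoc_graded_def gr_one restrict_def)

lemma G_one: "\<one>\<^bsub>G\<^esub> = \<Gamma> (\<lambda>n. if n = 0 then \<one> else \<zero>)"
  by (rule ext) (simp add: assoc_graded_def gr_one \<Gamma>_def, simp add: cls_def)

lemma G_add: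
  assumes "p \<in> rees" "q \<in> rees"
  shows "\<Gamma> p \<oplus>\<^bsub>G\<^esub> \<Gamma> q = \<Gamma> (\<lambda>n. p n \<oplus> q n)"
  using gr_mult rees_carrier assms by (simp add: assoc_graded_def \<Gamma>_def restrict_def)

lemma G_mult:
  assumes "p \<in> rees" "q \<in> rees"
  shows "\<Gamma> p \<otimes>\<^bsub>G\<^esub> \<Gamma> q = \<Gamma> (\<lambda>n. \<Oplus>i\<in>{..n}. p i \<otimes> q (n - i))"
proof
  fix n
  interpret C: comm_group "gr_comp R I n" by (rule comm_group_gr)
  have z: "p i \<otimes> q (n - i) \<in> pw n" if "i \<in> {..n}" for i
    using pw_mult[OF rees_pw[OF assms(1), of i] rees_pw[OF assms(2), of "n - i"]] that by simp
  have eq: "rcoset_mult R (pw (Suc n)) (cls i (p i)) (cls (n - i) (q (n - i)))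
      = cls n (p i \<otimes> q (n - i))" if "i \<in> {..n}" for i
    using rcoset_mult_cls[OF rees_pw[OF assms(1), of i] rees_pw[OF assms(2), of "n - i"]] that
    by simp
  have "(\<Gamma> p \<otimes>\<^bsub>G\<^esub> \<Gamma> q) n = finprod (gr_comp R I n)
      (\<lambda>i. rcoset_mult R (pw (Suc n)) (cls i (p i)) (cls (n - i) (q (n - i)))) {..n}"
    by (simp add: assoc_graded_def \<Gamma>_def)
  also have "\<dots> = finprod (gr_comp R I n) (\<lambda>i. cls n (p i \<otimes> q (n - i))) {..n}"
    by (rule C.finprod_cong') (use eq z in \<open>auto simp: gr_carrier\<close>)
  also have "\<dots> = cls n (\<Oplus>i\<in>{..n}. p i \<otimes> q (n - i))"
    by (rule finprod_cls) (use z in auto)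
  finally show "(\<Gamma> p \<otimes>\<^bsub>G\<^esub> \<Gamma> q) n = \<Gamma> (\<lambda>n. \<Oplus>i\<in>{..n}. p i \<otimes> q (n - i)) n"
    by (simp add: \<Gamma>_def)
qed

lemma \<Gamma>_closed: "p \<in> rees \<Longrightarrow> \<Gamma> p \<in> carrier G"
proof -
  assume p: "p \<in> rees"
  then obtain n where "bound \<zero> n p" using bound_upD[OF rees_up] by blast
  then have "{k. \<Gamma> p k \<noteq> cls k \<zero>} \<subseteq> {..n}" unfolding \<Gamma>_def bound_def by (auto simp: not_le[symmetric])
  then show ?thesis unfolding G_carrier using finite_subset rees_pw[OF p] by (auto simp: \<Gamma>_def)
qed

lemma \<Gamma>_surj:
  assumes "f \<in> carrier G"
  obtains p where "p \<in> rees" "f = \<Gamma> p"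
proof -
  \<comment> \<open>A vanishing component is lifted to 0 and not to an arbitrary element of I^(n+1);
    this is what makes the lift finitely supported.\<close>
  have "\<exists>x. x \<in> pw n \<and> f n = cls n x \<and> (f n = cls n \<zero> \<longrightarrow> x = \<zero>)" for n
  proof (cases "f n = cls n \<zero>")
    case True
    then show ?thesis by (intro exI[of _ \<zero>]) simp
  next
    case False
    then show ?thesis using assms unfolding G_carrier by blast
  qed
  then obtain p where p: "\<And>n. p n \<in> pw n" "\<And>n. f n = cls n (p n)"
    "\<And>n. f n = cls n \<zero> \<Longrightarrow> p n = \<zero>" by metis
  obtain N where N: "\<And>n. f n \<noteq> cls n \<zero> \<Longrightarrow> n \<le> N"
    using assms unfolding G_carrier finite_nat_set_iff_bounded_le by blast
  have "bound \<zero> N p" using N p(3) by (metis bound.intro not_le)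
  then have "p \<in> rees" unfolding rees_def using p(1) pw_carrier by blast
  then show ?thesis using that p(2) by (auto simp: \<Gamma>_def)
qed

lemma cring_G: "cring G"
proof -
  interpret U: UP_cring R "UP R" by unfold_locales auto
  let ?P = "UP R\<lparr>carrier := rees\<rparr>"
  interpret P: ring ?P by (rule U.P.subring_is_ring[OF subring_rees])
  have hom: "\<Gamma> \<in> ring_hom ?P G"
  proof (rule ring_hom_memI)
    fix p q assume "p \<in> carrier ?P" "q \<in> carrier ?P"
    then have pq: "p \<in> rees" "q \<in> rees" by auto
    show "\<Gamma> p \<in> carrier G" using \<Gamma>_closed pq by blast
    show "\<Gamma> (p \<otimes>\<^bsub>?P\<^esub> q) = \<Gamma> p \<otimes>\<^bsub>G\<^esub> \<Gamma> q"
      by (simp add: G_mult[OF pq] UP_simps(5)[OF rees_up[OF pq(1)] rees_up[OF pq(2)]])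
    show "\<Gamma> (p \<oplus>\<^bsub>?P\<^esub> q) = \<Gamma> p \<oplus>\<^bsub>G\<^esub> \<Gamma> q"
      by (simp add: G_add[OF pq] UP_simps(4)[OF rees_up[OF pq(1)] rees_up[OF pq(2)]])
  next
    show "\<Gamma> \<one>\<^bsub>?P\<^esub> = \<one>\<^bsub>G\<^esub>" by (simp add: G_one UP_simps(2))
  qed
  have im: "\<Gamma> ` carrier ?P = carrier G"
  proof
    show "carrier G \<subseteq> \<Gamma> ` carrier ?P" by (rule subsetI, erule \<Gamma>_surj) simp
  qed (use \<Gamma>_closed in auto)
  have z: "\<Gamma> \<zero>\<^bsub>?P\<^esub> = \<zero>\<^bsub>G\<^esub>" by (simp add: G_zero UP_simps(3) \<Gamma>_def)
  \<comment> \<open>The image construction replaces carrier and zero; \<open>im\<close> and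
    \<open>z\<close> show that both are already those of \<open>G\<close>. Since it yields a ring
    only, commutativity is transferred separately.\<close>
  have "ring (G\<lparr>carrier := \<Gamma> ` carrier ?P, ring.zero := \<Gamma> \<zero>\<^bsub>?P\<^esub>\<rparr>)"
    by (rule P.ring_hom_imp_img_ring[OF hom])
  then interpret G: ring G unfolding im z by simp
  show ?thesis
  proof (rule cring.intro[OF G.ring_axioms], rule comm_monoid.intro[OF G.monoid_axioms],
      rule comm_monoid_axioms.intro)
    fix f g assume "f \<in> carrier G" "g \<in> carrier G"
    then obtain p q where pq: "p \<in> rees" "f = \<Gamma> p" "q \<in> rees" "g = \<Gamma> q" by (metis \<Gamma>_surj)
    have "\<Gamma> (p \<otimes>\<^bsub>UP R\<^esub> q) = \<Gamma> (q \<otimes>\<^bsub>UP R\<^esub> p)"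
      using U.P.m_comm[of p q] rees_up[OF pq(1)] rees_up[OF pq(3)] by (simp only: UP_simps(1))
    then show "f \<otimes>\<^bsub>G\<^esub> g = g \<otimes>\<^bsub>G\<^esub> f"
      unfolding pq(2,4) G_mult[OF pq(1,3)] G_mult[OF pq(3,1)]
        UP_simps(5)[OF rees_up[OF pq(1)] rees_up[OF pq(3)]]
        UP_simps(5)[OF rees_up[OF pq(3)] rees_up[OF pq(1)]] .
  qed
qed

section \<open>Homogeneous elements and components of the associated graded ring\<close>

definition single :: "nat \<Rightarrow> 'a \<Rightarrow> nat \<Rightarrow> 'a" where
  "single n x = (\<lambda>k. if k = n then x else \<zero>)"

lemma single_rees: "x \<in> pw n \<Longrightarrow> single n x \<in> rees"
proof -
  assume x: "x \<in> pw n"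
  have "bound \<zero> n (single n x)" by (auto simp: single_def)
  then have "single n x \<in> up R" using pw_carrier[OF x] by (intro mem_upI) (auto simp: single_def)
  then show ?thesis using x by (simp add: rees_def single_def)
qed

lemma degree_iff_single: "f \<in> gr_degree R I n \<longleftrightarrow> (\<exists>x \<in> pw n. f = \<Gamma> (single n x))"
proof
  assume f: "f \<in> gr_degree R I n"
  then have "f n \<in> cls n ` pw n" by (simp add: gr_degree_def G_carrier)
  then obtain x where "x \<in> pw n" "f n = cls n x" by blast
  then show "\<exists>x \<in> pw n. f = \<Gamma> (single n x)"
    using f by (intro bexI[of _ x] ext) (auto simp: gr_degree_def gr_one \<Gamma>_def single_def)
next
  assume "\<exists>x \<in> pw n. f = \<Gamma> (single n x)"
  then obtain x where "x \<in> pw n" "f = \<Gamma> (single n x)" by blast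
  then show "f \<in> gr_degree R I n"
    using \<Gamma>_closed[OF single_rees] by (simp add: gr_degree_def gr_one \<Gamma>_def single_def)
qed

lemma single_mult:
  assumes "x \<in> pw i" "y \<in> pw j"
  shows "\<Gamma> (single i x) \<otimes>\<^bsub>G\<^esub> \<Gamma> (single j y) = \<Gamma> (single (i + j) (x \<otimes> y))"
proof -
  note c = pw_carrier[OF assms(1)] pw_carrier[OF assms(2)]
  have "(\<Oplus>k\<in>{..n}. single i x k \<otimes> single j y (n - k)) = single (i + j) (x \<otimes> y) n" for n
  proof -
    have "(\<Oplus>k\<in>{..n}. single i x k \<otimes> single j y (n - k))
        = (\<Oplus>k\<in>{..n}. if i = k then x \<otimes> single j y (n - i) else \<zero>)"
      using c by (intro finsum_cong') (auto simp: single_def)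
    also have "\<dots> = single (i + j) (x \<otimes> y) n"
    proof (cases "i \<le> n")
      case True
      have "(\<Oplus>k\<in>{..n}. if i = k then x \<otimes> single j y (n - i) else \<zero>) = x \<otimes> single j y (n - i)"
        using c True by (intro add.finprod_singleton) (auto simp: single_def)
      then show ?thesis using True c by (auto simp: single_def)
    next
      case False
      then have "(\<Oplus>k\<in>{..n}. if i = k then x \<otimes> single j y (n - i) else \<zero>) = (\<Oplus>k\<in>{..n}. \<zero>)"
        by (intro finsum_cong') auto
      then show ?thesis using False by (simp add: single_def)
    qed
    finally show ?thesis .
  qed
  then show ?thesis by (simp add: G_mult[OF single_rees[OF assms(1)] single_rees[OF assms(2)]])
qed

definition hcomp :: "nat \<Rightarrow> (nat \<Rightarrow> 'a set) \<Rightarrow> nat \<Rightarrow> 'a set" where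
  "hcomp n f = (\<lambda>k. if k = n then f k else cls k \<zero>)"

lemma hcomp_\<Gamma>: "hcomp n (\<Gamma> p) = \<Gamma> (single n (p n))"
  by (rule ext) (simp add: hcomp_def \<Gamma>_def single_def)

lemma G_add_apply:
  assumes "f \<in> carrier G" "g \<in> carrier G"
  shows "(f \<oplus>\<^bsub>G\<^esub> g) n = f n \<otimes>\<^bsub>gr_comp R I n\<^esub> g n"
  by (simp add: assoc_graded_def)

lemma comp_sum:
  assumes "f \<in> carrier G"
  shows "(\<Oplus>\<^bsub>G\<^esub>n\<in>{..N}. hcomp n f) = (\<lambda>k. if k \<le> N then f k else cls k \<zero>)"
proof -
  interpret G: cring G by (rule cring_G)
  obtain p where p: "p \<in> rees" "f = \<Gamma> p" using \<Gamma>_surj[OF assms] by blast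
  have cl: "hcomp n f \<in> carrier G" for n
    unfolding p(2) hcomp_\<Gamma> by (rule \<Gamma>_closed[OF single_rees[OF rees_pw[OF p(1)]]])
  have one: "a \<in> carrier R \<Longrightarrow> cls k \<zero> \<otimes>\<^bsub>gr_comp R I k\<^esub> cls k a = cls k a"
    "a \<in> carrier R \<Longrightarrow> cls k a \<otimes>\<^bsub>gr_comp R I k\<^esub> cls k \<zero> = cls k a" for k a
    by (simp_all add: gr_mult)
  show ?thesis
  proof (induction N)
    case 0
    have "(\<Oplus>\<^bsub>G\<^esub>n\<in>{..0}. hcomp n f) = hcomp 0 f" using cl by simp
    then show ?case by (auto simp: hcomp_def)
  next
    case (Suc N)
    have "(\<Oplus>\<^bsub>G\<^esub>n\<in>{..Suc N}. hcomp n f) = hcomp (Suc N) f \<oplus>\<^bsub>G\<^esub> (\<Oplus>\<^bsub>G\<^esub>n\<in>{..N}. hcomp n f)"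
      using cl by (intro G.finsum_Suc) auto
    moreover have "(\<Oplus>\<^bsub>G\<^esub>n\<in>{..N}. hcomp n f) \<in> carrier G" using cl by (intro G.finsum_closed) auto
    ultimately have "(\<Oplus>\<^bsub>G\<^esub>n\<in>{..Suc N}. hcomp n f) k = (if k \<le> Suc N then f k else cls k \<zero>)" for k
      using G_add_apply[OF cl, of _ "Suc N" k] Suc one rees_carrier[OF p(1)]
      by (auto simp: hcomp_def p(2) \<Gamma>_def le_Suc_eq)
    then show ?case by blast
  qed
qed

end

section \<open>Graded rings and Proj\<close>

text \<open>An ideal P maximal among those disjoint from \<open>T\<close> is prime: for
  \<open>a\<close> and \<open>b\<close> outside P, both P + (a) and P + (b) meet \<open>T\<close>,
  and a product of two such elements lies in P + (a b).\<close>

lemma (in cring) exists_prime_avoiding: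
  assumes I: "ideal I R" and T: "T \<subseteq> carrier R" "\<one> \<in> T" "\<And>s t. s \<in> T \<Longrightarrow> t \<in> T \<Longrightarrow> s \<otimes> t \<in> T"
    and disj: "I \<inter> T = {}"
  obtains P where "primeideal P R" "I \<subseteq> P" "P \<inter> T = {}"
proof -
  obtain P where P: "ideal P R" "I \<subseteq> P" "P \<inter> T = {}"
    and max: "\<forall>J. ideal J R \<longrightarrow> P \<subseteq> J \<longrightarrow> J \<inter> T = {} \<longrightarrow> J = P"
    by (rule exists_maximal_ideal_avoiding[OF I disj])
  interpret P: ideal P R by (rule P(1))
  have Pc: "P \<subseteq> carrier R" using P.Icarr by blast
  have meet: "\<exists>c \<in> carrier R. \<exists>v \<in> P. c \<otimes> a \<oplus> v \<in> T" if a: "a \<in> carrier R" "a \<notin> P" for a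
  proof -
    have ins: "insert a P \<subseteq> carrier R" using a(1) Pc by blast
    have self: "insert a P \<subseteq> Idl (insert a P)" by (rule genideal_self[OF ins])
    have "\<not> Idl (insert a P) \<inter> T = {}"
    proof
      assume "Idl (insert a P) \<inter> T = {}"
      then have "Idl (insert a P) = P" using max self genideal_ideal[OF ins] by simp
      then show False using self a(2) by blast
    qed
    then obtain t where t: "t \<in> Idl (insert a P)" "t \<in> T" by blast
    obtain c v where cv: "c \<in> carrier R" "v \<in> Idl P" "t = c \<otimes> a \<oplus> v"
      by (rule Idl_insertE[OF Pc a(1) t(1)])
    have "v \<in> P" using cv(2) genideal_minimal[OF P(1)] by blast
    then show ?thesis using cv(1,3) t(2) by blast
  qed
  have "primeideal P R"
  proof (rule primeidealI[OF P(1) is_cring])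
    show "carrier R \<noteq> P" using T(2) P(3) by blast
    fix a b assume ab: "a \<in> carrier R" "b \<in> carrier R" "a \<otimes> b \<in> P"
    show "a \<in> P \<or> b \<in> P"
    proof (rule ccontr)
      assume "\<not> ?thesis"
      then obtain c v d w where c: "c \<in> carrier R" "v \<in> P" "c \<otimes> a \<oplus> v \<in> T"
        and d: "d \<in> carrier R" "w \<in> P" "d \<otimes> b \<oplus> w \<in> T"
        using meet[OF ab(1)] meet[OF ab(2)] by blast
      note vw = P.Icarr[OF c(2)] P.Icarr[OF d(2)]
      have "(c \<otimes> a \<oplus> v) \<otimes> (d \<otimes> b \<oplus> w)
          = (c \<otimes> d) \<otimes> (a \<otimes> b) \<oplus> ((d \<otimes> b \<oplus> w) \<otimes> v \<oplus> (c \<otimes> a) \<otimes> w)"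
        using ab(1,2) c(1) d(1) vw by algebra
      also have "\<dots> \<in> P"
        by (intro P.a_closed P.I_l_closed[OF ab(3)] P.I_l_closed[OF c(2)] P.I_l_closed[OF d(2)])
          (use ab(1,2) c(1) d(1) vw in auto)
      finally show False using T(3)[OF c(3) d(3)] P(3) by blast
    qed
  qed
  then show ?thesis using that P(2,3) by blast
qed

lemma (in ideal) I_finsum:
  "finite F \<Longrightarrow> (\<And>i. i \<in> F \<Longrightarrow> f i \<in> I) \<Longrightarrow> (\<Oplus>i\<in>F. f i) \<in> I"
proof (induction F rule: finite_induct)
  case (insert i F)
  then have "f \<in> F \<rightarrow> carrier R" "f i \<in> carrier R" using Icarr by auto
  then have "(\<Oplus>i\<in>insert i F. f i) = f i \<oplus> (\<Oplus>i\<in>F. f i)" using insert by simp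
  then show ?case using insert a_closed by simp
qed simp

text \<open>\<open>cmp n\<close> is the projection to the component of degree \<open>n\<close>.\<close>

locale graded_cring = cring S for S :: "('a, 'c) ring_scheme" (structure) +
  fixes Sd :: "nat \<Rightarrow> 'a set" and cmp :: "nat \<Rightarrow> 'a \<Rightarrow> 'a"
  assumes Sd_subset: "Sd n \<subseteq> carrier S"
    and cmp_mem: "x \<in> carrier S \<Longrightarrow> cmp n x \<in> Sd n"
    and cmp_add: "x \<in> carrier S \<Longrightarrow> y \<in> carrier S \<Longrightarrow> cmp n (x \<oplus> y) = cmp n x \<oplus> cmp n y"
    and cmp_homog: "x \<in> Sd m \<Longrightarrow> cmp n x = (if n = m then x else \<zero>)"
    and cmp_decomp: "x \<in> carrier S \<Longrightarrow> \<exists>N. x = (\<Oplus>n\<in>{..N}. cmp n x)"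
    and Sd_one: "\<one> \<in> Sd 0"
    and Sd_mult: "x \<in> Sd i \<Longrightarrow> y \<in> Sd j \<Longrightarrow> x \<otimes> y \<in> Sd (i + j)"
begin

lemma Sd_carrier: "x \<in> Sd n \<Longrightarrow> x \<in> carrier S"
  using Sd_subset by (rule subsetD)

lemma cmp_closed [simp]: "x \<in> carrier S \<Longrightarrow> cmp n x \<in> carrier S"
  by (rule Sd_carrier[OF cmp_mem])

lemma cmp_zero [simp]: "cmp n \<zero> = \<zero>"
  using cmp_add[of \<zero> \<zero> n] add.l_cancel[of "cmp n \<zero>" "cmp n \<zero>" \<zero>] by simp

lemma Sd_zero: "\<zero> \<in> Sd n"
  using cmp_mem[of \<zero> n] by simp

lemma Sd_add: "x \<in> Sd n \<Longrightarrow> y \<in> Sd n \<Longrightarrow> x \<oplus> y \<in> Sd n"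
  using cmp_mem[of "x \<oplus> y" n] cmp_add[of x y n] by (simp add: Sd_carrier cmp_homog)

lemma Sd_pow: "x \<in> Sd n \<Longrightarrow> x [^] (k::nat) \<in> Sd (n * k)"
proof (induction k)
  case 0
  then show ?case using Sd_one by simp
next
  case (Suc k)
  then show ?case using Sd_mult[OF Suc.IH[OF Suc.prems] Suc.prems] by (simp add: add.commute)
qed

lemma cmp_finsum:
  "finite F \<Longrightarrow> (\<And>i. i \<in> F \<Longrightarrow> f i \<in> carrier S) \<Longrightarrow> cmp n (\<Oplus>i\<in>F. f i) = (\<Oplus>i\<in>F. cmp n (f i))"
proof (induction F rule: finite_induct)
  case (insert i F)
  then have f: "f \<in> F \<rightarrow> carrier S" "f i \<in> carrier S" by auto
  then show ?case using insert by (simp add: cmp_add Pi_iff)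
qed simp

lemma cmp_bounded:
  assumes "x \<in> carrier S"
  obtains N where "x = (\<Oplus>n\<in>{..N}. cmp n x)" "\<And>n. n > N \<Longrightarrow> cmp n x = \<zero>"
proof -
  obtain N where N: "x = (\<Oplus>n\<in>{..N}. cmp n x)" using cmp_decomp[OF assms] by blast
  have "cmp n x = \<zero>" if "n > N" for n
  proof -
    have "cmp n x = (\<Oplus>i\<in>{..N}. cmp n (cmp i x))"
      by (subst N) (rule cmp_finsum, use assms in auto)
    also have "\<dots> = (\<Oplus>i\<in>{..N}. \<zero>)"
      by (rule finsum_cong') (use that in \<open>auto simp: cmp_homog[OF cmp_mem[OF assms]]\<close>)
    finally show ?thesis by simp
  qed
  then show ?thesis using that N by blast
qed

lemma cmp_neg: "x \<in> carrier S \<Longrightarrow> cmp n (\<ominus> x) = \<ominus> cmp n x"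
proof -
  assume x: "x \<in> carrier S"
  have "cmp n (\<ominus> x) \<oplus> cmp n x = \<zero>" using cmp_add[of "\<ominus> x" x n] x by (simp add: l_neg)
  then show ?thesis using minus_equality x by simp
qed

lemma cmp_eqI:
  assumes "x \<in> carrier S" "y \<in> carrier S" "\<And>n. cmp n x = cmp n y"
  shows "x = y"
proof -
  have z: "cmp n (x \<ominus> y) = \<zero>" for n
    using assms by (simp add: minus_eq cmp_add cmp_neg r_neg)
  obtain N where "x \<ominus> y = (\<Oplus>n\<in>{..N}. cmp n (x \<ominus> y))"
    using cmp_decomp[of "x \<ominus> y"] assms by auto
  then have "x \<ominus> y = \<zero>" by (simp add: z)
  then show ?thesis using assms by (simp add: r_right_minus_eq)
qed

lemma cmp_homog_mult:
  assumes a: "a \<in> Sd d" and y: "y \<in> carrier S"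
  shows "cmp n (a \<otimes> y) = (if d \<le> n then a \<otimes> cmp (n - d) y else \<zero>)"
proof -
  have ac: "a \<in> carrier S" by (rule Sd_carrier[OF a])
  obtain N where N: "y = (\<Oplus>i\<in>{..N}. cmp i y)" "\<And>n. n > N \<Longrightarrow> cmp n y = \<zero>"
    using cmp_bounded[OF y] by metis
  have "a \<otimes> y = (\<Oplus>i\<in>{..N}. a \<otimes> cmp i y)"
    by (subst N(1)) (rule finsum_rdistr, use ac y in auto)
  then have "cmp n (a \<otimes> y) = (\<Oplus>i\<in>{..N}. cmp n (a \<otimes> cmp i y))"
    using cmp_finsum[of "{..N}" "\<lambda>i. a \<otimes> cmp i y" n] ac y by simp
  also have "\<dots> = (\<Oplus>i\<in>{..N}. if n = d + i then a \<otimes> cmp i y else \<zero>)"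
    by (rule finsum_cong') (use ac y in \<open>auto simp: cmp_homog[OF Sd_mult[OF a cmp_mem[OF y]]]\<close>)
  also have "\<dots> = (if d \<le> n then a \<otimes> cmp (n - d) y else \<zero>)"
  proof (cases "d \<le> n \<and> n - d \<le> N")
    case True
    have "(\<Oplus>i\<in>{..N}. if n = d + i then a \<otimes> cmp i y else \<zero>)
        = (\<Oplus>i\<in>{..N}. if n - d = i then a \<otimes> cmp i y else \<zero>)"
      by (rule finsum_cong') (use True ac y in auto)
    also have "\<dots> = a \<otimes> cmp (n - d) y"
      using add.finprod_singleton[of "n - d" "{..N}" "\<lambda>i. a \<otimes> cmp i y"] True ac y by simp
    finally show ?thesis using True by simp
  next
    case False
    then have "(\<Oplus>i\<in>{..N}. if n = d + i then a \<otimes> cmp i y else \<zero>) = (\<Oplus>i\<in>{..N}. \<zero>)"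
      by (intro finsum_cong') auto
    moreover have "d \<le> n \<Longrightarrow> cmp (n - d) y = \<zero>" using False N(2) by simp
    ultimately show ?thesis using ac by simp
  qed
  finally show ?thesis .
qed

lemma cmp_prod:
  assumes "x \<in> carrier S" "y \<in> carrier S" "x = (\<Oplus>i\<in>{..N}. cmp i x)"
  shows "cmp n (x \<otimes> y) = (\<Oplus>i\<in>{..N}. cmp n (cmp i x \<otimes> y))"
proof -
  have "x \<otimes> y = (\<Oplus>i\<in>{..N}. cmp i x \<otimes> y)"
    by (subst assms(3)) (rule finsum_ldistr, use assms in auto)
  then show ?thesis using cmp_finsum[of "{..N}" "\<lambda>i. cmp i x \<otimes> y" n] assms by simp
qed

text \<open>This is the largest homogeneous ideal inside \<open>p\<close>. It shows that a
  homogeneous ideal contains the components of its elements, and it later turns a prime into a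
  homogeneous prime.\<close>

lemma ideal_homogeneous_core:
  assumes "ideal p S"
  shows "ideal {x \<in> carrier S. \<forall>n. cmp n x \<in> p} S"
proof (rule idealI[OF ring_axioms])
  interpret p: ideal p S by fact
  let ?Z = "{x \<in> carrier S. \<forall>n. cmp n x \<in> p}"
  show "subgroup ?Z (add_monoid S)"
    by (rule add.subgroupI) (auto simp: cmp_add cmp_neg intro!: exI[of _ \<zero>])
  fix x r assume x: "x \<in> ?Z" and r: "r \<in> carrier S"
  obtain N where N: "r = (\<Oplus>i\<in>{..N}. cmp i r)" using cmp_decomp[OF r] by blast
  have xc: "x \<in> carrier S" using x by blast
  have "cmp n (r \<otimes> x) \<in> p" for n
    unfolding cmp_prod[OF r xc N]
    by (rule p.I_finsum)
      (use x r in \<open>auto simp: cmp_homog_mult[OF cmp_mem[OF r]] intro!: p.I_l_closed\<close>)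
  then show 1: "r \<otimes> x \<in> ?Z" using r xc by simp
  show "x \<otimes> r \<in> ?Z" using 1 m_comm[OF xc r] by simp
qed

lemma cmp_mem_homogeneous_ideal:
  assumes "homogeneous_ideal S Sd p" "x \<in> p"
  shows "cmp n x \<in> p"
proof -
  interpret p: ideal p S using assms(1) by (simp add: homogeneous_ideal_def)
  let ?Z = "{x \<in> carrier S. \<forall>n. cmp n x \<in> p}"
  note Z = ideal_homogeneous_core[OF p.is_ideal]
  have "p \<inter> (\<Union>n. Sd n) \<subseteq> ?Z"
    using Sd_carrier by (auto simp: cmp_homog)
  then have "Idl (p \<inter> (\<Union>n. Sd n)) \<subseteq> ?Z" by (rule genideal_minimal[OF Z])
  moreover have "p = Idl (p \<inter> (\<Union>n. Sd n))"
    using assms(1) unfolding homogeneous_ideal_def by (rule conjunct2)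
  ultimately have "p \<subseteq> ?Z" by (metis (no_types, lifting) equalityD1 subset_trans)
  then show ?thesis using assms(2) by blast
qed

lemma homogeneous_idealI:
  assumes "ideal p S" "\<And>x n. x \<in> p \<Longrightarrow> cmp n x \<in> p"
  shows "homogeneous_ideal S Sd p"
proof -
  interpret p: ideal p S by fact
  let ?G = "p \<inter> (\<Union>n. Sd n)"
  have G: "?G \<subseteq> carrier S" using p.Icarr by blast
  interpret g: ideal "Idl ?G" S by (rule genideal_ideal[OF G])
  have "x \<in> Idl ?G" if x: "x \<in> p" for x
  proof -
    have xc: "x \<in> carrier S" by (rule p.Icarr[OF x])
    obtain N where N: "x = (\<Oplus>n\<in>{..N}. cmp n x)" using cmp_decomp[OF xc] by blast
    have "cmp n x \<in> Idl ?G" for n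
      using genideal_self[OF G] assms(2)[OF x] cmp_mem[OF xc] by blast
    then show ?thesis by (subst N) (rule g.I_finsum, auto)
  qed
  moreover have "Idl ?G \<subseteq> p" by (rule genideal_minimal[OF assms(1)]) blast
  ultimately have "p = Idl ?G" by (intro subset_antisym subsetI) auto
  then show ?thesis unfolding homogeneous_ideal_def using assms(1) by (intro conjI)
qed

lemma irrelevant_subset_iff:
  assumes "ideal p S"
  shows "irrelevant_ideal S Sd \<subseteq> p \<longleftrightarrow> (\<forall>d \<ge> 1. Sd d \<subseteq> p)"
proof -
  have sub: "(\<Union>n \<in> {1..}. Sd n) \<subseteq> carrier S" using Sd_subset by blast
  have "Idl (\<Union>n \<in> {1..}. Sd n) \<subseteq> p \<longleftrightarrow> (\<Union>n \<in> {1..}. Sd n) \<subseteq> p"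
    using genideal_self[OF sub] genideal_minimal[OF assms, of "\<Union>n \<in> {1..}. Sd n"] subset_trans
    by (intro iffI)
  then show ?thesis unfolding irrelevant_ideal_def by auto
qed

text \<open>The working form of the definition, free of generated ideals. The form of positive
  degree outside \<open>p\<close> is the source of all denominators of high degree.\<close>

lemma proj_points_iff:
  "p \<in> proj_points S Sd \<longleftrightarrow>
    primeideal p S \<and> (\<forall>x \<in> p. \<forall>n. cmp n x \<in> p) \<and> (\<exists>d \<ge> 1. \<exists>t \<in> Sd d. t \<notin> p)"
proof (cases "primeideal p S")
  case True
  then have p: "ideal p S" by (rule primeideal.axioms(1))
  then show ?thesis
    unfolding proj_points_def mem_Collect_eq irrelevant_subset_iff[OF p]
    using True cmp_mem_homogeneous_ideal homogeneous_idealI[OF p] by blast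
qed (simp add: proj_points_def)

section \<open>Topology, points and stalks of Proj\<close>

lemma topspace_proj: "topspace (proj_topology S Sd) = proj_points S Sd"
proof
  show "topspace (proj_topology S Sd) \<subseteq> proj_points S Sd"
    unfolding topspace_def openin_proj_topology by blast
  have "proj_points S Sd = proj_points S Sd - proj_closed S Sd {\<one>}"
  proof -
    have "\<one> \<notin> p" if "p \<in> proj_points S Sd" for p
    proof -
      interpret primeideal p S using that by (simp add: proj_points_def)
      show ?thesis using I_notcarr one_imp_carrier by blast
    qed
    then show ?thesis unfolding proj_closed_def by blast
  qed
  then have "openin (proj_topology S Sd) (proj_points S Sd)"
    unfolding openin_proj_topology by (metis empty_subsetI insert_subset one_closed)
  then show "proj_points S Sd \<subseteq> topspace (proj_topology S Sd)" by (rule openin_subset)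
qed

lemma openin_proj_iff:
  "openin (proj_topology S Sd) U \<longleftrightarrow> (\<exists>E \<subseteq> carrier S. U = {p \<in> proj_points S Sd. \<not> E \<subseteq> p})"
  unfolding openin_proj_topology proj_closed_def by (auto simp: set_diff_eq)

lemma openin_basic:
  "g \<in> carrier S \<Longrightarrow> openin (proj_topology S Sd) {p \<in> proj_points S Sd. g \<notin> p}"
  unfolding openin_proj_iff by (rule exI[of _ "{g}"]) auto

lemma
  assumes "p \<in> proj_points S Sd"
  shows mult_set_homog_compl: "mult_set S (homog_compl Sd p)"
    and mult_notin_point: "x \<in> carrier S \<Longrightarrow> y \<in> carrier S \<Longrightarrow> x \<notin> p \<Longrightarrow> y \<notin> p \<Longrightarrow> x \<otimes> y \<notin> p"
    and one_notin_point: "\<one> \<notin> p"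
proof -
  interpret p: primeideal p S using assms by (simp add: proj_points_def)
  show m: "x \<otimes> y \<notin> p" if "x \<in> carrier S" "y \<in> carrier S" "x \<notin> p" "y \<notin> p" for x y
    using p.I_prime that by blast
  show o: "\<one> \<notin> p" using p.I_notcarr p.one_imp_carrier by blast
  show "mult_set S (homog_compl Sd p)"
  proof
    show "homog_compl Sd p \<subseteq> carrier S" unfolding homog_compl_def using Sd_subset by blast
    show "\<one> \<in> homog_compl Sd p" unfolding homog_compl_def using Sd_one o by blast
    fix s t assume "s \<in> homog_compl Sd p" "t \<in> homog_compl Sd p"
    then obtain i j where "s \<in> Sd i" "s \<notin> p" "t \<in> Sd j" "t \<notin> p" unfolding homog_compl_def by blast
    then show "s \<otimes> t \<in> homog_compl Sd p"
      unfolding homog_compl_def using Sd_mult[of s i t j] m Sd_carrier by blast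
  qed
qed

lemma pow_notin_point:
  assumes "p \<in> proj_points S Sd" "g \<in> carrier S" "g \<notin> p"
  shows "g [^] (k::nat) \<notin> p"
  by (induction k) (use assms one_notin_point mult_notin_point in auto)

text \<open>A prime P over the annihilator of \<open>f\<close> that avoids the powers of
  \<open>g\<close> need not be homogeneous. Its homogeneous core is again prime and has the same
  homogeneous elements; it misses \<open>g\<close>, a form of positive degree, and is therefore a
  point of Proj.\<close>

lemma exists_homogeneous_prime_avoiding:
  assumes f: "f \<in> Sd n" and g: "g \<in> Sd d" "d \<ge> 1" and ne: "\<And>k::nat. g [^] k \<otimes> f \<noteq> \<zero>"
  obtains p where "p \<in> proj_points S Sd" "g \<notin> p" "\<And>h i. h \<in> Sd i \<Longrightarrow> h \<otimes> f = \<zero> \<Longrightarrow> h \<in> p"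
proof -
  have fc: "f \<in> carrier S" and gc: "g \<in> carrier S" using f g Sd_carrier by auto
  obtain P where P: "primeideal P S" "{u \<in> carrier S. u \<otimes> f \<in> {\<zero>}} \<subseteq> P"
    "P \<inter> range (\<lambda>k::nat. g [^] k) = {}"
  proof (rule exists_prime_avoiding[OF ideal_colon[OF zeroideal fc], of "range (\<lambda>k::nat. g [^] k)"])
    show "range (\<lambda>k::nat. g [^] k) \<subseteq> carrier S" using gc by auto
    have "\<one> = g [^] (0::nat)" by simp
    then show "\<one> \<in> range (\<lambda>k::nat. g [^] k)" by (rule range_eqI)
    show "s \<otimes> t \<in> range (\<lambda>k::nat. g [^] k)"
      if "s \<in> range (\<lambda>k::nat. g [^] k)" "t \<in> range (\<lambda>k::nat. g [^] k)" for s t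
      using that gc by (auto simp: nat_pow_mult)
    show "{u \<in> carrier S. u \<otimes> f \<in> {\<zero>}} \<inter> range (\<lambda>k::nat. g [^] k) = {}"
      using ne by auto
  qed blast
  interpret P: primeideal P S by (rule P(1))
  define p where "p = {x \<in> carrier S. \<forall>n. cmp n x \<in> P}"
  have p_homog: "x \<in> p \<longleftrightarrow> x \<in> P" if "x \<in> Sd i" for x i
    using that Sd_carrier[OF that] P.zero_closed by (auto simp: p_def cmp_homog)
  have p_ideal: "ideal p S" unfolding p_def by (rule ideal_homogeneous_core[OF P.is_ideal])
  have "primeideal p S"
  proof (rule primeidealI[OF p_ideal is_cring])
    have "\<one> \<notin> p" using p_homog[OF Sd_one] P.I_notcarr P.one_imp_carrier by blast
    then show "carrier S \<noteq> p" by blast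
    fix x y assume x: "x \<in> carrier S" and y: "y \<in> carrier S" and xy: "x \<otimes> y \<in> p"
    show "x \<in> p \<or> y \<in> p"
    proof (rule ccontr)
      assume "\<not> ?thesis"
      then have ex: "\<exists>n. cmp n x \<notin> P" and ey: "\<exists>n. cmp n y \<notin> P" using x y unfolding p_def by auto
      \<comment> \<open>The lowest components of \<open>x\<close> and \<open>y\<close> outside P. In
        degree i + j the product x y equals x_i y_j up to terms of P, because every other term
        contains a component of \<open>x\<close> below degree \<open>i\<close> or one of
        \<open>y\<close> below degree \<open>j\<close>.\<close>
      define i where "i = (LEAST n. cmp n x \<notin> P)"
      define j where "j = (LEAST n. cmp n y \<notin> P)"
      have i: "cmp i x \<notin> P" "\<And>k. k < i \<Longrightarrow> cmp k x \<in> P"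
        using LeastI_ex[OF ex] not_less_Least[of _ "\<lambda>n. cmp n x \<notin> P"] unfolding i_def by blast+
      have j: "cmp j y \<notin> P" "\<And>k. k < j \<Longrightarrow> cmp k y \<in> P"
        using LeastI_ex[OF ey] not_less_Least[of _ "\<lambda>n. cmp n y \<notin> P"] unfolding j_def by blast+
      obtain N where N: "x = (\<Oplus>i\<in>{..N}. cmp i x)" "\<And>n. n > N \<Longrightarrow> cmp n x = \<zero>"
        using cmp_bounded[OF x] by metis
      have iN: "i \<in> {..N}" using i(1) N(2)[of i] P.zero_closed by (metis atMost_iff not_le)
      let ?t = "\<lambda>k. cmp (i + j) (cmp k x \<otimes> y)"
      have tc: "?t k \<in> carrier S" for k using x y by simp
      have other: "?t k \<in> P" if "k \<noteq> i" for k
      proof (cases "k < i")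
        case True
        then show ?thesis
          using i(2)[OF True] x y
          by (auto simp: cmp_homog_mult[OF cmp_mem[OF x]] intro!: P.I_r_closed)
      next
        case False
        then have "i + j - k < j" if "k \<le> i + j" using \<open>k \<noteq> i\<close> that by simp
        then show ?thesis
          using j(2) x y by (auto simp: cmp_homog_mult[OF cmp_mem[OF x]] intro!: P.I_l_closed)
      qed
      have "{..N} = insert i ({..N} - {i})" using iN by blast
      then have "(\<Oplus>k\<in>{..N}. ?t k) = ?t i \<oplus> (\<Oplus>k\<in>{..N} - {i}. ?t k)"
        using finsum_insert[of "{..N} - {i}" i ?t] tc by simp
      moreover have sP: "(\<Oplus>k\<in>{..N} - {i}. ?t k) \<in> P"
        by (rule P.I_finsum) (use other in auto)
      moreover have "(\<Oplus>k\<in>{..N}. ?t k) \<in> P"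
      proof -
        have "cmp (i + j) (x \<otimes> y) \<in> P" using xy unfolding p_def by simp
        then show ?thesis unfolding cmp_prod[OF x y N(1)] .
      qed
      ultimately have "(?t i \<oplus> (\<Oplus>k\<in>{..N} - {i}. ?t k)) \<oplus> \<ominus> (\<Oplus>k\<in>{..N} - {i}. ?t k) \<in> P"
        using P.a_closed P.a_inv_closed by simp
      then have "?t i \<in> P" using tc P.Icarr[OF sP] by (simp add: a_assoc r_neg)
      moreover have "?t i = cmp i x \<otimes> cmp j y" using y by (simp add: cmp_homog_mult[OF cmp_mem[OF x]])
      ultimately show False using P.I_prime[of "cmp i x" "cmp j y"] x y i(1) j(1) by simp
    qed
  qed
  moreover have "g \<notin> P" using P(3) nat_pow_eone[OF gc] by (metis IntI empty_iff rangeI)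
  then have gp: "g \<notin> p" using p_homog[OF g(1)] by blast
  moreover have "cmp n x \<in> p" if "x \<in> p" for x n
    using that p_homog[OF cmp_mem] by (simp add: p_def)
  ultimately have "p \<in> proj_points S Sd" unfolding proj_points_iff using g by blast
  moreover have "h \<in> p" if "h \<in> Sd i" "h \<otimes> f = \<zero>" for h i
    using P(2) that p_homog[OF that(1)] Sd_carrier by blast
  ultimately show ?thesis using that gp by blast
qed

lemma homog_localization_ops:
  "\<one>\<^bsub>homog_localization S Sd p\<^esub> = \<one>\<^bsub>localization S (homog_compl Sd p)\<^esub>"
  "\<zero>\<^bsub>homog_localization S Sd p\<^esub> = \<zero>\<^bsub>localization S (homog_compl Sd p)\<^esub>"
  "x \<otimes>\<^bsub>homog_localization S Sd p\<^esub> y = x \<otimes>\<^bsub>localization S (homog_compl Sd p)\<^esub> y"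
  "x \<oplus>\<^bsub>homog_localization S Sd p\<^esub> y = x \<oplus>\<^bsub>localization S (homog_compl Sd p)\<^esub> y"
  by (simp_all add: homog_localization_def)

text \<open>On \<open>D(g)\<close> the section \<open>f/g\<^sup>n\<close> is nilpotent, hence zero.\<close>

lemma nilpotent_killed_by_power:
  assumes red: "reduced_space (Proj S Sd)" and g: "g \<in> Sd 1" and f: "f \<in> Sd n"
    and nil: "f [^] (j::nat) = \<zero>"
  shows "\<exists>k::nat. g [^] k \<otimes> f = \<zero>"
proof (rule ccontr)
  assume "\<not> ?thesis"
  then have ne: "\<And>k::nat. g [^] k \<otimes> f \<noteq> \<zero>" by blast
  have gc: "g \<in> carrier S" and fc: "f \<in> carrier S" using Sd_carrier f g by auto
  \<comment> \<open>A point of D(g) that contains every homogeneous annihilator of \<open>f\<close>: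
    in its stalk f/g^n cannot vanish, which will contradict reducedness.\<close>
  obtain p where p: "p \<in> proj_points S Sd" "g \<notin> p" "\<And>h i. h \<in> Sd i \<Longrightarrow> h \<otimes> f = \<zero> \<Longrightarrow> h \<in> p"
    by (rule exists_homogeneous_prime_avoiding[OF f g order_refl ne]) blast
  let ?U = "{q \<in> proj_points S Sd. g \<notin> q}"
  let ?F = "\<lambda>a b. \<lambda>q\<in>?U. fraction S (homog_compl Sd q) a b"
  have U: "openin (proj_topology S Sd) ?U" by (rule openin_basic[OF gc])
  have gn: "g [^] k \<in> Sd k" for k :: nat using Sd_pow[OF g, of k] by simp
  have gk: "g [^] k \<in> homog_compl Sd q" if "q \<in> ?U" for k :: nat and q
    using gn pow_notin_point[of q g k] gc that unfolding homog_compl_def by blast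
  \<comment> \<open>Because \<open>g\<close> has degree one, g^n has the degree of \<open>f\<close>,
    and the quotient is a fraction of degree zero.\<close>
  define s where "s = ?F f (g [^] n)"
  have s: "s \<in> carrier (proj_sections S Sd ?U)"
  proof -
    have "s q \<in> carrier (homog_localization S Sd q)" if "q \<in> ?U" for q
      using that f gn[of n] pow_notin_point[of q g n] gc
      by (auto simp: s_def homog_localization_def)
    moreover have "\<exists>V m. \<exists>a\<in>Sd m. \<exists>b\<in>Sd m. openin (proj_topology S Sd) V \<and> q \<in> V \<and> V \<subseteq> ?U \<and>
        (\<forall>q'\<in>V. b \<notin> q' \<and> s q' = fraction S (homog_compl Sd q') a b)" if "q \<in> ?U" for q
      using U that f gn[of n] pow_notin_point[of _ g n] gc
      by (intro exI[of _ ?U] exI[of _ n] bexI[of _ f] bexI[of _ "g [^] n"]) (auto simp: s_def)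
    ultimately show ?thesis unfolding proj_sections_def by (auto simp: s_def)
  qed
  have "s [^]\<^bsub>proj_sections S Sd ?U\<^esub> k = ?F (f [^] k) ((g [^] n) [^] k)" for k :: nat
  proof (induction k)
    case 0
    show ?case
      by (simp add: proj_sections_def homog_localization_ops localization_def cong: restrict_cong)
  next
    case (Suc k)
    have "fraction S (homog_compl Sd q) (f [^] k) ((g [^] n) [^] k)
        \<otimes>\<^bsub>localization S (homog_compl Sd q)\<^esub> fraction S (homog_compl Sd q) f (g [^] n)
        = fraction S (homog_compl Sd q) (f [^] Suc k) ((g [^] n) [^] Suc k)" if q: "q \<in> ?U" for q
    proof -
      interpret L: mult_set S "homog_compl Sd q" using q by (intro mult_set_homog_compl) blast
      have "(g [^] n) [^] k = g [^] (n * k)" using gc by (rule nat_pow_pow)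
      then have "(g [^] n) [^] k \<in> homog_compl Sd q" using gk[OF q] by simp
      then show ?thesis using L.fraction_mult[of "f [^] k" "(g [^] n) [^] k" f "g [^] n"] gk[OF q] fc
        by simp
    qed
    then show ?case
      using Suc by (simp add: proj_sections_def homog_localization_ops s_def cong: restrict_cong)
  qed
  then have "s [^]\<^bsub>proj_sections S Sd ?U\<^esub> j = ?F \<zero> ((g [^] n) [^] j)" by (simp add: nil)
  also have "\<dots> = \<zero>\<^bsub>proj_sections S Sd ?U\<^esub>"
  proof -
    have "fraction S (homog_compl Sd q) \<zero> ((g [^] n) [^] j)
        = \<zero>\<^bsub>localization S (homog_compl Sd q)\<^esub>" if q: "q \<in> ?U" for q
    proof -
      interpret L: mult_set S "homog_compl Sd q" using q by (intro mult_set_homog_compl) blast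
      have "(g [^] n) [^] j = g [^] (n * j)" using gc by (rule nat_pow_pow)
      then have "(g [^] n) [^] j \<in> homog_compl Sd q" using gk[OF q] by simp
      then show ?thesis unfolding L.localization_zero using L.T_one by (intro L.fraction_eq) auto
    qed
    then show ?thesis by (simp add: proj_sections_def homog_localization_ops cong: restrict_cong)
  qed
  finally have sj: "s [^]\<^bsub>proj_sections S Sd ?U\<^esub> j = \<zero>\<^bsub>proj_sections S Sd ?U\<^esub>" .
  have "reduced_ring (proj_sections S Sd ?U)"
    using red U unfolding reduced_space_def Proj_def by simp
  then have "s = \<zero>\<^bsub>proj_sections S Sd ?U\<^esub>"
    using s sj unfolding reduced_ring_def by blast
  then have sp: "s p = \<zero>\<^bsub>localization S (homog_compl Sd p)\<^esub>"
    using p by (simp add: proj_sections_def homog_localization_ops)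
  interpret L: mult_set S "homog_compl Sd p" by (rule mult_set_homog_compl[OF p(1)])
  have "fraction S (homog_compl Sd p) f (g [^] n) = fraction S (homog_compl Sd p) \<zero> \<one>"
    using sp p by (simp add: s_def L.localization_zero)
  then obtain u where "u \<in> homog_compl Sd p" "u \<otimes> f = \<zero>"
    using L.fraction_eq_zero_iff[OF fc gk] p by blast
  then show False using p(3) unfolding homog_compl_def by blast
qed

end

section \<open>Graded homomorphisms that are bijective in high degrees\<close>

lemma homog_complI: "x \<in> Sd n \<Longrightarrow> x \<notin> p \<Longrightarrow> x \<in> homog_compl Sd p"
  unfolding homog_compl_def by blast

lemma section_localE:
  assumes "s \<in> carrier (proj_sections S Sd U)" "p \<in> U"
  obtains V n a f where "a \<in> Sd n" "f \<in> Sd n" "openin (proj_topology S Sd) V" "p \<in> V" "V \<subseteq> U"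
    "\<forall>q \<in> V. f \<notin> q \<and> s q = fraction S (homog_compl Sd q) a f"
proof -
  have "\<forall>p \<in> U. \<exists>V n. \<exists>a \<in> Sd n. \<exists>f \<in> Sd n.
      openin (proj_topology S Sd) V \<and> p \<in> V \<and> V \<subseteq> U \<and>
      (\<forall>q \<in> V. f \<notin> q \<and> s q = fraction S (homog_compl Sd q) a f)"
    using assms(1) unfolding proj_sections_def by simp
  then have "\<exists>V n. \<exists>a \<in> Sd n. \<exists>f \<in> Sd n.
      openin (proj_topology S Sd) V \<and> p \<in> V \<and> V \<subseteq> U \<and>
      (\<forall>q \<in> V. f \<notin> q \<and> s q = fraction S (homog_compl Sd q) a f)"
    using assms(2) by (rule bspec)
  then obtain V n a f where *: "a \<in> Sd n" "f \<in> Sd n" "openin (proj_topology S Sd) V \<and> p \<in> V \<and> V \<subseteq> U \<and>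
      (\<forall>q \<in> V. f \<notin> q \<and> s q = fraction S (homog_compl Sd q) a f)"
    by (elim bexE exE)
  show ?thesis by (rule that[of a n f V]) (use * in simp_all)
qed

locale graded_iso_above = A: graded_cring S Sd cs + B: graded_cring T Td ct
  for S :: "('a, 'c) ring_scheme" (structure) and Sd cs and T :: "('b, 'd) ring_scheme" and Td ct +
  fixes \<phi> :: "'a \<Rightarrow> 'b" and N :: nat
  assumes hom: "\<phi> \<in> ring_hom S T"
    and hom_cmp: "x \<in> carrier S \<Longrightarrow> \<phi> (cs n x) = ct n (\<phi> x)"
    and bij: "n \<ge> N \<Longrightarrow> bij_betw \<phi> (Sd n) (Td n)"
begin

sublocale h: ring_hom_cring S T \<phi>
  by (intro ring_hom_cring.intro ring_hom_cring_axioms.intro hom A.is_cring B.is_cring)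

text \<open>The ideal of elements without components below \<open>N\<close>. On it \<phi> is
  injective for inhomogeneous elements too, and its image consists of all elements of
  \<open>T\<close> without components below \<open>N\<close>.\<close>

definition hi :: "'a set" where
  "hi = {x \<in> carrier S. \<forall>n<N. cs n x = \<zero>}"

lemma hi_carrier: "x \<in> hi \<Longrightarrow> x \<in> carrier S"
  by (simp add: hi_def)

lemma hom_Sd: "x \<in> Sd n \<Longrightarrow> \<phi> x \<in> Td n"
  using hom_cmp[of x n] B.cmp_mem[of "\<phi> x" n] by (simp add: A.Sd_carrier A.cmp_homog)

lemma inj_hi:
  assumes "x \<in> hi" "y \<in> hi" "\<phi> x = \<phi> y"
  shows "x = y"
proof (rule A.cmp_eqI)
  show xy: "x \<in> carrier S" "y \<in> carrier S" using assms hi_carrier by auto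
  fix n
  have eq: "\<phi> (cs n x) = \<phi> (cs n y)" using hom_cmp xy assms(3) by simp
  show "cs n x = cs n y"
  proof (cases "n < N")
    case True
    then show ?thesis using assms(1,2) by (simp add: hi_def)
  next
    case False
    then have "inj_on \<phi> (Sd n)" using bij[of n] by (simp add: bij_betw_def)
    then show ?thesis using eq A.cmp_mem xy by (auto dest: inj_onD)
  qed
qed

lemma Sd_hi: "x \<in> Sd n \<Longrightarrow> n \<ge> N \<Longrightarrow> x \<in> hi"
  by (simp add: hi_def A.Sd_carrier A.cmp_homog)

lemma hi_add: "x \<in> hi \<Longrightarrow> y \<in> hi \<Longrightarrow> x \<oplus> y \<in> hi"
  by (simp add: hi_def A.cmp_add)

lemma hi_mult: "x \<in> hi \<Longrightarrow> y \<in> carrier S \<Longrightarrow> x \<otimes> y \<in> hi"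
proof -
  assume x: "x \<in> hi" and y: "y \<in> carrier S"
  have xc: "x \<in> carrier S" by (rule hi_carrier[OF x])
  obtain M where M: "x = (\<Oplus>i\<in>{..M}. cs i x)" using A.cmp_decomp[OF xc] by blast
  have "cs n (x \<otimes> y) = \<zero>" if n: "n < N" for n
  proof -
    have "cs n (cs i x \<otimes> y) = \<zero>" for i
    proof (cases "i < N")
      case True
      then show ?thesis using x y by (simp add: hi_def)
    next
      case False
      then show ?thesis using n by (simp add: A.cmp_homog_mult[OF A.cmp_mem[OF xc] y])
    qed
    then show ?thesis unfolding A.cmp_prod[OF xc y M] by simp
  qed
  then show ?thesis using xc y by (simp add: hi_def)
qed

lemma lift_high:
  assumes t: "t \<in> carrier T" "\<And>n. n < N \<Longrightarrow> ct n t = \<zero>\<^bsub>T\<^esub>"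
  obtains x where "x \<in> hi" "\<phi> x = t"
proof -
  have "\<exists>x. x \<in> Sd n \<and> x \<in> hi \<and> \<phi> x = ct n t" for n
  proof (cases "n < N")
    case True
    then show ?thesis
      using t(2) A.Sd_zero by (intro exI[of _ "\<zero>"]) (simp add: hi_def)
  next
    case False
    then have "ct n t \<in> \<phi> ` Sd n"
      using bij[of n] B.cmp_mem[OF t(1), of n] by (simp add: bij_betw_def)
    then show ?thesis using Sd_hi False by force
  qed
  then obtain x where x: "\<And>n. x n \<in> Sd n" "\<And>n. x n \<in> hi" "\<And>n. \<phi> (x n) = ct n t" by metis
  have xc: "x \<in> F \<rightarrow> carrier S" for F using x(1) A.Sd_carrier by auto
  obtain M where M: "t = (\<Oplus>\<^bsub>T\<^esub>n\<in>{..M}. ct n t)" using B.cmp_decomp[OF t(1)] by blast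
  have "(\<Oplus>n\<in>{..K}. x n) \<in> hi" for K
  proof (induction K)
    case 0
    then show ?case using x(2)[of 0] xc[of "{..0}"] hi_carrier by simp
  next
    case (Suc K)
    then show ?case using x(2)[of "Suc K"] xc[of "{..Suc K}"] hi_add by (simp add: A.finsum_Suc)
  qed
  moreover have "\<phi> (\<Oplus>n\<in>{..M}. x n) = t"
    using h.hom_finsum[OF xc] x(3) M by (simp add: o_def)
  ultimately show ?thesis using that by blast
qed

text \<open>Multiplication by a form of degree at least \<open>N\<close> leaves no component below
  \<open>N\<close>, so it brings every element of \<open>T\<close>, with or without a preimage, into
  the image of \<open>hi\<close>.\<close>

lemma lift_mult:
  assumes h: "h \<in> Sd e" "e \<ge> N" and t: "t \<in> carrier T"
  obtains x where "x \<in> hi" "\<phi> x = \<phi> h \<otimes>\<^bsub>T\<^esub> t"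
proof (rule lift_high)
  show "\<phi> h \<otimes>\<^bsub>T\<^esub> t \<in> carrier T" using h t A.Sd_carrier by simp
  show "ct n (\<phi> h \<otimes>\<^bsub>T\<^esub> t) = \<zero>\<^bsub>T\<^esub>" if "n < N" for n
    using that h(2) by (simp add: B.cmp_homog_mult[OF hom_Sd[OF h(1)] t])
qed

lemma lift_mult_homog:
  assumes h: "h \<in> Sd e" "e \<ge> N" and t: "t \<in> Td d"
  obtains x where "x \<in> Sd (e + d)" "\<phi> x = \<phi> h \<otimes>\<^bsub>T\<^esub> t"
proof -
  have "\<phi> h \<otimes>\<^bsub>T\<^esub> t \<in> \<phi> ` Sd (e + d)"
    using bij[of "e + d"] h(2) B.Sd_mult[OF hom_Sd[OF h(1)] t] by (simp add: bij_betw_def)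
  then show ?thesis using that by (metis imageE)
qed

section \<open>The homeomorphism of the spaces of points\<close>

abbreviation PS :: "'a set set" where "PS \<equiv> proj_points S Sd"
abbreviation PT :: "'b set set" where "PT \<equiv> proj_points T Td"

lemma good_S:
  assumes "p \<in> PS"
  obtains e h where "e \<ge> N" "e \<ge> 1" "h \<in> Sd e" "h \<notin> p"
proof -
  obtain d t where t: "d \<ge> 1" "t \<in> Sd d" "t \<notin> p"
    using assms unfolding A.proj_points_iff by blast
  \<comment> \<open>The exponent N + 1 instead of N keeps the degree positive when N = 0.\<close>
  have "N + 1 \<le> d * (N + 1)" using mult_le_mono1[OF t(1), of "N + 1"] by simp
  then show ?thesis
    using that[of "d * (N + 1)" "t [^] (N + 1)"] A.Sd_pow[OF t(2), of "N + 1"]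
      A.pow_notin_point[OF assms A.Sd_carrier[OF t(2)] t(3), of "N + 1"] by linarith
qed

lemma good_T:
  assumes "q \<in> PT"
  obtains e h where "e \<ge> N" "e \<ge> 1" "h \<in> Sd e" "\<phi> h \<notin> q"
proof -
  obtain d t where t: "d \<ge> 1" "t \<in> Td d" "t \<notin> q"
    using assms unfolding B.proj_points_iff by blast
  have le: "N + 1 \<le> d * (N + 1)" using mult_le_mono1[OF t(1), of "N + 1"] by simp
  then have "t [^]\<^bsub>T\<^esub> (N + 1) \<in> \<phi> ` Sd (d * (N + 1))"
    using bij[of "d * (N + 1)"] B.Sd_pow[OF t(2), of "N + 1"] unfolding bij_betw_def by simp
  then obtain h where "h \<in> Sd (d * (N + 1))" "\<phi> h = t [^]\<^bsub>T\<^esub> (N + 1)" by (metis imageE)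
  then show ?thesis
    using that[of "d * (N + 1)" h] le
      B.pow_notin_point[OF assms B.Sd_carrier[OF t(2)] t(3), of "N + 1"] by simp
qed

definition \<psi> :: "'b set \<Rightarrow> 'a set" where
  "\<psi> q = {x \<in> carrier S. \<phi> x \<in> q}"

lemma \<psi>_point:
  assumes "q \<in> PT"
  shows "\<psi> q \<in> PS"
  unfolding A.proj_points_iff
proof (intro conjI ballI allI)
  have q: "primeideal q T" using assms unfolding B.proj_points_iff by blast
  show "primeideal (\<psi> q) S"
    unfolding \<psi>_def 
    by (rule ring_hom_ring.primeideal_vimage[OF ring_hom_ringI2[OF A.ring_axioms B.ring_axioms hom] A.is_cring q])
  show "cs n x \<in> \<psi> q" if "x \<in> \<psi> q" for x n
    using that assms unfolding B.proj_points_iff by (simp add: \<psi>_def hom_cmp)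
  show "\<exists>d\<ge>1. \<exists>t\<in>Sd d. t \<notin> \<psi> q"
    by (rule good_T[OF assms]) (auto simp: \<psi>_def)
qed

text \<open>A form \<open>t\<close> in \<open>q\<close> need not come from \<open>S\<close>, but
  \<phi> h t does for \<open>h\<close> of high degree with \<phi> h outside \<open>q'\<close>, and
  primality of \<open>q'\<close> removes the factor again. Since \<open>q\<close> is homogeneous,
  treating forms is enough.\<close>

lemma \<psi>_subset:
  assumes q: "q \<in> PT" and q': "q' \<in> PT" and eq: "\<psi> q = \<psi> q'"
  shows "q \<subseteq> q'"
proof
  interpret q: primeideal q T using q by (simp add: proj_points_def)
  interpret q': primeideal q' T using q' by (simp add: proj_points_def)
  obtain e h where h: "e \<ge> N" "h \<in> Sd e" "\<phi> h \<notin> q'" by (rule good_T[OF q'])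
  have hc: "\<phi> h \<in> carrier T" using h(2) A.Sd_carrier by simp
  have homog: "t \<in> q'" if t: "t \<in> q" "t \<in> Td d" for t d
  proof -
    obtain x where x: "x \<in> Sd (e + d)" "\<phi> x = \<phi> h \<otimes>\<^bsub>T\<^esub> t"
      by (rule lift_mult_homog[OF h(2,1) t(2)])
    have "x \<in> \<psi> q" using x t(1) hc q.I_l_closed by (simp add: \<psi>_def A.Sd_carrier)
    then have "x \<in> \<psi> q'" unfolding eq .
    then have "\<phi> h \<otimes>\<^bsub>T\<^esub> t \<in> q'" using x(2) by (simp add: \<psi>_def)
    then show ?thesis using q'.I_prime[OF hc B.Sd_carrier[OF t(2)]] h(3) by blast
  qed
  fix t assume t: "t \<in> q"
  have tc: "t \<in> carrier T" by (rule q.Icarr[OF t])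
  obtain M where M: "t = (\<Oplus>\<^bsub>T\<^esub>n\<in>{..M}. ct n t)" using B.cmp_decomp[OF tc] by blast
  have "ct n t \<in> q" for n using q t unfolding B.proj_points_iff by blast
  then have "ct n t \<in> q'" for n using homog[OF _ B.cmp_mem[OF tc]] by blast
  then show "t \<in> q'" by (subst M) (rule q'.I_finsum, auto)
qed

lemma \<psi>_inj: "q \<in> PT \<Longrightarrow> q' \<in> PT \<Longrightarrow> \<psi> q = \<psi> q' \<Longrightarrow> q = q'"
  by (rule subset_antisym) (simp_all add: \<psi>_subset)

text \<open>For \<open>h\<close> of large degree outside \<open>p\<close>, multiplication by \<open>\<phi> h\<close> maps \<open>T\<close> into the image of
  \<open>hi\<close>, where \<open>\<phi>\<close> is injective; the preimage of \<open>p\<close> under the resulting map \<open>\<sigma>\<close> is the point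
  over \<open>p\<close>.\<close>

lemma \<psi>_surj:
  assumes "p \<in> PS"
  obtains q where "q \<in> PT" "\<psi> q = p"
proof -
  interpret p: primeideal p S using assms by (simp add: proj_points_def)
  obtain e h where h: "e \<ge> N" "e \<ge> 1" "h \<in> Sd e" "h \<notin> p" by (rule good_S[OF assms])
  have hc: "h \<in> carrier S" by (rule A.Sd_carrier[OF h(3)])
  have "\<exists>x. x \<in> hi \<and> \<phi> x = \<phi> h \<otimes>\<^bsub>T\<^esub> t" if "t \<in> carrier T" for t
    by (rule lift_mult[OF h(3,1) that]) blast
  then obtain \<sigma> where \<sigma>: "\<And>t. t \<in> carrier T \<Longrightarrow> \<sigma> t \<in> hi"
    "\<And>t. t \<in> carrier T \<Longrightarrow> \<phi> (\<sigma> t) = \<phi> h \<otimes>\<^bsub>T\<^esub> t" by metis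
  have \<sigma>_eq: "\<sigma> t = x" if "x \<in> hi" "t \<in> carrier T" "\<phi> x = \<phi> h \<otimes>\<^bsub>T\<^esub> t" for t x
    using that \<sigma> by (intro inj_hi) auto
  have \<sigma>c: "\<sigma> t \<in> carrier S" if "t \<in> carrier T" for t by (rule hi_carrier[OF \<sigma>(1)[OF that]])
  have \<sigma>_add: "\<sigma> (t \<oplus>\<^bsub>T\<^esub> r) = \<sigma> t \<oplus> \<sigma> r" if "t \<in> carrier T" "r \<in> carrier T" for t r
    using that \<sigma> \<sigma>c hc by (intro \<sigma>_eq hi_add) (auto simp: B.r_distr)
  \<comment> \<open>Each value of \<sigma> carries one factor \<open>h\<close>, so a product of two
    values carries one too many. The extra factor is harmless: \<open>h\<close> lies outside the
    prime \<open>p\<close>.\<close>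
  have \<sigma>_mult: "h \<otimes> \<sigma> (t \<otimes>\<^bsub>T\<^esub> r) = \<sigma> t \<otimes> \<sigma> r" if "t \<in> carrier T" "r \<in> carrier T" for t r
  proof (rule inj_hi)
    show "h \<otimes> \<sigma> (t \<otimes>\<^bsub>T\<^esub> r) \<in> hi" using that \<sigma>c Sd_hi[OF h(3,1)] by (intro hi_mult) auto
    show "\<sigma> t \<otimes> \<sigma> r \<in> hi" using that \<sigma> \<sigma>c by (intro hi_mult) auto
    show "\<phi> (h \<otimes> \<sigma> (t \<otimes>\<^bsub>T\<^esub> r)) = \<phi> (\<sigma> t \<otimes> \<sigma> r)"
      using that \<sigma>c hc by (simp add: \<sigma>(2) B.m_ac)
  qed
  have \<sigma>_hom: "\<sigma> (\<phi> x) = h \<otimes> x" if "x \<in> carrier S" for x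
    using that hc Sd_hi[OF h(3,1)] by (intro \<sigma>_eq hi_mult) auto
  define q where "q = {t \<in> carrier T. \<sigma> t \<in> p}"
  have mult: "t \<otimes>\<^bsub>T\<^esub> r \<in> q" if "t \<in> q" "r \<in> carrier T" for t r
  proof -
    have "h \<otimes> \<sigma> (t \<otimes>\<^bsub>T\<^esub> r) \<in> p"
      using that \<sigma>_mult \<sigma>c p.I_r_closed by (simp add: q_def)
    then show ?thesis
      using p.I_prime[OF hc, of "\<sigma> (t \<otimes>\<^bsub>T\<^esub> r)"] that \<sigma>c h(4) by (auto simp: q_def)
  qed
  have zero: "\<sigma> \<zero>\<^bsub>T\<^esub> = \<zero>" using \<sigma>_hom[of "\<zero>"] hc by simp
  have "ideal q T"
  proof (rule idealI[OF B.ring_axioms])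
    show "subgroup q (add_monoid T)"
    proof (rule B.add.subgroupI)
      show "q \<noteq> {}" using zero p.zero_closed by (auto simp: q_def)
      show "\<ominus>\<^bsub>T\<^esub> t \<in> q" if "t \<in> q" for t
        using mult[OF that, of "\<ominus>\<^bsub>T\<^esub> \<one>\<^bsub>T\<^esub>"] that by (simp add: q_def B.r_minus)
      show "t \<oplus>\<^bsub>T\<^esub> r \<in> q" if "t \<in> q" "r \<in> q" for t r
        using that p.a_closed by (simp add: q_def \<sigma>_add)
    qed (auto simp: q_def)
    fix t r assume t: "t \<in> q" and r: "r \<in> carrier T"
    show 1: "t \<otimes>\<^bsub>T\<^esub> r \<in> q" by (rule mult[OF t r])
    show "r \<otimes>\<^bsub>T\<^esub> t \<in> q" using 1 B.m_comm[of t r] t r by (simp add: q_def)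
  qed
  then have prime: "primeideal q T"
  proof (rule primeidealI[OF _ B.is_cring])
    have "\<sigma> \<one>\<^bsub>T\<^esub> = h" using \<sigma>_hom[of "\<one>"] hc by simp
    then have "\<one>\<^bsub>T\<^esub> \<notin> q" using h(4) by (simp add: q_def)
    then show "carrier T \<noteq> q" by blast
    fix t r assume tr: "t \<in> carrier T" "r \<in> carrier T" "t \<otimes>\<^bsub>T\<^esub> r \<in> q"
    then have "\<sigma> t \<otimes> \<sigma> r \<in> p" using \<sigma>_mult[of t r] hc p.I_l_closed by (simp add: q_def flip: \<sigma>_mult)
    then show "t \<in> q \<or> r \<in> q"
      using p.I_prime[OF \<sigma>c \<sigma>c] tr by (simp add: q_def)
  qed
  moreover have "ct n t \<in> q" if "t \<in> q" for t n
  proof -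
    have tc: "t \<in> carrier T" using that by (simp add: q_def)
    \<comment> \<open>\<sigma> raises degrees by the degree \<open>e\<close> of \<open>h\<close>;
      this is how homogeneity of \<open>p\<close> passes to \<open>q\<close>.\<close>
    have "\<sigma> (ct n t) = cs (e + n) (\<sigma> t)"
    proof (rule \<sigma>_eq)
      show "cs (e + n) (\<sigma> t) \<in> hi"
        using Sd_hi[OF A.cmp_mem[OF \<sigma>c[OF tc]], of "e + n"] h(1) by simp
      show "\<phi> (cs (e + n) (\<sigma> t)) = \<phi> h \<otimes>\<^bsub>T\<^esub> ct n t"
        using tc \<sigma>c by (simp add: hom_cmp \<sigma>(2) B.cmp_homog_mult[OF hom_Sd[OF h(3)]])
    qed (use tc in simp)
    moreover have "cs (e + n) (\<sigma> t) \<in> p"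
      using that assms unfolding A.proj_points_iff by (simp add: q_def)
    ultimately show ?thesis using tc by (simp add: q_def)
  qed
  moreover have "\<phi> h \<notin> q"
    using \<sigma>_hom[OF hc] p.I_prime[OF hc hc] h(4) by (auto simp: q_def)
  ultimately have "q \<in> PT" unfolding B.proj_points_iff using hom_Sd[OF h(3)] h(2) by blast
  moreover have "\<psi> q = p"
  proof -
    have "h \<otimes> x \<in> p \<longleftrightarrow> x \<in> p" if "x \<in> carrier S" for x
      using p.I_prime[OF hc that] p.I_l_closed[of x h] hc h(4) by blast
    then show ?thesis using p.Icarr by (auto simp: \<psi>_def q_def \<sigma>_hom)
  qed
  ultimately show ?thesis using that by blast
qed

definition \<chi> :: "'a set \<Rightarrow> 'b set" where
  "\<chi> p = (THE q. q \<in> PT \<and> \<psi> q = p)"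

lemma \<chi>_\<psi>: "q \<in> PT \<Longrightarrow> \<chi> (\<psi> q) = q"
  unfolding \<chi>_def using \<psi>_inj by (intro the_equality) auto

lemma \<chi>_point: "p \<in> PS \<Longrightarrow> \<chi> p \<in> PT" and \<psi>_\<chi>: "p \<in> PS \<Longrightarrow> \<psi> (\<chi> p) = p"
  by (rule \<psi>_surj, assumption, use \<chi>_\<psi> in force)+

lemma open_\<psi>:
  assumes "openin (proj_topology S Sd) U"
  shows "openin (proj_topology T Td) {q \<in> PT. \<psi> q \<in> U}"
proof -
  obtain E where E: "E \<subseteq> carrier S" "U = {p \<in> PS. \<not> E \<subseteq> p}"
    using assms unfolding A.openin_proj_iff by blast
  have "{q \<in> PT. \<psi> q \<in> U} = {q \<in> PT. \<not> \<phi> ` E \<subseteq> q}"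
    unfolding E(2) using \<psi>_point E(1) by (auto simp: \<psi>_def)
  moreover have "\<phi> ` E \<subseteq> carrier T" using E(1) by auto
  ultimately show ?thesis unfolding B.openin_proj_iff by blast
qed

text \<open>The elements of \<open>F\<close> need not come from \<open>S\<close>, so they are
  replaced by the preimages of their multiples by forms \<phi> h with \<open>h\<close> of degree at
  least \<open>N\<close>. All such \<open>h\<close> are taken at once: at each point some \<phi> h
  does not vanish, and there vanishing of the multiples forces vanishing of
  \<open>F\<close>.\<close>

lemma open_\<chi>:
  assumes "openin (proj_topology T Td) W"
  shows "openin (proj_topology S Sd) {p \<in> PS. \<chi> p \<in> W}"
proof -
  obtain F where F: "F \<subseteq> carrier T" "W = {q \<in> PT. \<not> F \<subseteq> q}"
    using assms unfolding B.openin_proj_iff by blast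
  let ?E = "{x \<in> carrier S. \<exists>t \<in> F. \<exists>e \<ge> N. \<exists>h \<in> Sd e. \<phi> x = \<phi> h \<otimes>\<^bsub>T\<^esub> t}"
  have iff: "F \<subseteq> q \<longleftrightarrow> ?E \<subseteq> \<psi> q" if q: "q \<in> PT" for q
  proof
    interpret q: primeideal q T using q by (simp add: proj_points_def)
    assume "F \<subseteq> q"
    then show "?E \<subseteq> \<psi> q" using q.I_l_closed A.Sd_carrier by (auto simp: \<psi>_def)
  next
    interpret q: primeideal q T using q by (simp add: proj_points_def)
    assume E: "?E \<subseteq> \<psi> q"
    obtain e h where h: "e \<ge> N" "h \<in> Sd e" "\<phi> h \<notin> q" by (rule good_T[OF q])
    show "F \<subseteq> q"
    proof
      fix t assume t: "t \<in> F"
      then have tc: "t \<in> carrier T" using F(1) by blast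
      obtain x where x: "x \<in> hi" "\<phi> x = \<phi> h \<otimes>\<^bsub>T\<^esub> t" by (rule lift_mult[OF h(2,1) tc])
      then have "x \<in> ?E" using hi_carrier t h by blast
      then have "x \<in> \<psi> q" by (rule subsetD[OF E])
      then have "\<phi> h \<otimes>\<^bsub>T\<^esub> t \<in> q" using x(2) by (simp add: \<psi>_def)
      then show "t \<in> q" using q.I_prime[of "\<phi> h" t] h A.Sd_carrier tc by auto
    qed
  qed
  have "\<chi> p \<in> W \<longleftrightarrow> \<not> ?E \<subseteq> p" if "p \<in> PS" for p
    unfolding F(2) using iff[OF \<chi>_point[OF that]] \<chi>_point[OF that] unfolding \<psi>_\<chi>[OF that] by simp
  then have "{p \<in> PS. \<chi> p \<in> W} = {p \<in> PS. \<not> ?E \<subseteq> p}" by (intro Collect_cong conj_cong refl)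
  moreover have "?E \<subseteq> carrier S" by blast
  ultimately show ?thesis unfolding A.openin_proj_iff by blast
qed

lemma homeomorphic_\<chi>: "homeomorphic_map (proj_topology S Sd) (proj_topology T Td) \<chi>"
proof -
  have "homeomorphic_maps (proj_topology S Sd) (proj_topology T Td) \<chi> \<psi>"
    unfolding homeomorphic_maps_def continuous_map_def A.topspace_proj B.topspace_proj
    using \<chi>_point \<psi>_point \<chi>_\<psi> \<psi>_\<chi> open_\<chi> open_\<psi> by auto
  then show ?thesis unfolding homeomorphic_maps_map by blast
qed

section \<open>The isomorphisms of stalks\<close>

abbreviation CS :: "'b set \<Rightarrow> 'a set" where "CS q \<equiv> homog_compl Sd (\<psi> q)"
abbreviation CT :: "'b set \<Rightarrow> 'b set" where "CT q \<equiv> homog_compl Td q"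
abbreviation LS :: "'b set \<Rightarrow> ('a \<times> 'a) set ring" where "LS q \<equiv> homog_localization S Sd (\<psi> q)"
abbreviation LT :: "'b set \<Rightarrow> ('b \<times> 'b) set ring" where "LT q \<equiv> homog_localization T Td q"

text \<open>The graph of the map a/f \<mapsto> \<phi> a/\<phi> f from the stalk at \<psi> q to the
  stalk at \<open>q\<close>. As a relation it requires no choice of representatives and can be read
  in both directions.\<close>

definition \<rho> :: "'b set \<Rightarrow> ('a \<times> 'a) set \<Rightarrow> ('b \<times> 'b) set \<Rightarrow> bool" where
  "\<rho> q x y \<longleftrightarrow> (\<exists>n a f. a \<in> Sd n \<and> f \<in> Sd n \<and> f \<notin> \<psi> q \<and>
     x = fraction S (CS q) a f \<and>
     y = fraction T (CT q) (\<phi> a) (\<phi> f))"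

lemma hom_homog_compl: "f \<in> CS q \<Longrightarrow> \<phi> f \<in> CT q"
  using hom_Sd A.Sd_carrier by (auto simp: homog_compl_def \<psi>_def)

text \<open>From \<open>T\<close> back to \<open>S\<close> the witness \<open>u\<close> may have no
  preimage. But \<phi> h u has one, namely \<open>v\<close>, which is again homogeneous and outside
  \<psi> q; after multiplication by \<open>v\<close> both sides lie in \<open>hi\<close>, where
  \<phi> is injective.\<close>

lemma fraction_eq_hom_iff:
  assumes q: "q \<in> PT" and ab: "a \<in> carrier S" "b \<in> carrier S"
    and fg: "f \<in> CS q" "g \<in> CS q"
  shows "fraction S (CS q) a f = fraction S (CS q) b g \<longleftrightarrow>
    fraction T (CT q) (\<phi> a) (\<phi> f) = fraction T (CT q) (\<phi> b) (\<phi> g)"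
proof -
  interpret C: mult_set S "CS q" by (rule A.mult_set_homog_compl[OF \<psi>_point[OF q]])
  interpret D: mult_set T "CT q" by (rule B.mult_set_homog_compl[OF q])
  note fgc = C.T_closed[OF fg(1)] C.T_closed[OF fg(2)]
  have "(\<exists>u\<in>CS q. u \<otimes> (a \<otimes> g) = u \<otimes> (b \<otimes> f)) \<longleftrightarrow>
    (\<exists>u\<in>CT q. u \<otimes>\<^bsub>T\<^esub> (\<phi> a \<otimes>\<^bsub>T\<^esub> \<phi> g) = u \<otimes>\<^bsub>T\<^esub> (\<phi> b \<otimes>\<^bsub>T\<^esub> \<phi> f))"
    (is "?L \<longleftrightarrow> ?R")
  proof
    assume ?L
    then obtain u where u: "u \<in> CS q"
      "u \<otimes> (a \<otimes> g) = u \<otimes> (b \<otimes> f)" by blast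
    then have "\<phi> (u \<otimes> (a \<otimes> g)) = \<phi> (u \<otimes> (b \<otimes> f))" by simp
    then have "\<phi> u \<otimes>\<^bsub>T\<^esub> (\<phi> a \<otimes>\<^bsub>T\<^esub> \<phi> g) = \<phi> u \<otimes>\<^bsub>T\<^esub> (\<phi> b \<otimes>\<^bsub>T\<^esub> \<phi> f)"
      using ab fgc C.T_closed[OF u(1)] by simp
    then show ?R using hom_homog_compl[OF u(1)] by blast
  next
    assume ?R
    then obtain u d where u: "u \<in> Td d" "u \<notin> q"
      and eq: "u \<otimes>\<^bsub>T\<^esub> (\<phi> a \<otimes>\<^bsub>T\<^esub> \<phi> g) = u \<otimes>\<^bsub>T\<^esub> (\<phi> b \<otimes>\<^bsub>T\<^esub> \<phi> f)"
      unfolding homog_compl_def by blast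
    obtain e h where h: "e \<ge> N" "h \<in> Sd e" "\<phi> h \<notin> q" by (rule good_T[OF q])
    obtain v where v: "v \<in> Sd (e + d)" "\<phi> v = \<phi> h \<otimes>\<^bsub>T\<^esub> u" by (rule lift_mult_homog[OF h(2,1) u(1)])
    have c: "v \<in> carrier S" "h \<in> carrier S" "u \<in> carrier T"
      using v(1) h(2) u(1) A.Sd_carrier B.Sd_carrier by auto
    have "\<phi> v \<notin> q" unfolding v(2) using B.mult_notin_point[OF q] c h(3) u(2) by simp
    then have "v \<notin> \<psi> q" by (simp add: \<psi>_def)
    then have vC: "v \<in> CS q"
      by (rule homog_complI[of _ Sd, OF v(1)])
    have vhi: "v \<in> hi" using Sd_hi[OF v(1)] h(1) by simp
    have "v \<otimes> (a \<otimes> g) = v \<otimes> (b \<otimes> f)"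
    proof (rule inj_hi)
      show "v \<otimes> (a \<otimes> g) \<in> hi" "v \<otimes> (b \<otimes> f) \<in> hi"
        using ab fgc by (simp_all add: hi_mult[OF vhi])
      show "\<phi> (v \<otimes> (a \<otimes> g)) = \<phi> (v \<otimes> (b \<otimes> f))"
        using ab fgc c eq by (simp add: v(2) B.m_assoc)
    qed
    then show ?L using vC by blast
  qed
  then show ?thesis
    using C.fraction_eq_iff[OF ab(1) fg(1) ab(2) fg(2)]
      D.fraction_eq_iff[OF _ hom_homog_compl[OF fg(1)] _ hom_homog_compl[OF fg(2)], of "\<phi> a" "\<phi> b"] ab
    by simp
qed

lemma \<rho>_iff:
  assumes "q \<in> PT" "\<rho> q x y" "\<rho> q x' y'"
  shows "x = x' \<longleftrightarrow> y = y'"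
proof -
  obtain n a f where 1: "a \<in> Sd n" "f \<in> Sd n" "f \<notin> \<psi> q"
    "x = fraction S (CS q) a f" "y = fraction T (CT q) (\<phi> a) (\<phi> f)"
    using assms(2) unfolding \<rho>_def by blast
  obtain m b g where 2: "b \<in> Sd m" "g \<in> Sd m" "g \<notin> \<psi> q"
    "x' = fraction S (CS q) b g" "y' = fraction T (CT q) (\<phi> b) (\<phi> g)"
    using assms(3) unfolding \<rho>_def by blast
  have "f \<in> CS q" "g \<in> CS q"
    by (rule homog_complI[of _ Sd, OF 1(2,3)], rule homog_complI[of _ Sd, OF 2(2,3)])
  then show ?thesis
    unfolding 1(4,5) 2(4,5)
    by (intro fraction_eq_hom_iff assms(1) A.Sd_carrier[OF 1(1)] A.Sd_carrier[OF 2(1)])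
qed

lemma \<rho>_carrier_S: "\<rho> q x y \<Longrightarrow> x \<in> carrier (LS q)"
  by (auto simp: \<rho>_def homog_localization_def)

lemma \<rho>_carrier_T: "\<rho> q x y \<Longrightarrow> y \<in> carrier (LT q)"
proof -
  assume "\<rho> q x y"
  then obtain n a f where 1: "a \<in> Sd n" "f \<in> Sd n" "f \<notin> \<psi> q"
    "y = fraction T (CT q) (\<phi> a) (\<phi> f)" unfolding \<rho>_def by blast
  have "\<phi> a \<in> Td n" "\<phi> f \<in> Td n - q"
    using hom_Sd 1 A.Sd_carrier[OF 1(2)] by (auto simp: \<psi>_def)
  then show ?thesis unfolding 1(4) homog_localization_def by auto
qed

lemma \<rho>_total_S: "x \<in> carrier (LS q) \<Longrightarrow> \<exists>y. \<rho> q x y"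
  by (auto simp: \<rho>_def homog_localization_def)

text \<open>The fraction b/g is expanded by \<phi> h, after which numerator and denominator have
  preimages. The same \<open>a\<close> and \<open>f\<close> serve at all points where neither \<phi>
  h nor \<open>g\<close> vanishes, so whole sections can be lifted locally.\<close>

lemma \<rho>_lift:
  assumes q: "q \<in> PT" and h: "e \<ge> N" "h \<in> Sd e" "\<phi> h \<notin> q"
    and a: "a \<in> Sd (e + n)" "\<phi> a = \<phi> h \<otimes>\<^bsub>T\<^esub> b" and f: "f \<in> Sd (e + n)" "\<phi> f = \<phi> h \<otimes>\<^bsub>T\<^esub> g"
    and b: "b \<in> Td n" and g: "g \<in> Td n" "g \<notin> q"
  shows "f \<notin> \<psi> q"
    and "\<rho> q (fraction S (CS q) a f) (fraction T (CT q) b g)"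
proof -
  interpret D: mult_set T "CT q" by (rule B.mult_set_homog_compl[OF q])
  have c: "\<phi> h \<in> carrier T" "b \<in> carrier T" "g \<in> carrier T"
    using h(2) b g A.Sd_carrier B.Sd_carrier by auto
  have hD: "\<phi> h \<in> CT q" by (rule homog_complI[of _ Td, OF hom_Sd[OF h(2)] h(3)])
  have gD: "g \<in> CT q" by (rule homog_complI[of _ Td, OF g])
  show fq: "f \<notin> \<psi> q" using B.mult_notin_point[OF q c(1,3) h(3) g(2)] f(2) by (simp add: \<psi>_def)
  have "fraction T (CT q) b g = fraction T (CT q) (\<phi> a) (\<phi> f)"
    unfolding a(2) f(2) by (rule D.fraction_cancel[OF c(2) gD hD, symmetric])
  then show "\<rho> q (fraction S (CS q) a f) (fraction T (CT q) b g)"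
    unfolding \<rho>_def using a(1) f(1) fq by blast
qed

lemma \<rho>_total_T:
  assumes q: "q \<in> PT" and y: "y \<in> carrier (LT q)"
  shows "\<exists>x. \<rho> q x y"
proof -
  obtain b g n where bg: "b \<in> Td n" "g \<in> Td n" "g \<notin> q" "y = fraction T (CT q) b g"
    using y by (auto simp: homog_localization_def)
  obtain e h where h: "e \<ge> N" "h \<in> Sd e" "\<phi> h \<notin> q" by (rule good_T[OF q])
  obtain a where a: "a \<in> Sd (e + n)" "\<phi> a = \<phi> h \<otimes>\<^bsub>T\<^esub> b" by (rule lift_mult_homog[OF h(2,1) bg(1)])
  obtain f where f: "f \<in> Sd (e + n)" "\<phi> f = \<phi> h \<otimes>\<^bsub>T\<^esub> g" by (rule lift_mult_homog[OF h(2,1) bg(2)])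
  show ?thesis using \<rho>_lift(2)[OF q h a f bg(1-3)] bg(4) by blast
qed

lemma
  assumes q: "q \<in> PT" and 1: "\<rho> q x y" and 2: "\<rho> q x' y'"
  shows \<rho>_mult: "\<rho> q (x \<otimes>\<^bsub>LS q\<^esub> x') (y \<otimes>\<^bsub>LT q\<^esub> y')"
    and \<rho>_add: "\<rho> q (x \<oplus>\<^bsub>LS q\<^esub> x') (y \<oplus>\<^bsub>LT q\<^esub> y')"
proof -
  interpret C: mult_set S "CS q" by (rule A.mult_set_homog_compl[OF \<psi>_point[OF q]])
  interpret D: mult_set T "CT q" by (rule B.mult_set_homog_compl[OF q])
  obtain n a f where 1: "a \<in> Sd n" "f \<in> Sd n" "f \<notin> \<psi> q"
    "x = fraction S (CS q) a f" "y = fraction T (CT q) (\<phi> a) (\<phi> f)"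
    using 1 unfolding \<rho>_def by blast
  obtain m b g where 2: "b \<in> Sd m" "g \<in> Sd m" "g \<notin> \<psi> q"
    "x' = fraction S (CS q) b g" "y' = fraction T (CT q) (\<phi> b) (\<phi> g)"
    using 2 unfolding \<rho>_def by blast
  have fg: "f \<in> CS q" "g \<in> CS q"
    by (rule homog_complI[of _ Sd, OF 1(2,3)], rule homog_complI[of _ Sd, OF 2(2,3)])
  note c = A.Sd_carrier[OF 1(1)] A.Sd_carrier[OF 1(2)] A.Sd_carrier[OF 2(1)] A.Sd_carrier[OF 2(2)]
  have fgd: "f \<otimes> g \<in> Sd (n + m)" "f \<otimes> g \<notin> \<psi> q"
    using A.Sd_mult[OF 1(2) 2(2)] A.mult_notin_point[OF \<psi>_point[OF q] c(2,4) 1(3) 2(3)] by auto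
  have "a \<otimes> b \<in> Sd (n + m)" by (rule A.Sd_mult[OF 1(1) 2(1)])
  moreover have "x \<otimes>\<^bsub>LS q\<^esub> x'
      = fraction S (CS q) (a \<otimes> b) (f \<otimes> g)"
    unfolding 1(4) 2(4) A.homog_localization_ops by (rule C.fraction_mult[OF c(1) fg(1) c(3) fg(2)])
  moreover have "y \<otimes>\<^bsub>LT q\<^esub> y'
      = fraction T (CT q) (\<phi> (a \<otimes> b)) (\<phi> (f \<otimes> g))"
    unfolding 1(5) 2(5) B.homog_localization_ops
    using D.fraction_mult[OF _ hom_homog_compl[OF fg(1)] _ hom_homog_compl[OF fg(2)], of "\<phi> a" "\<phi> b"] c
    by simp
  ultimately show "\<rho> q (x \<otimes>\<^bsub>LS q\<^esub> x') (y \<otimes>\<^bsub>LT q\<^esub> y')"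
    unfolding \<rho>_def using fgd by blast
  have "a \<otimes> g \<oplus> b \<otimes> f \<in> Sd (n + m)"
    using A.Sd_add[OF A.Sd_mult[OF 1(1) 2(2)]] A.Sd_mult[OF 2(1) 1(2)] by (simp add: add.commute)
  moreover have "x \<oplus>\<^bsub>LS q\<^esub> x'
      = fraction S (CS q) (a \<otimes> g \<oplus> b \<otimes> f) (f \<otimes> g)"
    unfolding 1(4) 2(4) A.homog_localization_ops by (rule C.fraction_add[OF c(1) fg(1) c(3) fg(2)])
  moreover have "y \<oplus>\<^bsub>LT q\<^esub> y'
      = fraction T (CT q) (\<phi> (a \<otimes> g \<oplus> b \<otimes> f)) (\<phi> (f \<otimes> g))"
    unfolding 1(5) 2(5) B.homog_localization_ops
    using D.fraction_add[OF _ hom_homog_compl[OF fg(1)] _ hom_homog_compl[OF fg(2)], of "\<phi> a" "\<phi> b"] c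
    by simp
  ultimately show "\<rho> q (x \<oplus>\<^bsub>LS q\<^esub> x') (y \<oplus>\<^bsub>LT q\<^esub> y')"
    unfolding \<rho>_def using fgd by blast
qed

lemma \<rho>_one:
  assumes q: "q \<in> PT"
  shows "\<rho> q \<one>\<^bsub>LS q\<^esub> \<one>\<^bsub>LT q\<^esub>"
proof -
  interpret C: mult_set S "CS q" by (rule A.mult_set_homog_compl[OF \<psi>_point[OF q]])
  interpret D: mult_set T "CT q" by (rule B.mult_set_homog_compl[OF q])
  show ?thesis
    unfolding \<rho>_def A.homog_localization_ops B.homog_localization_ops C.localization_one D.localization_one
    by (intro exI[of _ "0::nat"] exI[of _ "\<one>"])
      (simp add: A.Sd_one A.one_notin_point[OF \<psi>_point[OF q]])
qed

section \<open>Transfer of sections\<close>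

lemma section_S_imp_T:
  assumes W: "openin (proj_topology T Td) W"
    and s: "s \<in> carrier (proj_sections S Sd {p \<in> PS. \<chi> p \<in> W})"
    and t: "t \<in> extensional W" and \<rho>: "\<And>q. q \<in> W \<Longrightarrow> \<rho> q (s (\<psi> q)) (t q)"
  shows "t \<in> carrier (proj_sections T Td W)"
proof -
  have WP: "W \<subseteq> PT" using openin_subset[OF W] B.topspace_proj by simp
  have "\<exists>V n. \<exists>b\<in>Td n. \<exists>g\<in>Td n. openin (proj_topology T Td) V \<and> q \<in> V \<and> V \<subseteq> W \<and>
      (\<forall>q'\<in>V. g \<notin> q' \<and> t q' = fraction T (homog_compl Td q') b g)" if q: "q \<in> W" for q
  proof -
    have qP: "q \<in> PT" using q WP by blast
    have \<psi>q: "\<psi> q \<in> {p \<in> PS. \<chi> p \<in> W}" using q qP \<psi>_point \<chi>_\<psi> by simp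
    obtain V n a f where V0: "a \<in> Sd n" "f \<in> Sd n" "openin (proj_topology S Sd) V" "\<psi> q \<in> V"
      "V \<subseteq> {p \<in> PS. \<chi> p \<in> W}" "\<forall>p\<in>V. f \<notin> p \<and> s p = fraction S (homog_compl Sd p) a f"
      by (rule section_localE[OF s \<psi>q])
    note V = V0(1-5) conjunct1[OF bspec[OF V0(6)]] conjunct2[OF bspec[OF V0(6)]]
    let ?V = "{q \<in> PT. \<psi> q \<in> V}"
    have "\<phi> f \<notin> q' \<and> t q' = fraction T (homog_compl Td q') (\<phi> a) (\<phi> f)" if q': "q' \<in> ?V" for q'
    proof
      have q'W: "q' \<in> W" using q' V(5) \<chi>_\<psi> by auto
      show "\<phi> f \<notin> q'" using V(6) q' A.Sd_carrier[OF V(2)] by (auto simp: \<psi>_def)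
      have "\<rho> q' (s (\<psi> q')) (fraction T (homog_compl Td q') (\<phi> a) (\<phi> f))"
        unfolding \<rho>_def using V(1,2,6,7) q' by blast
      then show "t q' = fraction T (homog_compl Td q') (\<phi> a) (\<phi> f)"
        using \<rho>_iff[OF _ \<rho>[OF q'W]] q' by blast
    qed
    moreover have "?V \<subseteq> W" using V(5) \<chi>_\<psi> by auto
    moreover have "q \<in> ?V" using qP V(4) by simp
    ultimately show ?thesis
      using open_\<psi>[OF V(3)] hom_Sd[OF V(1)] hom_Sd[OF V(2)]
      by (intro exI[of _ ?V] exI[of _ n] bexI[of _ "\<phi> a"] bexI[of _ "\<phi> f"]) auto
  qed
  moreover have "t q \<in> carrier (LT q)" if "q \<in> W" for q
    by (rule \<rho>_carrier_T[OF \<rho>[OF that]])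
  ultimately show ?thesis
    unfolding proj_sections_def using t by (simp add: PiE_def Pi_def)
qed

lemma section_T_imp_S:
  assumes W: "openin (proj_topology T Td) W"
    and t: "t \<in> carrier (proj_sections T Td W)"
    and s: "s \<in> extensional {p \<in> PS. \<chi> p \<in> W}" and \<rho>: "\<And>q. q \<in> W \<Longrightarrow> \<rho> q (s (\<psi> q)) (t q)"
  shows "s \<in> carrier (proj_sections S Sd {p \<in> PS. \<chi> p \<in> W})"
proof -
  let ?U = "{p \<in> PS. \<chi> p \<in> W}"
  have WP: "W \<subseteq> PT" using openin_subset[OF W] B.topspace_proj by simp
  have \<rho>': "\<rho> (\<chi> p) (s p) (t (\<chi> p))" if "p \<in> ?U" for p
    using \<rho>[of "\<chi> p"] that \<psi>_\<chi> by simp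
  have "\<exists>V n. \<exists>a\<in>Sd n. \<exists>f\<in>Sd n. openin (proj_topology S Sd) V \<and> p \<in> V \<and> V \<subseteq> ?U \<and>
      (\<forall>p'\<in>V. f \<notin> p' \<and> s p' = fraction S (homog_compl Sd p') a f)" if p: "p \<in> ?U" for p
  proof -
    have q: "\<chi> p \<in> W" "\<chi> p \<in> PT" using p WP by auto
    obtain V n b g where V0: "b \<in> Td n" "g \<in> Td n" "openin (proj_topology T Td) V" "\<chi> p \<in> V"
      "V \<subseteq> W" "\<forall>q\<in>V. g \<notin> q \<and> t q = fraction T (CT q) b g"
      by (rule section_localE[OF t q(1)])
    note V = V0(1-5) conjunct1[OF bspec[OF V0(6)]] conjunct2[OF bspec[OF V0(6)]]
    obtain e h where h: "e \<ge> N" "h \<in> Sd e" "\<phi> h \<notin> \<chi> p" by (rule good_T[OF q(2)])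
    obtain a where a: "a \<in> Sd (e + n)" "\<phi> a = \<phi> h \<otimes>\<^bsub>T\<^esub> b" by (rule lift_mult_homog[OF h(2,1) V(1)])
    obtain f where f: "f \<in> Sd (e + n)" "\<phi> f = \<phi> h \<otimes>\<^bsub>T\<^esub> g" by (rule lift_mult_homog[OF h(2,1) V(2)])
    \<comment> \<open>The lifted fraction a/f is known to represent \<open>s\<close> only where
      \<open>h\<close> does not vanish, hence the intersection with D(h).\<close>
    let ?V = "{p \<in> PS. \<chi> p \<in> V} \<inter> {p \<in> PS. h \<notin> p}"
    have hc: "h \<in> carrier S" by (rule A.Sd_carrier[OF h(2)])
    have mem: "\<phi> h \<in> \<chi> p' \<longleftrightarrow> h \<in> p'" if "p' \<in> PS" for p'
      using \<psi>_\<chi>[OF that] hc unfolding \<psi>_def by blast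
    have "f \<notin> p' \<and> s p' = fraction S (homog_compl Sd p') a f" if p': "p' \<in> ?V" for p'
    proof -
      have P: "p' \<in> PS" "\<chi> p' \<in> PT" "\<chi> p' \<in> V" "\<phi> h \<notin> \<chi> p'" "p' \<in> ?U" "\<psi> (\<chi> p') = p'"
        using p' mem \<chi>_point \<psi>_\<chi> V(5) by auto
      note l = \<rho>_lift[OF P(2) h(1,2) P(4) a f V(1,2) V(6)[OF P(3)]]
      have "\<rho> (\<chi> p') (fraction S (homog_compl Sd p') a f) (t (\<chi> p'))"
        using l(2) V(7)[OF P(3)] P(6) by simp
      then show ?thesis using \<rho>_iff[OF P(2) \<rho>'[OF P(5)]] l(1) P(6) by blast
    qed
    moreover have "openin (proj_topology S Sd) ?V"
      by (rule openin_Int[OF open_\<chi>[OF V(3)] A.openin_basic[OF hc]])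
    moreover have "p \<in> ?V" "?V \<subseteq> ?U" using p V(4,5) h(3) mem by auto
    ultimately show ?thesis
      using a(1) f(1)
      by (intro exI[of _ ?V] exI[of _ "e + n"] bexI[of _ a] bexI[of _ f]) auto
  qed
  moreover have "s p \<in> carrier (homog_localization S Sd p)" if "p \<in> ?U" for p
    using \<rho>_carrier_S[OF \<rho>'[OF that]] that \<psi>_\<chi> by simp
  ultimately show ?thesis
    unfolding proj_sections_def using s by (simp add: PiE_def Pi_def)
qed

text \<open>It runs from stalks of \<open>T\<close> to stalks of \<open>S\<close>, against \<phi>,
  because an isomorphism of ringed spaces over \<chi> maps sections on the target Proj T to sections
  on Proj S.\<close>

definition \<kappa> :: "'b set \<Rightarrow> ('b \<times> 'b) set \<Rightarrow> ('a \<times> 'a) set" where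
  "\<kappa> q y = (THE x. \<rho> q x y)"

lemma \<kappa>_eq: "q \<in> PT \<Longrightarrow> \<rho> q x y \<Longrightarrow> \<kappa> q y = x"
  unfolding \<kappa>_def using \<rho>_iff by (intro the_equality) auto

lemma \<rho>_\<kappa>: "q \<in> PT \<Longrightarrow> y \<in> carrier (LT q) \<Longrightarrow> \<rho> q (\<kappa> q y) y"
  using \<rho>_total_T \<kappa>_eq by metis

definition \<theta> :: "'b set set \<Rightarrow> ('b set \<Rightarrow> ('b \<times> 'b) set) \<Rightarrow> 'a set \<Rightarrow> ('a \<times> 'a) set" where
  "\<theta> W t = (\<lambda>p\<in>{p \<in> PS. \<chi> p \<in> W}. \<kappa> (\<chi> p) (t (\<chi> p)))"

lemma section_T_stalk:
  "t \<in> carrier (proj_sections T Td W) \<Longrightarrow> q \<in> W \<Longrightarrow> t q \<in> carrier (LT q)"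
  by (auto simp: proj_sections_def)

lemma section_S_stalk:
  "s \<in> carrier (proj_sections S Sd U) \<Longrightarrow> p \<in> U \<Longrightarrow> s p \<in> carrier (homog_localization S Sd p)"
  by (auto simp: proj_sections_def)

lemma \<theta>_iso:
  assumes W: "openin (proj_topology T Td) W"
  shows "\<theta> W \<in> ring_iso (proj_sections T Td W) (proj_sections S Sd {p \<in> PS. \<chi> p \<in> W})"
proof -
  let ?U = "{p \<in> PS. \<chi> p \<in> W}"
  have WP: "q \<in> W \<Longrightarrow> q \<in> PT" for q using openin_subset[OF W] B.topspace_proj by auto
  have \<rho>: "\<rho> q (\<theta> W t (\<psi> q)) (t q)" if "t \<in> carrier (proj_sections T Td W)" "q \<in> W" for t q
    using \<rho>_\<kappa>[OF WP section_T_stalk] that \<psi>_point \<chi>_\<psi> WP by (simp add: \<theta>_def)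
  have closed: "\<theta> W t \<in> carrier (proj_sections S Sd ?U)" if "t \<in> carrier (proj_sections T Td W)" for t
    by (rule section_T_imp_S[OF W that _ \<rho>[OF that]]) (simp only: \<theta>_def restrict_extensional)
  have "\<theta> W \<in> ring_hom (proj_sections T Td W) (proj_sections S Sd ?U)"
  proof (rule ring_hom_memI)
    fix t t' assume t: "t \<in> carrier (proj_sections T Td W)" "t' \<in> carrier (proj_sections T Td W)"
    show "\<theta> W t \<in> carrier (proj_sections S Sd ?U)" by (rule closed[OF t(1)])
    have *: "\<kappa> (\<chi> p) (t (\<chi> p) \<otimes>\<^bsub>LT (\<chi> p)\<^esub> t' (\<chi> p))
        = \<kappa> (\<chi> p) (t (\<chi> p)) \<otimes>\<^bsub>homog_localization S Sd p\<^esub> \<kappa> (\<chi> p) (t' (\<chi> p))"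
      "\<kappa> (\<chi> p) (t (\<chi> p) \<oplus>\<^bsub>LT (\<chi> p)\<^esub> t' (\<chi> p))
        = \<kappa> (\<chi> p) (t (\<chi> p)) \<oplus>\<^bsub>homog_localization S Sd p\<^esub> \<kappa> (\<chi> p) (t' (\<chi> p))" if p: "p \<in> ?U" for p
    proof -
      have q: "\<chi> p \<in> PT" "\<chi> p \<in> W" "\<psi> (\<chi> p) = p" using p WP \<psi>_\<chi> by auto
      note r = \<rho>_\<kappa>[OF q(1) section_T_stalk[OF t(1) q(2)]] \<rho>_\<kappa>[OF q(1) section_T_stalk[OF t(2) q(2)]]
      show "\<kappa> (\<chi> p) (t (\<chi> p) \<otimes>\<^bsub>LT (\<chi> p)\<^esub> t' (\<chi> p))
        = \<kappa> (\<chi> p) (t (\<chi> p)) \<otimes>\<^bsub>homog_localization S Sd p\<^esub> \<kappa> (\<chi> p) (t' (\<chi> p))"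
        using \<kappa>_eq[OF q(1) \<rho>_mult[OF q(1) r]] q(3) by simp
      show "\<kappa> (\<chi> p) (t (\<chi> p) \<oplus>\<^bsub>LT (\<chi> p)\<^esub> t' (\<chi> p))
        = \<kappa> (\<chi> p) (t (\<chi> p)) \<oplus>\<^bsub>homog_localization S Sd p\<^esub> \<kappa> (\<chi> p) (t' (\<chi> p))"
        using \<kappa>_eq[OF q(1) \<rho>_add[OF q(1) r]] q(3) by simp
    qed
    show "\<theta> W (t \<otimes>\<^bsub>proj_sections T Td W\<^esub> t') = \<theta> W t \<otimes>\<^bsub>proj_sections S Sd ?U\<^esub> \<theta> W t'"
      by (rule ext) (simp add: \<theta>_def proj_sections_def restrict_def *(1))
    show "\<theta> W (t \<oplus>\<^bsub>proj_sections T Td W\<^esub> t') = \<theta> W t \<oplus>\<^bsub>proj_sections S Sd ?U\<^esub> \<theta> W t'"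
      by (rule ext) (simp add: \<theta>_def proj_sections_def restrict_def *(2))
  next
    have "\<kappa> (\<chi> p) \<one>\<^bsub>LT (\<chi> p)\<^esub> = \<one>\<^bsub>homog_localization S Sd p\<^esub>"
      if "p \<in> ?U" for p
      using \<kappa>_eq[OF WP \<rho>_one[OF WP]] that \<psi>_\<chi> by simp
    then show "\<theta> W \<one>\<^bsub>proj_sections T Td W\<^esub> = \<one>\<^bsub>proj_sections S Sd ?U\<^esub>"
      by (intro ext) (simp add: \<theta>_def proj_sections_def restrict_def)
  qed
  moreover have "inj_on (\<theta> W) (carrier (proj_sections T Td W))"
  proof (rule inj_onI)
    fix t t' assume t: "t \<in> carrier (proj_sections T Td W)" "t' \<in> carrier (proj_sections T Td W)"
      and eq: "\<theta> W t = \<theta> W t'"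
    have "t q = t' q" if "q \<in> W" for q
      using \<rho>_iff[OF WP[OF that] \<rho>[OF t(1) that] \<rho>[OF t(2) that]] eq by simp
    moreover have "t \<in> extensional W" "t' \<in> extensional W"
      using t by (auto simp: proj_sections_def PiE_def)
    ultimately show "t = t'" by (intro extensionalityI[of t W t']) auto
  qed
  moreover have "s \<in> \<theta> W ` carrier (proj_sections T Td W)" if s: "s \<in> carrier (proj_sections S Sd ?U)" for s
  proof -
    \<comment> \<open>For surjectivity a preimage is chosen stalk by stalk; that the choices form a
      section is the content of \<open>section_S_imp_T\<close>.\<close>
    have "\<exists>y. \<rho> q (s (\<psi> q)) y" if "q \<in> W" for q
      using \<rho>_total_S section_S_stalk[OF s, of "\<psi> q"] that \<psi>_point \<chi>_\<psi> WP by simp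
    then obtain t0 where t0: "\<And>q. q \<in> W \<Longrightarrow> \<rho> q (s (\<psi> q)) (t0 q)" by metis
    define t where "t = restrict t0 W"
    have rt: "\<rho> q (s (\<psi> q)) (t q)" if "q \<in> W" for q using t0 that by (simp add: t_def)
    have "t \<in> carrier (proj_sections T Td W)"
      by (rule section_S_imp_T[OF W s _ rt]) (simp only: t_def restrict_extensional)
    moreover have "\<theta> W t = s"
    proof (rule extensionalityI[of _ ?U])
      show "\<theta> W t \<in> extensional ?U" by (simp only: \<theta>_def restrict_extensional)
      show "s \<in> extensional ?U" using s by (auto simp: proj_sections_def PiE_def)
      fix p assume p: "p \<in> ?U"
      then show "\<theta> W t p = s p"
        using \<kappa>_eq[OF WP rt, of "\<chi> p"] \<psi>_\<chi> by (simp add: \<theta>_def)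
    qed
    ultimately show ?thesis by blast
  qed
  ultimately show ?thesis
    unfolding ring_iso_def bij_betw_def using closed by blast
qed

theorem isomorphic_Proj: "isomorphic_spaces (Proj S Sd) (Proj T Td)"
proof -
  have "\<theta> V (restrict t V) = restrict (\<theta> W t) {p \<in> PS. \<chi> p \<in> V}" if "V \<subseteq> W" for V W t
    using that by (intro ext) (auto simp: \<theta>_def restrict_def)
  then have "ringed_space_iso (Proj S Sd) (Proj T Td) \<chi> \<theta>"
    unfolding ringed_space_iso_def Let_def
    using homeomorphic_\<chi> \<theta>_iso by (simp add: Proj_def A.topspace_proj)
  then show ?thesis unfolding isomorphic_spaces_def by blast
qed

end

section \<open>The grading of G and the effect of a reduced Proj\<close>

context cring_ideal begin

lemma graded_cring_G: "graded_cring G (gr_degree R I) hcomp"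
proof (intro graded_cring.intro graded_cring_axioms.intro cring_G)
  fix f g x y :: "nat \<Rightarrow> 'a set" and m n i j :: nat
  show "gr_degree R I n \<subseteq> carrier G" unfolding gr_degree_def by blast
  show "hcomp n f \<in> gr_degree R I n" if f: "f \<in> carrier G"
  proof -
    obtain p where p: "p \<in> rees" "f = \<Gamma> p" by (rule \<Gamma>_surj[OF f])
    show ?thesis unfolding degree_iff_single p(2) hcomp_\<Gamma> using rees_pw[OF p(1)] by blast
  qed
  show "hcomp n (f \<oplus>\<^bsub>G\<^esub> g) = hcomp n f \<oplus>\<^bsub>G\<^esub> hcomp n g" if fg: "f \<in> carrier G" "g \<in> carrier G"
  proof -
    have cl: "hcomp n f \<in> carrier G" if f: "f \<in> carrier G" for f
    proof -
      obtain p where p: "p \<in> rees" "f = \<Gamma> p" by (rule \<Gamma>_surj[OF f])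
      show ?thesis unfolding p(2) hcomp_\<Gamma> by (rule \<Gamma>_closed[OF single_rees[OF rees_pw[OF p(1)]]])
    qed
    show ?thesis
      by (rule ext, subst G_add_apply[OF cl[OF fg(1)] cl[OF fg(2)]])
        (simp add: hcomp_def G_add_apply[OF fg] gr_mult)
  qed
  show "hcomp n f = (if n = m then f else \<zero>\<^bsub>G\<^esub>)" if f: "f \<in> gr_degree R I m"
  proof -
    obtain x where x: "x \<in> pw m" "f = \<Gamma> (single m x)" using f unfolding degree_iff_single by blast
    show ?thesis unfolding x(2) hcomp_\<Gamma> G_zero by (auto simp: single_def \<Gamma>_def)
  qed
  show "\<exists>N. f = (\<Oplus>\<^bsub>G\<^esub>n\<in>{..N}. hcomp n f)" if f: "f \<in> carrier G"
  proof -
    obtain N where N: "\<And>n. f n \<noteq> cls n \<zero> \<Longrightarrow> n \<le> N"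
      using f unfolding G_carrier finite_nat_set_iff_bounded_le by blast
    have "f = (\<lambda>k. if k \<le> N then f k else cls k \<zero>)" by (rule ext) (use N in \<open>metis (full_types)\<close>)
    then show ?thesis unfolding comp_sum[OF f] by blast
  qed
  show "\<one>\<^bsub>G\<^esub> \<in> gr_degree R I 0"
    unfolding degree_iff_single G_one by (rule bexI[of _ \<one>]) (simp_all add: single_def)
  show "f \<otimes>\<^bsub>G\<^esub> g \<in> gr_degree R I (i + j)" if "f \<in> gr_degree R I i" "g \<in> gr_degree R I j"
    using that unfolding degree_iff_single using single_mult pw_mult by blast
qed

lemma single_pow:
  assumes "x \<in> pw n"
  shows "\<Gamma> (single n x) [^]\<^bsub>G\<^esub> (k::nat) = \<Gamma> (single (n * k) (x [^] k))"
proof (induction k)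
  case 0
  show ?case by (simp add: G_one single_def)
next
  case (Suc k)
  have "x [^] k \<in> pw (n * k)" by (rule ideal_power_pow[OF ideal assms])
  then show ?case using single_mult[OF _ assms, of "x [^] k" "n * k"] Suc by (simp add: add.commute)
qed

lemma single_eq_zero_iff:
  assumes "x \<in> carrier R"
  shows "\<Gamma> (single n x) = \<zero>\<^bsub>G\<^esub> \<longleftrightarrow> x \<in> pw (Suc n)"
proof -
  have "\<Gamma> (single n x) = \<zero>\<^bsub>G\<^esub> \<longleftrightarrow> cls n x = cls n \<zero>"
    unfolding G_zero by (auto simp: \<Gamma>_def single_def fun_eq_iff)
  then show ?thesis using cls_eq_zero_iff[OF assms] by simp
qed

text \<open>The j-th power of the class of \<open>f\<close> lives in degree n j, so
  \<open>nil\<close> says that this class is nilpotent. The degree one form used as denominator is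
  the class of \<open>x\<close>.\<close>

lemma Proj_reduced_imp_killed:
  assumes red: "reduced_space (Proj G (gr_degree R I))" and x: "x \<in> I" and f: "f \<in> pw n"
    and nil: "f [^] (j::nat) \<in> pw (Suc (n * j))"
  shows "\<exists>e::nat. x [^] e \<otimes> f \<in> pw (Suc (e + n))"
proof -
  interpret G: graded_cring G "gr_degree R I" hcomp by (rule graded_cring_G)
  have x1: "x \<in> pw 1" using x ideal_power_one[OF ideal] by simp
  have "\<exists>e::nat. \<Gamma> (single 1 x) [^]\<^bsub>G\<^esub> e \<otimes>\<^bsub>G\<^esub> \<Gamma> (single n f) = \<zero>\<^bsub>G\<^esub>"
  proof (rule G.nilpotent_killed_by_power[OF red])
    show "\<Gamma> (single 1 x) \<in> gr_degree R I 1" unfolding degree_iff_single using x1 by blast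
    show "\<Gamma> (single n f) \<in> gr_degree R I n" unfolding degree_iff_single using f by blast
    show "\<Gamma> (single n f) [^]\<^bsub>G\<^esub> j = \<zero>\<^bsub>G\<^esub>"
      unfolding single_pow[OF f] using nil single_eq_zero_iff pw_carrier[OF f] by simp
  qed
  then obtain e :: nat where e: "\<Gamma> (single 1 x) [^]\<^bsub>G\<^esub> e \<otimes>\<^bsub>G\<^esub> \<Gamma> (single n f) = \<zero>\<^bsub>G\<^esub>" by blast
  have xe: "x [^] e \<in> pw e" using ideal_power_pow[OF ideal x1, of e] by simp
  have "\<Gamma> (single (e + n) (x [^] e \<otimes> f)) = \<zero>\<^bsub>G\<^esub>"
    using e single_mult[OF xe f] single_pow[OF x1, of e] by simp
  then show ?thesis using single_eq_zero_iff pw_carrier[OF xe] pw_carrier[OF f] by auto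
qed

end

section \<open>The graded homomorphism induced by a ring homomorphism\<close>

locale ideal_hom = A: cring_ideal R I + B: cring_ideal S J
  for R :: "('a, 'c) ring_scheme" (structure) and I and S :: "('b, 'd) ring_scheme" and J +
  fixes h :: "'a \<Rightarrow> 'b"
  assumes hom: "h \<in> ring_hom R S" and image: "x \<in> I \<Longrightarrow> h x \<in> J"
begin

sublocale h: ring_hom_cring R S h
  by (intro ring_hom_cring.intro ring_hom_cring_axioms.intro hom A.is_cring B.is_cring)

lemma hom_pw: "x \<in> A.pw n \<Longrightarrow> h x \<in> B.pw n"
proof (induction n arbitrary: x)
  case 0
  then show ?case by simp
next
  case (Suc n)
  from Suc.prems have "x \<in> ideal_prod R (A.pw n) I" by (simp add: ideal_power.simps(2))
  then show ?case
  proof (induction x rule: ideal_prod.induct)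
    case (prod u v)
    then have "h (u \<otimes> v) = h u \<otimes>\<^bsub>S\<^esub> h v"
      using A.pw_carrier ideal.Icarr[OF A.ideal] by simp
    then show ?case
      using ideal_prod.prod[OF Suc.IH[OF prod(1)] image[OF prod(2)], of S]
      by (simp add: ideal_power.simps(2))
  next
    case (sum u v)
    then have "u \<in> carrier R" "v \<in> carrier R"
      using A.pw_carrier[of _ "Suc n"] by (auto simp: ideal_power.simps(2))
    then show ?case using sum.IH B.pw_add by simp
  qed
qed

lemma gr_map_cls:
  assumes x: "x \<in> carrier R"
  shows "gr_map S J h n (A.cls n x) = B.cls n (h x)"
proof -
  have *: "B.cls n (h y) = B.cls n (h x)" if y: "y \<in> A.cls n x" for y
  proof -
    have yc: "y \<in> carrier R" and eq: "A.cls n y = A.cls n x" using A.mem_cls[OF x y] by auto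
    then have "h (y \<ominus> x) \<in> B.pw (Suc n)" using A.cls_eq_iff[OF yc x] hom_pw by blast
    then show ?thesis using B.cls_eq_iff[of "h y" "h x" n] yc x by (simp add: A.minus_eq B.minus_eq)
  qed
  have "gr_map S J h n (A.cls n x) = (\<Union>y\<in>A.cls n x. B.cls n (h y))"
    unfolding gr_map_def B.cls_def ..
  also have "\<dots> = (\<Union>y\<in>A.cls n x. B.cls n (h x))" by (intro SUP_cong refl) (rule *)
  also have "\<dots> = B.cls n (h x)" using A.cls_self[OF x] by blast
  finally show ?thesis .
qed

definition \<Phi> :: "(nat \<Rightarrow> 'a set) \<Rightarrow> nat \<Rightarrow> 'b set" where
  "\<Phi> f = (\<lambda>n. gr_map S J h n (f n))"

lemma \<Phi>_\<Gamma>: "p \<in> A.rees \<Longrightarrow> \<Phi> (A.\<Gamma> p) = B.\<Gamma> (\<lambda>n. h (p n))"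
  using gr_map_cls A.rees_carrier by (simp add: \<Phi>_def A.\<Gamma>_def B.\<Gamma>_def)

lemma \<Phi>_single: "x \<in> A.pw n \<Longrightarrow> \<Phi> (A.\<Gamma> (A.single n x)) = B.\<Gamma> (B.single n (h x))"
  unfolding \<Phi>_\<Gamma>[OF A.single_rees]
  by (rule arg_cong[of _ _ B.\<Gamma>]) (auto simp: A.single_def B.single_def)

lemma hom_rees: "p \<in> A.rees \<Longrightarrow> (\<lambda>n. h (p n)) \<in> B.rees"
proof -
  assume p: "p \<in> A.rees"
  obtain k where "bound \<zero> k p" using A.bound_upD[OF A.rees_up[OF p]] by blast
  then have "bound \<zero>\<^bsub>S\<^esub> k (\<lambda>n. h (p n))" by (auto simp: bound_def)
  then have "(\<lambda>n. h (p n)) \<in> up S" using A.rees_carrier[OF p] by (intro mem_upI) auto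
  then show ?thesis using hom_pw[OF A.rees_pw[OF p]] by (simp add: B.rees_def)
qed

text \<open>Checked on lifts to the Rees algebra, where the product is a convolution, which
  \<open>h\<close> respects term by term.\<close>

lemma \<Phi>_hom: "\<Phi> \<in> ring_hom A.G B.G"
proof (rule ring_hom_memI)
  fix f g assume f: "f \<in> carrier A.G" and g: "g \<in> carrier A.G"
  obtain p where p: "p \<in> A.rees" "f = A.\<Gamma> p" by (rule A.\<Gamma>_surj[OF f])
  obtain q where q: "q \<in> A.rees" "g = A.\<Gamma> q" by (rule A.\<Gamma>_surj[OF g])
  note c = A.rees_carrier[OF p(1)] A.rees_carrier[OF q(1)]
  show "\<Phi> f \<in> carrier B.G" unfolding p(2) \<Phi>_\<Gamma>[OF p(1)] by (rule B.\<Gamma>_closed[OF hom_rees[OF p(1)]])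
  have m: "f \<otimes>\<^bsub>A.G\<^esub> g = A.\<Gamma> (\<lambda>n. \<Oplus>i\<in>{..n}. p i \<otimes> q (n - i))"
    unfolding p(2) q(2) by (rule A.G_mult[OF p(1) q(1)])
  have "\<Phi> (f \<otimes>\<^bsub>A.G\<^esub> g) n = B.cls n (h (\<Oplus>i\<in>{..n}. p i \<otimes> q (n - i)))" for n
    unfolding m using gr_map_cls[OF A.pw_carrier[OF A.rees_conv[OF p(1) q(1)]]]
    by (simp add: \<Phi>_def A.\<Gamma>_def)
  moreover have "h (\<Oplus>i\<in>{..n}. p i \<otimes> q (n - i)) = (\<Oplus>\<^bsub>S\<^esub>i\<in>{..n}. h (p i) \<otimes>\<^bsub>S\<^esub> h (q (n - i)))" for n
    using h.hom_finsum[of "\<lambda>i. p i \<otimes> q (n - i)" "{..n}"] c by (simp add: o_def)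
  ultimately show "\<Phi> (f \<otimes>\<^bsub>A.G\<^esub> g) = \<Phi> f \<otimes>\<^bsub>B.G\<^esub> \<Phi> g"
    unfolding p(2) q(2) \<Phi>_\<Gamma>[OF p(1)] \<Phi>_\<Gamma>[OF q(1)] B.G_mult[OF hom_rees[OF p(1)] hom_rees[OF q(1)]]
    by (intro ext) (simp add: B.\<Gamma>_def)
  have a: "f \<oplus>\<^bsub>A.G\<^esub> g = A.\<Gamma> (\<lambda>n. p n \<oplus> q n)"
    unfolding p(2) q(2) by (rule A.G_add[OF p(1) q(1)])
  show "\<Phi> (f \<oplus>\<^bsub>A.G\<^esub> g) = \<Phi> f \<oplus>\<^bsub>B.G\<^esub> \<Phi> g"
    unfolding a unfolding p(2) q(2) \<Phi>_\<Gamma>[OF p(1)] \<Phi>_\<Gamma>[OF q(1)] B.G_add[OF hom_rees[OF p(1)] hom_rees[OF q(1)]]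
    using gr_map_cls c by (simp add: \<Phi>_def A.\<Gamma>_def B.\<Gamma>_def)
next
  show "\<Phi> \<one>\<^bsub>A.G\<^esub> = \<one>\<^bsub>B.G\<^esub>"
    unfolding A.G_one B.G_one using gr_map_cls
    by (intro ext) (simp add: \<Phi>_def A.\<Gamma>_def B.\<Gamma>_def)
qed

text \<open>Bijectivity has to pass between two descriptions of degree \<open>n\<close>: the group
  of cosets \<open>gr_comp\<close>, and the families supported in degree \<open>n\<close> that form
  \<open>gr_degree\<close>.\<close>

lemma graded_iso_above_\<Phi>:
  assumes iso: "\<And>n. n \<ge> N \<Longrightarrow> gr_map S J h n \<in> iso (gr_comp R I n) (gr_comp S J n)"
  shows "graded_iso_above A.G (gr_degree R I) A.hcomp B.G (gr_degree S J) B.hcomp \<Phi> N"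
proof (intro graded_iso_above.intro graded_iso_above_axioms.intro A.graded_cring_G B.graded_cring_G \<Phi>_hom)
  fix f n assume f: "f \<in> carrier A.G"
  show "\<Phi> (A.hcomp n f) = B.hcomp n (\<Phi> f)"
    by (rule ext) (simp add: \<Phi>_def A.hcomp_def B.hcomp_def gr_map_cls)
next
  fix n assume n: "n \<ge> N"
  have inj: "inj_on (gr_map S J h n) (A.cls n ` A.pw n)"
    and surj: "gr_map S J h n ` (A.cls n ` A.pw n) = B.cls n ` B.pw n"
    using iso[OF n] unfolding iso_def bij_betw_def A.gr_carrier B.gr_carrier by auto
  have eqA: "A.\<Gamma> (A.single n x) = A.\<Gamma> (A.single n y) \<longleftrightarrow> A.cls n x = A.cls n y" for x y
    by (auto simp: A.\<Gamma>_def A.single_def fun_eq_iff)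
  have eqB: "B.\<Gamma> (B.single n x) = B.\<Gamma> (B.single n y) \<longleftrightarrow> B.cls n x = B.cls n y" for x y
    by (auto simp: B.\<Gamma>_def B.single_def fun_eq_iff)
  show "bij_betw \<Phi> (gr_degree R I n) (gr_degree S J n)"
  proof (rule bij_betw_imageI)
    show "inj_on \<Phi> (gr_degree R I n)"
    proof (rule inj_onI)
      fix f g assume "f \<in> gr_degree R I n" "g \<in> gr_degree R I n" and eq: "\<Phi> f = \<Phi> g"
      then obtain x y where x: "x \<in> A.pw n" "f = A.\<Gamma> (A.single n x)"
        and y: "y \<in> A.pw n" "g = A.\<Gamma> (A.single n y)" unfolding A.degree_iff_single by blast
      have "B.cls n (h x) = B.cls n (h y)"
        using eq unfolding x(2) y(2) \<Phi>_single[OF x(1)] \<Phi>_single[OF y(1)] eqB .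
      then have "gr_map S J h n (A.cls n x) = gr_map S J h n (A.cls n y)"
        using gr_map_cls A.pw_carrier x(1) y(1) by simp
      then have "A.cls n x = A.cls n y" using inj_onD[OF inj] x(1) y(1) by blast
      then show "f = g" unfolding x(2) y(2) eqA .
    qed
    show "\<Phi> ` gr_degree R I n = gr_degree S J n"
    proof (intro subset_antisym subsetI)
      fix g assume "g \<in> \<Phi> ` gr_degree R I n"
      then obtain f where "f \<in> gr_degree R I n" "g = \<Phi> f" by blast
      then obtain x where x: "x \<in> A.pw n" "g = \<Phi> (A.\<Gamma> (A.single n x))"
        unfolding A.degree_iff_single by blast
      then show "g \<in> gr_degree S J n"
        unfolding B.degree_iff_single x(2) \<Phi>_single[OF x(1)] using hom_pw[OF x(1)] by blast
    next
      fix g assume "g \<in> gr_degree S J n"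
      then obtain y where y: "y \<in> B.pw n" "g = B.\<Gamma> (B.single n y)"
        unfolding B.degree_iff_single by blast
      have "B.cls n y \<in> gr_map S J h n ` (A.cls n ` A.pw n)" unfolding surj using y(1) by blast
      then obtain x where x: "x \<in> A.pw n" "B.cls n y = gr_map S J h n (A.cls n x)" by blast
      then have "B.cls n (h x) = B.cls n y" using gr_map_cls[OF A.pw_carrier[OF x(1)]] by simp
      then have "\<Phi> (A.\<Gamma> (A.single n x)) = g" unfolding \<Phi>_single[OF x(1)] y(2) eqB .
      moreover have "A.\<Gamma> (A.single n x) \<in> gr_degree R I n"
        unfolding A.degree_iff_single using x(1) by blast
      ultimately show "g \<in> \<Phi> ` gr_degree R I n" by blast
    qed
  qed
qed

text \<open>Surjectivity is asked of the powers themselves and not only modulo the next power; this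
  is the form in which \<open>powers_eventually_equal\<close> supplies it.\<close>

lemma gr_map_iso:
  assumes inj: "\<And>x. x \<in> A.pw n \<Longrightarrow> h x \<in> B.pw (Suc n) \<Longrightarrow> x \<in> A.pw (Suc n)"
    and surj: "B.pw n \<subseteq> h ` A.pw n"
  shows "gr_map S J h n \<in> iso (gr_comp R I n) (gr_comp S J n)"
proof -
  note c = A.pw_carrier[of _ n]
  have "gr_map S J h n \<in> hom (gr_comp R I n) (gr_comp S J n)"
  proof (rule homI)
    fix E D assume "E \<in> carrier (gr_comp R I n)" "D \<in> carrier (gr_comp R I n)"
    then obtain x y where x: "x \<in> A.pw n" "E = A.cls n x" and y: "y \<in> A.pw n" "D = A.cls n y"
      unfolding A.gr_carrier by blast
    show "gr_map S J h n E \<in> carrier (gr_comp S J n)"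
      unfolding x(2) gr_map_cls[OF c[OF x(1)]] B.gr_carrier using hom_pw[OF x(1)] by blast
    show "gr_map S J h n (E \<otimes>\<^bsub>gr_comp R I n\<^esub> D) = gr_map S J h n E \<otimes>\<^bsub>gr_comp S J n\<^esub> gr_map S J h n D"
      unfolding x(2) y(2) using c[OF x(1)] c[OF y(1)] by (simp add: gr_map_cls A.gr_mult B.gr_mult)
  qed
  moreover have "inj_on (gr_map S J h n) (carrier (gr_comp R I n))"
  proof (rule inj_onI)
    fix E D assume XY: "E \<in> carrier (gr_comp R I n)" "D \<in> carrier (gr_comp R I n)"
      and eq: "gr_map S J h n E = gr_map S J h n D"
    then obtain x y where x: "x \<in> A.pw n" "E = A.cls n x" and y: "y \<in> A.pw n" "D = A.cls n y"
      unfolding A.gr_carrier by blast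
    have "B.cls n (h x) = B.cls n (h y)"
      using eq unfolding x(2) y(2) gr_map_cls[OF c[OF x(1)]] gr_map_cls[OF c[OF y(1)]] .
    then have "h (x \<ominus> y) \<in> B.pw (Suc n)"
      using B.cls_eq_iff[of "h x" "h y" n] c[OF x(1)] c[OF y(1)] by (simp add: A.minus_eq B.minus_eq)
    moreover have "x \<ominus> y \<in> A.pw n" using A.pw_add A.pw_neg x(1) y(1) by (simp add: A.minus_eq)
    ultimately have "x \<ominus> y \<in> A.pw (Suc n)" using inj by blast
    then show "E = D" unfolding x(2) y(2) using A.cls_eq_iff[OF c[OF x(1)] c[OF y(1)]] by blast
  qed
  moreover have "gr_map S J h n ` carrier (gr_comp R I n) = carrier (gr_comp S J n)"
  proof (intro subset_antisym subsetI)
    fix D assume "D \<in> gr_map S J h n ` carrier (gr_comp R I n)"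
    then show "D \<in> carrier (gr_comp S J n)"
      using gr_map_cls c hom_pw unfolding A.gr_carrier B.gr_carrier by auto
  next
    fix D assume "D \<in> carrier (gr_comp S J n)"
    then obtain y where "y \<in> B.pw n" "D = B.cls n y" unfolding B.gr_carrier by blast
    then obtain x where x: "x \<in> A.pw n" "D = B.cls n (h x)" using surj by blast
    then have "D = gr_map S J h n (A.cls n x)" using gr_map_cls[OF c[OF x(1)]] by simp
    then show "D \<in> gr_map S J h n ` carrier (gr_comp R I n)" unfolding A.gr_carrier using x(1) by blast
  qed
  ultimately show ?thesis unfolding iso_def bij_betw_def by blast
qed

end

text \<open>The largest ideal inside the additive subgroup \<open>H\<close>. Images of powers of
  \<open>I\<close> are mere subgroups of \<open>S\<close>; that such a subgroup contains a generated
  ideal can be tested on generators through this core.\<close>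

lemma (in cring) ideal_core:
  assumes E: "\<zero> \<in> H" "\<And>x y. x \<in> H \<Longrightarrow> y \<in> H \<Longrightarrow> x \<oplus> y \<in> H" "\<And>x. x \<in> H \<Longrightarrow> \<ominus> x \<in> H"
  shows "ideal {v \<in> carrier R. \<forall>b \<in> carrier R. v \<otimes> b \<in> H} R"
proof (rule idealI[OF ring_axioms])
  let ?Z = "{v \<in> carrier R. \<forall>b \<in> carrier R. v \<otimes> b \<in> H}"
  show "subgroup ?Z (add_monoid R)"
  proof (rule add.subgroupI)
    show "?Z \<noteq> {}" using E(1) by (auto intro!: exI[of _ \<zero>])
    show "\<ominus> v \<in> ?Z" if "v \<in> ?Z" for v using that E(3) by (simp add: l_minus)
    show "v \<oplus> w \<in> ?Z" if "v \<in> ?Z" "w \<in> ?Z" for v w using that E(2) by (simp add: l_distr)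
  qed blast
  fix v r assume v: "v \<in> ?Z" and r: "r \<in> carrier R"
  show 1: "v \<otimes> r \<in> ?Z" using v r by (simp add: m_assoc)
  show "r \<otimes> v \<in> ?Z" using 1 m_comm[of v r] v r by simp
qed

section \<open>Powers of the extended ideal\<close>

context ideal_hom begin

lemma extended_power_subset:
  assumes J: "J = genideal S (h ` I)"
  shows "B.pw n \<subseteq> genideal S (h ` A.pw n)"
proof (induction n)
  case 0
  have sub: "h ` carrier R \<subseteq> carrier S" by auto
  have "h \<one> \<in> genideal S (h ` carrier R)" using B.genideal_self[OF sub] by blast
  then have "genideal S (h ` carrier R) = carrier S"
    using ideal.one_imp_carrier[OF B.genideal_ideal[OF sub]] by simp
  then show ?case by simp
next
  case (Suc n)
  have sub: "h ` A.pw k \<subseteq> carrier S" for k using A.pw_carrier by auto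
  have subI: "h ` I \<subseteq> carrier S" using ideal.Icarr[OF A.ideal] by auto
  interpret K: ideal "genideal S (h ` A.pw (Suc n))" S by (rule B.genideal_ideal[OF sub])
  have uv: "u \<otimes>\<^bsub>S\<^esub> v \<in> genideal S (h ` A.pw (Suc n))" if "u \<in> B.pw n" "v \<in> J" for u v
  proof (rule B.Idl_mult[OF K.is_ideal sub[of n] subI])
    show "u \<in> genideal S (h ` A.pw n)" "v \<in> genideal S (h ` I)" using Suc that J by auto
    fix a b assume "a \<in> h ` A.pw n" "b \<in> h ` I"
    then obtain x y where x: "x \<in> A.pw n" "a = h x" and y: "y \<in> I" "b = h y" by blast
    have "x \<otimes> y \<in> A.pw (Suc n)"
      using ideal_prod.prod[OF x(1) y(1), of R] by (simp add: ideal_power.simps(2))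
    moreover have "a \<otimes>\<^bsub>S\<^esub> b = h (x \<otimes> y)"
      unfolding x(2) y(2) using A.pw_carrier[OF x(1)] ideal.Icarr[OF A.ideal y(1)] by simp
    ultimately show "a \<otimes>\<^bsub>S\<^esub> b \<in> genideal S (h ` A.pw (Suc n))" using B.genideal_self[OF sub] by blast
  qed
  have "z \<in> genideal S (h ` A.pw (Suc n))" if "z \<in> ideal_prod S (B.pw n) J" for z
    using that by (induction z rule: ideal_prod.induct) (auto intro: uv K.a_closed)
  then show ?case by (auto simp: ideal_power.simps(2))
qed

lemma image_subgroup:
  "\<zero>\<^bsub>S\<^esub> \<in> h ` A.pw n"
  "x \<in> h ` A.pw n \<Longrightarrow> y \<in> h ` A.pw n \<Longrightarrow> x \<oplus>\<^bsub>S\<^esub> y \<in> h ` A.pw n"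
  "x \<in> h ` A.pw n \<Longrightarrow> \<ominus>\<^bsub>S\<^esub> x \<in> h ` A.pw n"
proof -
  show "\<zero>\<^bsub>S\<^esub> \<in> h ` A.pw n" by (rule image_eqI[OF _ A.pw_zero]) simp
  show "x \<oplus>\<^bsub>S\<^esub> y \<in> h ` A.pw n" if xy: "x \<in> h ` A.pw n" "y \<in> h ` A.pw n"
  proof -
    obtain a b where a: "a \<in> A.pw n" "x = h a" and b: "b \<in> A.pw n" "y = h b" using xy by blast
    then have "x \<oplus>\<^bsub>S\<^esub> y = h (a \<oplus> b)" using A.pw_carrier by simp
    then show ?thesis using A.pw_add[OF a(1) b(1)] by blast
  qed
  show "\<ominus>\<^bsub>S\<^esub> x \<in> h ` A.pw n" if x: "x \<in> h ` A.pw n"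
  proof -
    obtain a where a: "a \<in> A.pw n" "x = h a" using x by blast
    then have "\<ominus>\<^bsub>S\<^esub> x = h (\<ominus> a)" using A.pw_carrier by simp
    then show ?thesis using A.pw_neg[OF a(1)] by blast
  qed
qed

text \<open>If \<open>I\<^sup>k\<close> lies in the conductor, then \<open>(I S)\<^sup>k\<^sup>+\<^sup>j \<subseteq> I\<^sup>j\<close>.\<close>

lemma extended_power_subset_image:
  assumes J: "J = genideal S (h ` I)"
    and cond: "\<And>x b. x \<in> A.pw k \<Longrightarrow> b \<in> carrier S \<Longrightarrow> h x \<otimes>\<^bsub>S\<^esub> b \<in> h ` carrier R"
  shows "B.pw (k + j) \<subseteq> h ` A.pw j"
proof (induction j)
  case 0
  \<comment> \<open>This is the conductor of h(R), seen as an ideal of \<open>S\<close>. It contains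
    h(I^k), and thus the k-th power of \<open>J\<close>.\<close>
  let ?Z = "{v \<in> carrier S. \<forall>b \<in> carrier S. v \<otimes>\<^bsub>S\<^esub> b \<in> h ` A.pw 0}"
  have Z: "ideal ?Z S" by (rule B.ideal_core) (rule image_subgroup; assumption)+
  have "h ` A.pw k \<subseteq> ?Z" using cond A.pw_carrier by auto
  then have "genideal S (h ` A.pw k) \<subseteq> ?Z" by (rule B.genideal_minimal[OF Z])
  then have Z: "B.pw k \<subseteq> ?Z" using extended_power_subset[OF J] by (rule subset_trans[rotated])
  show ?case
  proof
    fix y assume "y \<in> B.pw (k + 0)"
    then have "y \<in> ?Z" using Z by auto
    then have "y \<otimes>\<^bsub>S\<^esub> \<one>\<^bsub>S\<^esub> \<in> h ` A.pw 0" "y \<in> carrier S" by blast+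
    then show "y \<in> h ` A.pw 0" by simp
  qed
next
  case (Suc j)
  have uv: "u \<otimes>\<^bsub>S\<^esub> v \<in> h ` A.pw (Suc j)" if u: "u \<in> B.pw (k + j)" and v: "v \<in> J" for u v
  proof -
    have uc: "u \<in> carrier S" by (rule B.pw_carrier[OF u])
    \<comment> \<open>With \<open>u\<close> fixed, generators of \<open>J\<close> suffice: u (h x b)
      = (u b) h x, and u b stays in the power k + j of \<open>J\<close>, where the induction
      hypothesis applies.\<close>
    let ?H = "{w \<in> carrier S. u \<otimes>\<^bsub>S\<^esub> w \<in> h ` A.pw (Suc j)}"
    let ?Z = "{v \<in> carrier S. \<forall>b \<in> carrier S. v \<otimes>\<^bsub>S\<^esub> b \<in> ?H}"
    have Z: "ideal ?Z S"
    proof (rule B.ideal_core)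
      show "\<zero>\<^bsub>S\<^esub> \<in> ?H" using uc image_subgroup(1) by simp
      show "x \<oplus>\<^bsub>S\<^esub> y \<in> ?H" if "x \<in> ?H" "y \<in> ?H" for x y
        using that uc image_subgroup(2) by (simp add: B.r_distr)
      show "\<ominus>\<^bsub>S\<^esub> x \<in> ?H" if "x \<in> ?H" for x
        using that uc image_subgroup(3) by (simp add: B.r_minus)
    qed
    have "h ` I \<subseteq> ?Z"
    proof
      fix w assume "w \<in> h ` I"
      then obtain x where x: "x \<in> I" "w = h x" by blast
      have xc: "x \<in> carrier R" by (rule ideal.Icarr[OF A.ideal x(1)])
      have "u \<otimes>\<^bsub>S\<^esub> (w \<otimes>\<^bsub>S\<^esub> b) \<in> h ` A.pw (Suc j)" if b: "b \<in> carrier S" for b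
      proof -
        have "u \<otimes>\<^bsub>S\<^esub> b \<in> B.pw (k + j)" by (rule ideal.I_r_closed[OF B.pw_ideal u b])
        then obtain a where a: "a \<in> A.pw j" "u \<otimes>\<^bsub>S\<^esub> b = h a" using Suc by blast
        have "u \<otimes>\<^bsub>S\<^esub> (w \<otimes>\<^bsub>S\<^esub> b) = (u \<otimes>\<^bsub>S\<^esub> b) \<otimes>\<^bsub>S\<^esub> w"
          using uc b xc x(2) by (simp add: B.m_ac)
        also have "\<dots> = h (a \<otimes> x)" using a x(2) xc A.pw_carrier by simp
        finally show ?thesis
          using ideal_prod.prod[OF a(1) x(1), of R] by (simp add: ideal_power.simps(2))
      qed
      then show "w \<in> ?Z" using x(2) xc by simp
    qed
    then have "v \<in> ?Z" using B.genideal_minimal[OF Z] v J by blast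
    then have "v \<otimes>\<^bsub>S\<^esub> \<one>\<^bsub>S\<^esub> \<in> ?H" "v \<in> carrier S" by blast+
    then show ?thesis by simp
  qed
  have "z \<in> h ` A.pw (Suc j)" if "z \<in> ideal_prod S (B.pw (k + j)) J" for z
    using that by (induction z rule: ideal_prod.induct) (auto intro: uv image_subgroup(2))
  then show ?case by (auto simp: ideal_power.simps(2))
qed

lemma powers_eventually_equal:
  assumes noeth: "noetherian_ring R" and loc: "local_ring R I"
    and J: "J = genideal S (h ` I)" and inj: "inj_on h (carrier R)"
    and red: "reduced_space (Proj A.G (gr_degree R I))"
    and cond: "\<And>x b. x \<in> A.pw k \<Longrightarrow> b \<in> carrier S \<Longrightarrow> h x \<otimes>\<^bsub>S\<^esub> b \<in> h ` carrier R"
  shows "\<exists>N. \<forall>n\<ge>N. (\<forall>x \<in> A.pw n. h x \<in> B.pw (Suc n) \<longrightarrow> x \<in> A.pw (Suc n)) \<and> B.pw n \<subseteq> h ` A.pw n"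
proof -
  obtain x and r :: nat where x: "x \<in> {..<r} \<rightarrow> carrier R" and I: "I = genideal R (x ` {..<r})"
    by (rule noetherian_ring.ideal_gensE[OF noeth A.ideal])
  have xI: "x i \<in> I" if "i < r" for i
    unfolding I using that x A.genideal_self[of "x ` {..<r}"] by auto
  note sub = extended_power_subset_image[OF J cond]
  have torsion: "\<exists>N. \<forall>N'\<ge>N. \<forall>a \<in> A.pw N'. a \<otimes> f \<in> A.pw (Suc (n + N'))"
    if f: "f \<in> A.pw n" and hf: "h f \<in> B.pw (Suc n)" for f n
  proof -
    have fc: "f \<in> carrier R" by (rule A.pw_carrier[OF f])
    \<comment> \<open>The exponent k + 1 makes up for the loss of k: since (n + 1)(k + 1) = k + (n
      (k + 1) + 1), one power more than n (k + 1) survives.\<close>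
    have "h f [^]\<^bsub>S\<^esub> Suc k \<in> B.pw (Suc n * Suc k)" by (rule B.ideal_power_pow[OF B.ideal hf])
    moreover have "Suc n * Suc k = k + Suc (n * Suc k)" by simp
    ultimately have "h f [^]\<^bsub>S\<^esub> Suc k \<in> h ` A.pw (Suc (n * Suc k))" using sub by (metis subsetD)
    moreover have "h (f [^] j) = h f [^]\<^bsub>S\<^esub> j" for j :: nat
      by (induction j) (use fc in auto)
    ultimately have "h (f [^] Suc k) \<in> h ` A.pw (Suc (n * Suc k))" by (simp only:)
    then obtain w where w: "w \<in> A.pw (Suc (n * Suc k))" "h (f [^] Suc k) = h w" by blast
    have "f [^] Suc k = w"
      by (rule inj_onD[OF inj w(2)]) (use fc A.pw_carrier[OF w(1)] in auto)
    then have nil: "f [^] Suc k \<in> A.pw (Suc (n * Suc k))" using w(1) by simp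
    have "\<exists>e::nat. x i [^] e \<otimes> f \<in> A.pw (Suc (e + n))" if "i < r" for i
      by (rule A.Proj_reduced_imp_killed[OF red xI[OF that] f nil])
    then obtain e :: "nat \<Rightarrow> nat"
      where e: "\<And>i. i < r \<Longrightarrow> x i [^] e i \<otimes> f \<in> A.pw (Suc (e i + n))" by metis
    show ?thesis
    \<comment> \<open>Each generator kills the class of \<open>f\<close> with its own exponent. A
      monomial of degree above the sum of these exponents is divisible by one of the powers
      concerned, and such monomials generate the power of the ideal.\<close>
    proof (intro exI[of _ "Suc (\<Sum>i<r. e i)"] allI impI ballI)
      fix N a assume N: "Suc (\<Sum>i<r. e i) \<le> N" and a: "a \<in> A.pw N"
      show "a \<otimes> f \<in> A.pw (Suc (n + N))"
      proof (rule A.Idl_mult_right[OF A.pw_ideal _ fc _ a[unfolded A.ideal_power_eq_Idl_mon[OF x I]]])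
        show "A.mon x r ` monoms r N \<subseteq> carrier R" using A.mon_closed[OF x] by blast
        fix b assume "b \<in> A.mon x r ` monoms r N"
        then obtain M where M: "M \<in> monoms r N" "b = A.mon x r M" by blast
        obtain i M' where i: "i < r" "M' \<in> monoms r (N - e i)" "e i \<le> N"
          "A.mon x r M = A.mon x r M' \<otimes> x i [^] e i"
          using A.mon_pigeonhole[OF x I M(1), of e] N by (metis Suc_le_eq)
        have xc: "x i \<in> carrier R" using funcset_mem[OF x] i(1) by simp
        have "A.mon x r M' \<otimes> (x i [^] e i \<otimes> f) \<in> A.pw ((N - e i) + Suc (e i + n))"
          by (rule A.pw_mult[OF A.mon_in_ideal_power[OF x I i(2)] e[OF i(1)]])
        moreover have "(N - e i) + Suc (e i + n) = Suc (n + N)" using i(3) by simp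
        ultimately show "b \<otimes> f \<in> A.pw (Suc (n + N))"
          unfolding M(2) i(4) using A.mon_closed[OF x] xc fc by (simp add: A.m_assoc add.commute)
      qed
    qed
  qed
  obtain n0 where n0: "n < n0" if "n \<in> {n. \<exists>f \<in> A.pw n - A.pw (Suc n).
    \<exists>N. \<forall>N'\<ge>N. \<forall>a \<in> A.pw N'. a \<otimes> f \<in> A.pw (Suc (n + N'))}" for n
    using A.finite_degrees_of_torsion[OF noeth loc] unfolding finite_nat_set_iff_bounded by blast
  have inj_high: "f \<in> A.pw (Suc n)" if "n \<ge> n0" "f \<in> A.pw n" "h f \<in> B.pw (Suc n)" for n f
  proof (rule ccontr)
    assume "f \<notin> A.pw (Suc n)"
    then have "n < n0" using that(2) torsion[OF that(2,3)] by (intro n0) blast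
    then show False using that(1) by simp
  qed
  have "B.pw n \<subseteq> h ` A.pw n" if n: "n \<ge> n0 + k" for n
  proof
    fix y assume y: "y \<in> B.pw n"
    have "y \<in> B.pw (k + (n - k))" using y n by simp
    then obtain f where f: "f \<in> A.pw (n - k)" "y = h f" using sub by blast
    \<comment> \<open>The k powers lost to the conductor are regained one at a time: h f = y lies in
      the n-th power of \<open>J\<close>, hence in all lower ones, and the degrees n - k + i are at
      least \<open>n0\<close>, where \<open>inj_high\<close> applies.\<close>
    have "f \<in> A.pw (n - k + i)" if "i \<le> k" for i
      using that
    proof (induction i)
      case 0
      then show ?case using f(1) by simp
    next
      case (Suc i)
      have "h f \<in> B.pw (Suc (n - k + i))"
      proof -
        have "Suc (n - k + i) \<le> n" using Suc.prems n by linarith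
        from B.ideal_power_antimono[OF B.ideal this] show ?thesis using y f(2) by auto
      qed
      then show ?case using inj_high[of "n - k + i" f] Suc n by simp
    qed
    from this[of k] show "y \<in> h ` A.pw n" using f(2) n by simp
  qed
  then show ?thesis using inj_high by (intro exI[of _ "n0 + k"]) simp
qed

end

text \<open>Every generator of \<open>m\<close> has a power in \<open>C\<close>, and a monomial
  whose degree exceeds the sum of these exponents is divisible by one of these powers.\<close>

lemma radical_imp_power_subset:
  assumes noeth: "noetherian_ring A" and "cring A" and m: "ideal m A"
    and C: "ideal C A" and rad: "m \<subseteq> radical A C"
  shows "\<exists>k. ideal_power A m k \<subseteq> C"
proof -
  interpret A: cring A by fact
  obtain x and r :: nat where x: "x \<in> {..<r} \<rightarrow> carrier A" and m_eq: "m = genideal A (x ` {..<r})"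
    by (rule noetherian_ring.ideal_gensE[OF noeth m])
  have "\<exists>e::nat. x i [^]\<^bsub>A\<^esub> e \<in> C" if "i < r" for i
  proof -
    have "x i \<in> m" unfolding m_eq using that x A.genideal_self[of "x ` {..<r}"] by auto
    then show ?thesis using rad unfolding radical_def by blast
  qed
  then obtain e :: "nat \<Rightarrow> nat" where e: "\<And>i. i < r \<Longrightarrow> x i [^]\<^bsub>A\<^esub> e i \<in> C" by metis
  let ?k = "Suc (\<Sum>i<r. e i)"
  have "A.mon x r M \<in> C" if M: "M \<in> monoms r ?k" for M
  proof -
    obtain i M' where "i < r" "A.mon x r M = A.mon x r M' \<otimes>\<^bsub>A\<^esub> x i [^]\<^bsub>A\<^esub> e i"
      using A.mon_pigeonhole[OF x m_eq M, of e] by (metis lessI)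
    then show ?thesis using ideal.I_l_closed[OF C e] A.mon_closed[OF x] by simp
  qed
  then have "ideal_power A m ?k \<subseteq> C"
    unfolding A.ideal_power_eq_Idl_mon[OF x m_eq] by (intro A.genideal_minimal[OF C]) blast
  then show ?thesis by blast
qed

theorem proposition1:
  fixes A :: "('a, 'c) ring_scheme" and m :: "'a set"
  assumes "noetherian_ring A" and "local_ring A m"
  shows "(reduced_space (Proj (assoc_graded A m) (gr_degree A m)) \<and> radical A (conductor A) = m
            \<longrightarrow> (\<exists>N. \<forall>n \<ge> N. nu A m n \<in> iso (gr_comp A m n)
                    (gr_comp (normalization A) (extend_ideal A m) n)))
       \<and> ((\<exists>N. \<forall>n \<ge> N. nu A m n \<in> iso (gr_comp A m n)
                    (gr_comp (normalization A) (extend_ideal A m) n))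
            \<longrightarrow> isomorphic_spaces (Proj (assoc_graded A m) (gr_degree A m))
                  (Proj (assoc_graded (normalization A) (extend_ideal A m))
                        (gr_degree (normalization A) (extend_ideal A m))))"
proof -
  have cring: "cring A" and max: "maximalideal m A" using assms(2) by (auto simp: local_ring_def)
  interpret A: cring A by (rule cring)
  have m: "ideal m A" by (rule maximalideal.axioms(1)[OF max])
  \<comment> \<open>As \<open>m\<close> is proper, \<open>A\<close> is not the zero ring, which the
    results on integral closure require.\<close>
  have ne: "\<one>\<^bsub>A\<^esub> \<noteq> \<zero>\<^bsub>A\<^esub>"
    using maximalideal.I_notcarr[OF max] ideal.one_imp_carrier[OF m]
      additive_subgroup.zero_closed[OF ideal.axioms(1)[OF m]] by metis
  let ?B = "normalization A" and ?J = "extend_ideal A m" and ?h = "to_fractions A"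
  interpret B: cring ?B by (rule cring_normalization[OF assms(1) cring ne])
  have hom: "?h \<in> ring_hom A ?B" by (rule to_fractions_normalization_hom[OF assms(1) cring ne])
  have sub: "?h ` m \<subseteq> carrier ?B" using ring_hom_closed[OF hom] ideal.Icarr[OF m] by blast
  interpret H: ideal_hom A m ?B ?J ?h
  proof (intro ideal_hom.intro ideal_hom_axioms.intro cring_ideal.intro cring_ideal_axioms.intro
      cring m hom B.is_cring)
    show "ideal ?J ?B" unfolding extend_ideal_def by (rule B.genideal_ideal[OF sub])
    show "?h x \<in> ?J" if "x \<in> m" for x
      unfolding extend_ideal_def using that B.genideal_self[OF sub] by blast
  qed
  have "\<exists>N. \<forall>n\<ge>N. nu A m n \<in> iso (gr_comp A m n) (gr_comp ?B ?J n)"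
    if red: "reduced_space (Proj (assoc_graded A m) (gr_degree A m))"
      and rad: "radical A (conductor A) = m"
  proof -
    \<comment> \<open>The conductor is the contraction to \<open>A\<close> of the largest ideal of
      the normalization inside the image of \<open>A\<close>; \<open>H.A.pw 0\<close> is all of
      \<open>A\<close>.\<close>
    have "ideal {v \<in> carrier ?B. \<forall>b \<in> carrier ?B. v \<otimes>\<^bsub>?B\<^esub> b \<in> ?h ` H.A.pw 0} ?B"
      by (rule B.ideal_core) (rule H.image_subgroup; assumption)+
    then have "ideal {a \<in> carrier A.
        ?h a \<in> {v \<in> carrier ?B. \<forall>b \<in> carrier ?B. v \<otimes>\<^bsub>?B\<^esub> b \<in> ?h ` H.A.pw 0}} A"
      by (rule ring_hom_ring.ideal_vimage[OF ring_hom_ringI2[OF A.ring_axioms B.ring_axioms hom]])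
    moreover have "{a \<in> carrier A.
        ?h a \<in> {v \<in> carrier ?B. \<forall>b \<in> carrier ?B. v \<otimes>\<^bsub>?B\<^esub> b \<in> ?h ` H.A.pw 0}} = conductor A"
      unfolding conductor_def using ring_hom_closed[OF hom] by auto
    ultimately have "ideal (conductor A) A" by (simp only:)
    then obtain k where k: "ideal_power A m k \<subseteq> conductor A"
      using radical_imp_power_subset[OF assms(1) cring m] rad by blast
    have "?h x \<otimes>\<^bsub>?B\<^esub> b \<in> ?h ` carrier A" if "x \<in> ideal_power A m k" "b \<in> carrier ?B" for x b
      using k that unfolding conductor_def by blast
    then obtain N where N: "\<And>n. n \<ge> N \<Longrightarrow>
        (\<forall>x \<in> H.A.pw n. ?h x \<in> H.B.pw (Suc n) \<longrightarrow> x \<in> H.A.pw (Suc n)) \<and> H.B.pw n \<subseteq> ?h ` H.A.pw n"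
      using H.powers_eventually_equal[OF assms _ A.to_fractions_inj red, of k]
      unfolding extend_ideal_def by blast
    have "nu A m n \<in> iso (gr_comp A m n) (gr_comp ?B ?J n)" if "n \<ge> N" for n
      unfolding nu_def by (rule H.gr_map_iso) (use N[OF that] in blast)+
    then show ?thesis by blast
  qed
  moreover have "isomorphic_spaces (Proj (assoc_graded A m) (gr_degree A m))
      (Proj (assoc_graded ?B ?J) (gr_degree ?B ?J))"
    if iso: "\<exists>N. \<forall>n\<ge>N. nu A m n \<in> iso (gr_comp A m n) (gr_comp ?B ?J n)"
  proof -
    obtain N where N: "\<And>n. n \<ge> N \<Longrightarrow> nu A m n \<in> iso (gr_comp A m n) (gr_comp ?B ?J n)"
      using iso by blast
    show ?thesis
      by (rule graded_iso_above.isomorphic_Proj[OF H.graded_iso_above_\<Phi>[OF N[unfolded nu_def]]])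
  qed
  ultimately show ?thesis by blast
qed

end
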